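(* Let $\mathcal{Q}$ be a Dynkin quiver. For all $M$ in $\bmod\,k\mathcal{Q}$ the following holds: (1) both the projective and the injective dimension of $\widehat{M}$ in $\bmod\,\mathcal{H}_{\mathcal{Q}}^{\rm op}$ are at most one; (2) ${\rm Ext}^1(\widehat{M},\widehat{M})=0$ in $\bmod\,\mathcal{H}_{\mathcal{Q}}^{\rm op}$.
   Context: Let $k$ be a field, $\mathcal{Q}$ a Dynkin quiver (an orientation of a simply laced Dynkin diagram), $k\mathcal{Q}$ its path algebra, $\bmod\,k\mathcal{Q}$ the category of finite dimensional left $k\mathcal{Q}$-modules, identified with finite dimensional representations of $\mathcal{Q}$, and ${\rm proj}\,k\mathcal{Q}$ the full subcategory of projectives. ${\rm Hom}^{\rm mono}({\rm proj}\,k\mathcal{Q})$ is the category whose objects are injective maps $\iota:P\to Q$ between objects of ${\rm proj}\,k\mathcal{Q}$, with morphisms from $\iota:P\to Q$ to $\iota':P'\to Q'$ the pairs $(\varphi:P\to P',\psi:Q\to Q')$ with $\psi\iota=\iota'\varphi$. $\mathcal{H}_{\mathcal{Q}}$ is the full subcategory of objects without (nonzero) direct summands of the form $0\to P$. $\bmod\,\mathcal{H}_{\mathcal{Q}}^{\rm op}$ is the category of $k$-linear additive contravariant functors from $\mathcal{H}_{\mathcal{Q}}$ to finite dimensional $k$-vector spaces. For $M\in\bmod\,k\mathcal{Q}$, the functor $\widehat{M}\in\bmod\,\mathcal{H}_{\mathcal{Q}}^{\rm op}$ is defined by $\widehat{M}(\iota:P\to Q)={\rm Im}\big({\rm Hom}(\iota,M):{\rm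 Hom}(Q,M)\to{\rm Hom}(P,M)\big)$, with the natural definition on morphisms. *)

theory Defs
  imports
    "HOL-Library.Function_Algebras"
    "HOL-Library.Product_Plus"
    "HOL-Library.Extended_Nat"
    "Graph_Theory.Digraph"
begin

text \<open>A finite-dimensional vector space is a finitely spanned subspace of an ambient vector space
  with scalar multiplication \<open>s\<close>.  If the ambient space is infinite-dimensional, every
  finite-dimensional vector space occurs up to isomorphism.  A linear map between two subspaces is
  a function on the ambient type that vanishes outside its domain, so that equality of maps is
  equality of functions, sums of maps are pointwise sums, and composites are \<open>\<circ>\<close>.\<close>

definition fin_dim :: "('k::field \<Rightarrow> 'w::ab_group_add \<Rightarrow> 'w) \<Rightarrow> 'w set \<Rightarrow> bool" where
  "fin_dim s V \<longleftrightarrow> (\<exists>B. finite B \<and> V = module.span s B)"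

definition lin :: "('k::field \<Rightarrow> 'w::ab_group_add \<Rightarrow> 'w) \<Rightarrow> 'w set \<Rightarrow> 'w set \<Rightarrow> ('w \<Rightarrow> 'w) set" where
  "lin s V W = {f. f ` V \<subseteq> W
     \<and> (\<forall>x\<in>V. \<forall>y\<in>V. f (x + y) = f x + f y)
     \<and> (\<forall>c. \<forall>x\<in>V. f (s c x) = s c (f x))
     \<and> (\<forall>x. x \<notin> V \<longrightarrow> f x = 0)}"

definition id_on :: "'w::zero set \<Rightarrow> 'w \<Rightarrow> 'w" where
  "id_on V = (\<lambda>x. if x \<in> V then x else 0)"

text \<open>Families of linear maps indexed by \<open>I\<close>; they are zero at indices outside \<open>I\<close>.\<close>

definition lin_fam ::
  "('k::field \<Rightarrow> 'w::ab_group_add \<Rightarrow> 'w) \<Rightarrow> 'i set \<Rightarrow> ('i \<Rightarrow> 'w set) \<Rightarrow> ('i \<Rightarrow> 'w set) \<Rightarrow> ('i \<Rightarrow> 'w \<Rightarrow> 'w) set"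
where
  "lin_fam s I V W = {f. (\<forall>i\<in>I. f i \<in> lin s (V i) (W i)) \<and> (\<forall>i. i \<notin> I \<longrightarrow> f i = 0)}"

definition id_fam :: "'i set \<Rightarrow> ('i \<Rightarrow> 'w::zero set) \<Rightarrow> 'i \<Rightarrow> 'w \<Rightarrow> 'w" where
  "id_fam I V = (\<lambda>i. if i \<in> I then id_on (V i) else 0)"

definition comp_fam :: "('i \<Rightarrow> 'w \<Rightarrow> 'w) \<Rightarrow> ('i \<Rightarrow> 'w \<Rightarrow> 'w) \<Rightarrow> 'i \<Rightarrow> 'w \<Rightarrow> 'w" (infixr "\<circ>\<circ>" 55) where
  "g \<circ>\<circ> f = (\<lambda>i. g i \<circ> f i)"

definition scale_fam :: "('k \<Rightarrow> 'w \<Rightarrow> 'w) \<Rightarrow> 'k \<Rightarrow> ('i \<Rightarrow> 'w \<Rightarrow> 'w) \<Rightarrow> 'i \<Rightarrow> 'w \<Rightarrow> 'w" where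
  "scale_fam s c f = (\<lambda>i x. s c (f i x))"

text \<open>The data of a \<open>k\<close>-linear category; the addition of morphisms is that of the type \<open>'m\<close>.
  Morphisms do not carry their source and target: the sets \<open>Hom X Y\<close> may overlap.\<close>

record ('o, 'm, 'k) lincat =
  Obj :: "'o set"
  Hom :: "'o \<Rightarrow> 'o \<Rightarrow> 'm set"
  Id :: "'o \<Rightarrow> 'm"
  Comp :: "'m \<Rightarrow> 'm \<Rightarrow> 'm"
  Scal :: "'k \<Rightarrow> 'm \<Rightarrow> 'm"

definition direct_summand :: "('o, 'm::ab_group_add, 'k) lincat \<Rightarrow> 'o \<Rightarrow> 'o \<Rightarrow> bool" where
  "direct_summand C Y X \<longleftrightarrow> X \<in> Obj C \<and> Y \<in> Obj C \<and>
     (\<exists>Z\<in>Obj C. \<exists>i\<in>Hom C Y X. \<exists>p\<in>Hom C X Y. \<exists>j\<in>Hom C Z X. \<exists>q\<in>Hom C X Z.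
        Comp C p i = Id C Y \<and> Comp C q j = Id C Z \<and> Comp C p j = 0 \<and> Comp C q i = 0 \<and>
        Comp C i p + Comp C j q = Id C X)"

text \<open>For \<open>f \<in> Hom C X Y\<close>, \<open>fmap F X Y f\<close> is the map \<open>F Y \<rightarrow> F X\<close>.\<close>

record ('o, 'm, 'w) cofunctor =
  fobj :: "'o \<Rightarrow> 'w set"
  fmap :: "'o \<Rightarrow> 'o \<Rightarrow> 'm \<Rightarrow> 'w \<Rightarrow> 'w"

definition mod_op ::
  "('o, 'm::ab_group_add, 'k::field) lincat \<Rightarrow> ('k \<Rightarrow> 'w::ab_group_add \<Rightarrow> 'w) \<Rightarrow> ('o, 'm, 'w) cofunctor set"
where
  "mod_op C s = {F.
     (\<forall>X\<in>Obj C. fin_dim s (fobj F X)) \<and>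
     (\<forall>X\<in>Obj C. \<forall>Y\<in>Obj C. \<forall>f\<in>Hom C X Y. fmap F X Y f \<in> lin s (fobj F Y) (fobj F X)) \<and>
     (\<forall>X\<in>Obj C. fmap F X X (Id C X) = id_on (fobj F X)) \<and>
     (\<forall>X\<in>Obj C. \<forall>Y\<in>Obj C. \<forall>Z\<in>Obj C. \<forall>f\<in>Hom C X Y. \<forall>g\<in>Hom C Y Z.
        fmap F X Z (Comp C g f) = fmap F X Y f \<circ> fmap F Y Z g) \<and>
     (\<forall>X\<in>Obj C. \<forall>Y\<in>Obj C. \<forall>f\<in>Hom C X Y. \<forall>g\<in>Hom C X Y.
        fmap F X Y (f + g) = fmap F X Y f + fmap F X Y g) \<and>
     (\<forall>X\<in>Obj C. \<forall>Y\<in>Obj C. \<forall>f\<in>Hom C X Y. \<forall>c.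
        fmap F X Y (Scal C c f) = (\<lambda>x. s c (fmap F X Y f x)))}"

definition nat_trans ::
  "('o, 'm, 'k::field) lincat \<Rightarrow> ('k \<Rightarrow> 'w::ab_group_add \<Rightarrow> 'w) \<Rightarrow>
   ('o, 'm, 'w) cofunctor \<Rightarrow> ('o, 'm, 'w) cofunctor \<Rightarrow> ('o \<Rightarrow> 'w \<Rightarrow> 'w) set"
where
  "nat_trans C s F G = {\<eta> \<in> lin_fam s (Obj C) (fobj F) (fobj G).
     \<forall>X\<in>Obj C. \<forall>Y\<in>Obj C. \<forall>f\<in>Hom C X Y. \<eta> X \<circ> fmap F X Y f = fmap G X Y f \<circ> \<eta> Y}"

text \<open>Exactness in the functor category is exactness at every object.\<close>

definition nt_mono :: "('o, 'm, 'k) lincat \<Rightarrow> ('o, 'm, 'w) cofunctor \<Rightarrow> ('o \<Rightarrow> 'w \<Rightarrow> 'w) \<Rightarrow> bool" where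
  "nt_mono C F \<eta> \<longleftrightarrow> (\<forall>X\<in>Obj C. inj_on (\<eta> X) (fobj F X))"

definition nt_epi ::
  "('o, 'm, 'k) lincat \<Rightarrow> ('o, 'm, 'w) cofunctor \<Rightarrow> ('o, 'm, 'w) cofunctor \<Rightarrow> ('o \<Rightarrow> 'w \<Rightarrow> 'w) \<Rightarrow> bool"
where
  "nt_epi C F G \<eta> \<longleftrightarrow> (\<forall>X\<in>Obj C. \<eta> X ` fobj F X = fobj G X)"

definition nt_exact ::
  "('o, 'm, 'k) lincat \<Rightarrow> ('o, 'm, 'w::zero) cofunctor \<Rightarrow> ('o, 'm, 'w) cofunctor \<Rightarrow>
   ('o \<Rightarrow> 'w \<Rightarrow> 'w) \<Rightarrow> ('o \<Rightarrow> 'w \<Rightarrow> 'w) \<Rightarrow> bool"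
where
  "nt_exact C F G \<eta> \<theta> \<longleftrightarrow> (\<forall>X\<in>Obj C. \<eta> X ` fobj F X = {x \<in> fobj G X. \<theta> X x = 0})"

definition zero_functor :: "('o, 'm, 'k) lincat \<Rightarrow> ('o, 'm, 'w::zero) cofunctor \<Rightarrow> bool" where
  "zero_functor C F \<longleftrightarrow> (\<forall>X\<in>Obj C. fobj F X = {0})"

definition projective_functor ::
  "('o, 'm::ab_group_add, 'k::field) lincat \<Rightarrow> ('k \<Rightarrow> 'w::ab_group_add \<Rightarrow> 'w) \<Rightarrow> ('o, 'm, 'w) cofunctor \<Rightarrow> bool"
where
  "projective_functor C s P \<longleftrightarrow> P \<in> mod_op C s \<and>
     (\<forall>F\<in>mod_op C s. \<forall>G\<in>mod_op C s. \<forall>\<pi>\<in>nat_trans C s F G. \<forall>\<eta>\<in>nat_trans C s P G.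
        nt_epi C F G \<pi> \<longrightarrow> (\<exists>\<theta>\<in>nat_trans C s P F. \<pi> \<circ>\<circ> \<theta> = \<eta>))"

definition injective_functor ::
  "('o, 'm::ab_group_add, 'k::field) lincat \<Rightarrow> ('k \<Rightarrow> 'w::ab_group_add \<Rightarrow> 'w) \<Rightarrow> ('o, 'm, 'w) cofunctor \<Rightarrow> bool"
where
  "injective_functor C s J \<longleftrightarrow> J \<in> mod_op C s \<and>
     (\<forall>F\<in>mod_op C s. \<forall>G\<in>mod_op C s. \<forall>\<mu>\<in>nat_trans C s F G. \<forall>\<eta>\<in>nat_trans C s F J.
        nt_mono C F \<mu> \<longrightarrow> (\<exists>\<theta>\<in>nat_trans C s G J. \<theta> \<circ>\<circ> \<mu> = \<eta>))"

text \<open>Projective resolutions \<open>0 \<rightarrow> P n \<rightarrow> \<dots> \<rightarrow> P 0 \<rightarrow> F \<rightarrow> 0\<close> with augmentation \<open>d 0\<close>, and dually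
  injective coresolutions \<open>0 \<rightarrow> F \<rightarrow> J 0 \<rightarrow> \<dots> \<rightarrow> J n \<rightarrow> 0\<close>; the terms beyond \<open>n\<close> are zero.\<close>

definition projective_resolution ::
  "('o, 'm::ab_group_add, 'k::field) lincat \<Rightarrow> ('k \<Rightarrow> 'w::ab_group_add \<Rightarrow> 'w) \<Rightarrow> ('o, 'm, 'w) cofunctor \<Rightarrow>
   nat \<Rightarrow> (nat \<Rightarrow> ('o, 'm, 'w) cofunctor) \<Rightarrow> (nat \<Rightarrow> 'o \<Rightarrow> 'w \<Rightarrow> 'w) \<Rightarrow> bool"
where
  "projective_resolution C s F n P d \<longleftrightarrow>
     (\<forall>i. projective_functor C s (P i)) \<and>
     d 0 \<in> nat_trans C s (P 0) F \<and> nt_epi C (P 0) F (d 0) \<and>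
     (\<forall>i. d (Suc i) \<in> nat_trans C s (P (Suc i)) (P i) \<and>
          nt_exact C (P (Suc i)) (P i) (d (Suc i)) (d i)) \<and>
     (\<forall>i>n. zero_functor C (P i))"

definition injective_coresolution ::
  "('o, 'm::ab_group_add, 'k::field) lincat \<Rightarrow> ('k \<Rightarrow> 'w::ab_group_add \<Rightarrow> 'w) \<Rightarrow> ('o, 'm, 'w) cofunctor \<Rightarrow>
   nat \<Rightarrow> (nat \<Rightarrow> ('o, 'm, 'w) cofunctor) \<Rightarrow> (nat \<Rightarrow> 'o \<Rightarrow> 'w \<Rightarrow> 'w) \<Rightarrow> bool"
where
  "injective_coresolution C s F n J d \<longleftrightarrow>
     (\<forall>i. injective_functor C s (J i)) \<and>
     d 0 \<in> nat_trans C s F (J 0) \<and> nt_mono C F (d 0) \<and>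
     nt_exact C F (J 0) (d 0) (d 1) \<and>
     (\<forall>i. d (Suc i) \<in> nat_trans C s (J i) (J (Suc i)) \<and>
          nt_exact C (J i) (J (Suc i)) (d (Suc i)) (d (Suc (Suc i)))) \<and>
     (\<forall>i>n. zero_functor C (J i))"

definition proj_dim ::
  "('o, 'm::ab_group_add, 'k::field) lincat \<Rightarrow> ('k \<Rightarrow> 'w::ab_group_add \<Rightarrow> 'w) \<Rightarrow> ('o, 'm, 'w) cofunctor \<Rightarrow> enat"
where
  "proj_dim C s F = Inf {enat n | n. \<exists>P d. projective_resolution C s F n P d}"

definition inj_dim ::
  "('o, 'm::ab_group_add, 'k::field) lincat \<Rightarrow> ('k \<Rightarrow> 'w::ab_group_add \<Rightarrow> 'w) \<Rightarrow> ('o, 'm, 'w) cofunctor \<Rightarrow> enat"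
where
  "inj_dim C s F = Inf {enat n | n. \<exists>J d. injective_coresolution C s F n J d}"

text \<open>Yoneda's \<open>Ext\<^sup>1(F,G)\<close>: the classes of extensions \<open>0 \<rightarrow> G \<rightarrow> E \<rightarrow> F \<rightarrow> 0\<close> under equivalence
  (by the five lemma the comparison map \<open>\<theta>\<close> is invertible).  Its zero element is the class of
  the split extensions.\<close>

definition extensions ::
  "('o, 'm::ab_group_add, 'k::field) lincat \<Rightarrow> ('k \<Rightarrow> 'w::ab_group_add \<Rightarrow> 'w) \<Rightarrow>
   ('o, 'm, 'w) cofunctor \<Rightarrow> ('o, 'm, 'w) cofunctor \<Rightarrow>
   (('o, 'm, 'w) cofunctor \<times> ('o \<Rightarrow> 'w \<Rightarrow> 'w) \<times> ('o \<Rightarrow> 'w \<Rightarrow> 'w)) set"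
where
  "extensions C s F G = {(E, i, p). E \<in> mod_op C s \<and> i \<in> nat_trans C s G E \<and> p \<in> nat_trans C s E F \<and>
     nt_mono C G i \<and> nt_exact C G E i p \<and> nt_epi C E F p}"

definition ext_equiv ::
  "('o, 'm::ab_group_add, 'k::field) lincat \<Rightarrow> ('k \<Rightarrow> 'w::ab_group_add \<Rightarrow> 'w) \<Rightarrow>
   ('o, 'm, 'w) cofunctor \<Rightarrow> ('o, 'm, 'w) cofunctor \<Rightarrow>
   (('o, 'm, 'w) cofunctor \<times> ('o \<Rightarrow> 'w \<Rightarrow> 'w) \<times> ('o \<Rightarrow> 'w \<Rightarrow> 'w)) rel"
where
  "ext_equiv C s F G = {((E, i, p), (E', i', p')).
     (E, i, p) \<in> extensions C s F G \<and> (E', i', p') \<in> extensions C s F G \<and>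
     (\<exists>\<theta>\<in>nat_trans C s E E'. \<theta> \<circ>\<circ> i = i' \<and> p' \<circ>\<circ> \<theta> = p)}"

definition Ext1 ::
  "('o, 'm::ab_group_add, 'k::field) lincat \<Rightarrow> ('k \<Rightarrow> 'w::ab_group_add \<Rightarrow> 'w) \<Rightarrow>
   ('o, 'm, 'w) cofunctor \<Rightarrow> ('o, 'm, 'w) cofunctor \<Rightarrow>
   (('o, 'm, 'w) cofunctor \<times> ('o \<Rightarrow> 'w \<Rightarrow> 'w) \<times> ('o \<Rightarrow> 'w \<Rightarrow> 'w)) set set"
where
  "Ext1 C s F G = extensions C s F G // ext_equiv C s F G"

definition Ext1_zero ::
  "('o, 'm::ab_group_add, 'k::field) lincat \<Rightarrow> ('k \<Rightarrow> 'w::ab_group_add \<Rightarrow> 'w) \<Rightarrow>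
   ('o, 'm, 'w) cofunctor \<Rightarrow> ('o, 'm, 'w) cofunctor \<Rightarrow>
   (('o, 'm, 'w) cofunctor \<times> ('o \<Rightarrow> 'w \<Rightarrow> 'w) \<times> ('o \<Rightarrow> 'w \<Rightarrow> 'w)) set"
where
  "Ext1_zero C s F G = {(E, i, p) \<in> extensions C s F G.
     \<exists>\<sigma>\<in>nat_trans C s F E. p \<circ>\<circ> \<sigma> = id_fam (Obj C) (fobj F)}"

text \<open>Edge sets of the simply laced Dynkin diagrams on the vertices \<open>0, \<dots>, n - 1\<close>.  In types D and E
  the vertices \<open>0, \<dots>, n - 2\<close> form a path and \<open>n - 1\<close> is attached to \<open>n - 3\<close> and \<open>2\<close>, respectively.\<close>

definition A_edges :: "nat \<Rightarrow> nat set set" where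
  "A_edges n = {{i, i + 1} | i. i + 1 < n}"

definition D_edges :: "nat \<Rightarrow> nat set set" where
  "D_edges n = {{i, i + 1} | i. i + 2 < n} \<union> {{n - 3, n - 1}}"

definition E_edges :: "nat \<Rightarrow> nat set set" where
  "E_edges n = {{i, i + 1} | i. i + 2 < n} \<union> {{2, n - 1}}"

definition dynkin_diagram :: "nat \<Rightarrow> nat set set \<Rightarrow> bool" where
  "dynkin_diagram n E \<longleftrightarrow>
     (n \<ge> 1 \<and> E = A_edges n) \<or> (n \<ge> 4 \<and> E = D_edges n) \<or> (n \<in> {6, 7, 8} \<and> E = E_edges n)"

definition dynkin_quiver :: "('v, 'a) pre_digraph \<Rightarrow> bool" where
  "dynkin_quiver Q \<longleftrightarrow> wf_digraph Q \<and>
     (\<exists>n E \<beta>. dynkin_diagram n E \<and> bij_betw \<beta> (verts Q) {..<n} \<and>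
        bij_betw (\<lambda>a. \<beta> ` {tail Q a, head Q a}) (arcs Q) E)"

text \<open>Finite-dimensional left modules over the path algebra are identified with finite-dimensional
  representations of \<open>Q\<close>; exactness of representations is exactness at every vertex.\<close>

record ('v, 'a, 'u) qrep =
  space :: "'v \<Rightarrow> 'u set"
  act :: "'a \<Rightarrow> 'u \<Rightarrow> 'u"

definition fd_reps ::
  "('k::field \<Rightarrow> 'u::ab_group_add \<Rightarrow> 'u) \<Rightarrow> ('v, 'a) pre_digraph \<Rightarrow> ('v, 'a, 'u) qrep set"
where
  "fd_reps s Q = {M. (\<forall>v\<in>verts Q. fin_dim s (space M v)) \<and>
     (\<forall>a\<in>arcs Q. act M a \<in> lin s (space M (tail Q a)) (space M (head Q a)))}"

definition rep_hom ::
  "('k::field \<Rightarrow> 'u::ab_group_add \<Rightarrow> 'u) \<Rightarrow> ('v, 'a) pre_digraph \<Rightarrow>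
   ('v, 'a, 'u) qrep \<Rightarrow> ('v, 'a, 'u) qrep \<Rightarrow> ('v \<Rightarrow> 'u \<Rightarrow> 'u) set"
where
  "rep_hom s Q M N = {f \<in> lin_fam s (verts Q) (space M) (space N).
     \<forall>a\<in>arcs Q. f (head Q a) \<circ> act M a = act N a \<circ> f (tail Q a)}"

definition rep_mono :: "('v, 'a) pre_digraph \<Rightarrow> ('v, 'a, 'u) qrep \<Rightarrow> ('v \<Rightarrow> 'u \<Rightarrow> 'u) \<Rightarrow> bool" where
  "rep_mono Q M f \<longleftrightarrow> (\<forall>v\<in>verts Q. inj_on (f v) (space M v))"

definition rep_epi ::
  "('v, 'a) pre_digraph \<Rightarrow> ('v, 'a, 'u) qrep \<Rightarrow> ('v, 'a, 'u) qrep \<Rightarrow> ('v \<Rightarrow> 'u \<Rightarrow> 'u) \<Rightarrow> bool"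
where
  "rep_epi Q M N f \<longleftrightarrow> (\<forall>v\<in>verts Q. f v ` space M v = space N v)"

definition zero_rep :: "('v, 'a) pre_digraph \<Rightarrow> ('v, 'a, 'u::zero) qrep \<Rightarrow> bool" where
  "zero_rep Q M \<longleftrightarrow> (\<forall>v\<in>verts Q. space M v = {0})"

definition proj_reps ::
  "('k::field \<Rightarrow> 'u::ab_group_add \<Rightarrow> 'u) \<Rightarrow> ('v, 'a) pre_digraph \<Rightarrow> ('v, 'a, 'u) qrep set"
where
  "proj_reps s Q = {P \<in> fd_reps s Q.
     \<forall>M\<in>fd_reps s Q. \<forall>N\<in>fd_reps s Q. \<forall>\<pi>\<in>rep_hom s Q M N. \<forall>f\<in>rep_hom s Q P N.
        rep_epi Q M N \<pi> \<longrightarrow> (\<exists>g\<in>rep_hom s Q P M. \<pi> \<circ>\<circ> g = f)}"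

text \<open>The object \<open>(P, R, \<iota>)\<close> stands for \<open>\<iota> : P \<rightarrow> R\<close>.\<close>

type_synonym ('v, 'a, 'u) rep_map = "('v, 'a, 'u) qrep \<times> ('v, 'a, 'u) qrep \<times> ('v \<Rightarrow> 'u \<Rightarrow> 'u)"

definition mono_proj ::
  "('k::field \<Rightarrow> 'u::ab_group_add \<Rightarrow> 'u) \<Rightarrow> ('v, 'a) pre_digraph \<Rightarrow>
   (('v, 'a, 'u) rep_map, ('v \<Rightarrow> 'u \<Rightarrow> 'u) \<times> ('v \<Rightarrow> 'u \<Rightarrow> 'u), 'k) lincat"
where
  "mono_proj s Q = \<lparr>
     Obj = {(P, R, \<iota>). P \<in> proj_reps s Q \<and> R \<in> proj_reps s Q \<and> \<iota> \<in> rep_hom s Q P R \<and> rep_mono Q P \<iota>},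
     Hom = (\<lambda>(P, R, \<iota>) (P', R', \<iota>').
       {(\<phi>, \<psi>). \<phi> \<in> rep_hom s Q P P' \<and> \<psi> \<in> rep_hom s Q R R' \<and> \<psi> \<circ>\<circ> \<iota> = \<iota>' \<circ>\<circ> \<phi>}),
     Id = (\<lambda>(P, R, \<iota>). (id_fam (verts Q) (space P), id_fam (verts Q) (space R))),
     Comp = (\<lambda>(\<phi>', \<psi>') (\<phi>, \<psi>). (\<phi>' \<circ>\<circ> \<phi>, \<psi>' \<circ>\<circ> \<psi>)),
     Scal = (\<lambda>c (\<phi>, \<psi>). (scale_fam s c \<phi>, scale_fam s c \<psi>)) \<rparr>"

definition H_cat ::
  "('k::field \<Rightarrow> 'u::ab_group_add \<Rightarrow> 'u) \<Rightarrow> ('v, 'a) pre_digraph \<Rightarrow>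
   (('v, 'a, 'u) rep_map, ('v \<Rightarrow> 'u \<Rightarrow> 'u) \<times> ('v \<Rightarrow> 'u \<Rightarrow> 'u), 'k) lincat"
where
  "H_cat s Q = (mono_proj s Q) \<lparr> Obj := {X \<in> Obj (mono_proj s Q).
     \<not> (\<exists>Z P \<kappa>. zero_rep Q Z \<and> \<not> zero_rep Q P \<and> direct_summand (mono_proj s Q) (Z, P, \<kappa>) X)} \<rparr>"

text \<open>The value of \<open>hat M\<close> at \<open>\<iota> : P \<rightarrow> R\<close> is a subspace of \<open>rep_hom s Q P M\<close>.  Therefore vector spaces in
  the functor category are taken inside the type \<open>'v \<Rightarrow> 'u \<Rightarrow> 'u\<close> with scalar multiplication
  \<open>scale_fam s\<close>, which is infinite-dimensional whenever \<open>'u\<close> is.\<close>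

definition hat ::
  "('k::field \<Rightarrow> 'u::ab_group_add \<Rightarrow> 'u) \<Rightarrow> ('v, 'a) pre_digraph \<Rightarrow> ('v, 'a, 'u) qrep \<Rightarrow>
   (('v, 'a, 'u) rep_map, ('v \<Rightarrow> 'u \<Rightarrow> 'u) \<times> ('v \<Rightarrow> 'u \<Rightarrow> 'u), 'v \<Rightarrow> 'u \<Rightarrow> 'u) cofunctor"
where
  "hat s Q M = (let im = (\<lambda>(P, R, \<iota>). (\<lambda>g. g \<circ>\<circ> \<iota>) ` rep_hom s Q R M) in \<lparr>
     fobj = im,
     fmap = (\<lambda>X Y (\<phi>, \<psi>) h. if h \<in> im Y then h \<circ>\<circ> \<phi> else 0) \<rparr>)"

end

theory Submission
  imports Defs "Graph_Theory.Arc_Walk"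
begin

text \<open>
  Write an object of \<open>H_cat s Q\<close> as \<open>\<iota> : P \<rightarrow> R\<close>, let \<open>\<pi> : S \<rightarrow> M\<close> be an epimorphism from a projective
  representation, and let \<open>A\<close> be its kernel, which is projective because submodules of projectives are
  projective.  A morphism from \<open>\<iota>\<close> to \<open>id : S \<rightarrow> S\<close> is the same as a map \<open>\<psi> : R \<rightarrow> S\<close>.  As \<open>R\<close> is
  projective, every map \<open>R \<rightarrow> M\<close> lifts to \<open>S\<close>, and so \<open>\<psi> \<mapsto> \<pi> \<psi> \<iota>\<close> maps \<open>Hom(\<iota>, id)\<close> onto the value of
  \<open>hat M\<close> at \<open>\<iota>\<close>.  Moreover \<open>\<pi> \<psi> \<iota> = 0\<close> holds exactly if \<open>\<psi> \<iota>\<close> has image in \<open>A\<close>, that is, if \<open>\<psi>\<close> belongs to a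
  morphism from \<open>\<iota>\<close> to the inclusion \<open>A \<rightarrow> S\<close>.  This gives an exact sequence
  \<open>0 \<rightarrow> Hom(-, A \<rightarrow> S) \<rightarrow> Hom(-, S = S) \<rightarrow> hat M \<rightarrow> 0\<close>.  The inclusion \<open>A \<rightarrow> S\<close> may have summands \<open>0 \<rightarrow> P\<close>,
  but no object of \<open>H_cat s Q\<close> has a nonzero morphism to such a summand, so they can be removed (lemma
  \<open>H_decomposition\<close>).  Hence \<open>hat M\<close> has projective dimension at most one (lemma \<open>hat_presentation\<close>).

  The group \<open>Ext\<^sup>1(hat M, hat M)\<close> is the cokernel of the map from the value of \<open>hat M\<close> at \<open>S = S\<close> to its value
  at \<open>A \<rightarrow> S\<close>.  This map restricts maps \<open>S \<rightarrow> M\<close> to \<open>A\<close>, and it is onto by the definition of \<open>hat M\<close>.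

  For the injective dimension, the role of the representable functors is played by their duals
  \<open>D Hom(Y, -)\<close>, and the role of \<open>S\<close> by an injective coresolution \<open>0 \<rightarrow> M \<rightarrow> I0 \<rightarrow> I1 \<rightarrow> 0\<close>.  The Nakayama
  functor turns the map \<open>c : I0 \<rightarrow> I1\<close> into a map \<open>r : R0 \<rightarrow> R1\<close> between projectives with
  \<open>Hom(N, I\<^sub>i) = D Hom(R\<^sub>i, N)\<close> for all \<open>N\<close>.  Then
  \<open>0 \<rightarrow> hat M \<rightarrow> D Hom(R0 = R0, -) \<rightarrow> D Hom(im r \<rightarrow> R1, -) \<rightarrow> 0\<close> is exact (lemma \<open>hat_copresentation\<close>): all
  exactness statements translate into the fact that subspaces of finite-dimensional spaces are
  determined by their annihilators (lemma \<open>double_annihilator\<close>).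

  The underlying graph enters through one property only: between two vertices of a Dynkin quiver there
  is at most one directed walk (lemma \<open>dynkin_quiver_unique_walk\<close>).  This makes the indecomposable
  projective and injective representations, and the standard injective coresolution, explicit.
\<close>

section \<open>Finite-dimensional vector spaces and functionals\<close>

text \<open>The maps in \<open>lin\<close> stay within one ambient type and vanish outside their source.  Functionals, coordinates
  and embeddings into the ambient space change the type, and only their values on \<open>V\<close> matter.\<close>

definition linear_on ::
  "('k::field \<Rightarrow> 'x::ab_group_add \<Rightarrow> 'x) \<Rightarrow> ('k \<Rightarrow> 'y::ab_group_add \<Rightarrow> 'y) \<Rightarrow> 'x set \<Rightarrow> ('x \<Rightarrow> 'y) \<Rightarrow> bool"
where
  "linear_on s t V f \<longleftrightarrow> (\<forall>x\<in>V. \<forall>y\<in>V. f (x + y) = f x + f y) \<and> (\<forall>c. \<forall>x\<in>V. f (s c x) = t c (f x))"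

abbreviation functional_on :: "('k::field \<Rightarrow> 'x::ab_group_add \<Rightarrow> 'x) \<Rightarrow> 'x set \<Rightarrow> ('x \<Rightarrow> 'k) \<Rightarrow> bool" where
  "functional_on s V \<xi> \<equiv> linear_on s (*) V \<xi>"

lemma vector_space_field: "vector_space ((*) :: 'k::field \<Rightarrow> 'k \<Rightarrow> 'k)"
  by unfold_locales (auto simp: algebra_simps)

lemma module_if_vector_space: "vector_space s \<Longrightarrow> module s"
  by (simp add: module_iff_vector_space)

lemma
  assumes "vector_space s" "module.subspace s V"
  shows subspace_zeroD: "0 \<in> V"
    and subspace_addD: "x \<in> V \<Longrightarrow> y \<in> V \<Longrightarrow> x + y \<in> V"
    and subspace_scaleD: "x \<in> V \<Longrightarrow> s c x \<in> V"
    and subspace_diffD: "x \<in> V \<Longrightarrow> y \<in> V \<Longrightarrow> x - y \<in> V"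
    and subspace_sumD: "(\<And>i. i \<in> A \<Longrightarrow> g i \<in> V) \<Longrightarrow> sum g A \<in> V"
proof -
  interpret vector_space s by fact
  show "0 \<in> V" "x \<in> V \<Longrightarrow> y \<in> V \<Longrightarrow> x + y \<in> V" "x \<in> V \<Longrightarrow> s c x \<in> V"
    "x \<in> V \<Longrightarrow> y \<in> V \<Longrightarrow> x - y \<in> V"
    "(\<And>i. i \<in> A \<Longrightarrow> g i \<in> V) \<Longrightarrow> sum g A \<in> V"
    by (fact subspace_0[OF assms(2)] subspace_add[OF assms(2)] subspace_scale[OF assms(2)]
        subspace_diff[OF assms(2)] subspace_sum[OF assms(2)])+
qed

lemma linear_onI:
  "(\<And>x y. x \<in> V \<Longrightarrow> y \<in> V \<Longrightarrow> f (x + y) = f x + f y) \<Longrightarrow> (\<And>c x. x \<in> V \<Longrightarrow> f (s c x) = t c (f x))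
    \<Longrightarrow> linear_on s t V f"
  by (auto simp: linear_on_def)

lemma linear_on_add: "linear_on s t V f \<Longrightarrow> x \<in> V \<Longrightarrow> y \<in> V \<Longrightarrow> f (x + y) = f x + f y"
  by (auto simp: linear_on_def)

lemma linear_on_scale: "linear_on s t V f \<Longrightarrow> x \<in> V \<Longrightarrow> f (s c x) = t c (f x)"
  by (auto simp: linear_on_def)

lemma linear_on_zero:
  assumes "linear_on s t V f" "0 \<in> V"
  shows "f 0 = 0"
  using linear_on_add[OF assms(1,2,2)] by simp

lemma linear_on_diff:
  assumes "vector_space s" "module.subspace s V" "linear_on s t V f" "x \<in> V" "y \<in> V"
  shows "f (x - y) = f x - f y"
  using linear_on_add[OF assms(3) subspace_diffD[OF assms(1,2,4,5)] assms(5)] by simp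

lemma linear_on_subset: "linear_on s t V f \<Longrightarrow> U \<subseteq> V \<Longrightarrow> linear_on s t U f"
  by (auto simp: linear_on_def subset_iff)

lemma linear_on_compose:
  "linear_on s t V f \<Longrightarrow> linear_on t r W g \<Longrightarrow> f ` V \<subseteq> W \<Longrightarrow> linear_on s r V (\<lambda>x. g (f x))"
  by (auto simp: linear_on_def image_subset_iff)

lemma linear_on_inj_iff:
  assumes "vector_space s" "module.subspace s V" "linear_on s t V f"
  shows "inj_on f V \<longleftrightarrow> (\<forall>x\<in>V. f x = 0 \<longrightarrow> x = 0)"
proof
  note 0 = subspace_zeroD[OF assms(1,2)]
  show "\<forall>x\<in>V. f x = 0 \<longrightarrow> x = 0" if "inj_on f V"
    using inj_onD[OF that _ _ 0] linear_on_zero[OF assms(3) 0] by simp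
next
  assume *: "\<forall>x\<in>V. f x = 0 \<longrightarrow> x = 0"
  show "inj_on f V"
  proof (rule inj_onI)
    fix x y assume xy: "x \<in> V" "y \<in> V" "f x = f y"
    then have "f (x - y) = 0" using linear_on_diff[OF assms xy(1,2)] by simp
    then show "x = y" using * subspace_diffD[OF assms(1,2) xy(1,2)] by fastforce
  qed
qed

lemma subspace_linear_image:
  assumes "vector_space s" "vector_space t" "module.subspace s V" "linear_on s t V f"
  shows "module.subspace t (f ` V)"
proof (rule module.subspaceI[OF module_if_vector_space[OF assms(2)]])
  note sub = subspace_zeroD[OF assms(1,3)] subspace_addD[OF assms(1,3)] subspace_scaleD[OF assms(1,3)]
  show "0 \<in> f ` V" using linear_on_zero[OF assms(4) sub(1)] sub(1) by force
  fix x assume "x \<in> f ` V"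
  then obtain x' where x: "x = f x'" "x' \<in> V" by blast
  show "t c x \<in> f ` V" for c
    using linear_on_scale[OF assms(4) x(2), of c] sub(3)[OF x(2), of c] x(1) by force
  fix y assume "y \<in> f ` V"
  then obtain y' where y: "y = f y'" "y' \<in> V" by blast
  show "x + y \<in> f ` V" using linear_on_add[OF assms(4) x(2) y(2)] sub(2)[OF x(2) y(2)] x(1) y(1) by force
qed

lemma subspace_kernel:
  assumes "vector_space s" "module.subspace s V" "linear_on s t V f"
    and "vector_space t"
  shows "module.subspace s {x \<in> V. f x = 0}"
proof (rule module.subspaceI[OF module_if_vector_space[OF assms(1)]])
  interpret T: vector_space t by fact
  note sub = subspace_zeroD[OF assms(1,2)] subspace_addD[OF assms(1,2)] subspace_scaleD[OF assms(1,2)]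
  show "0 \<in> {x \<in> V. f x = 0}" using linear_on_zero[OF assms(3) sub(1)] sub(1) by simp
  fix x assume x: "x \<in> {x \<in> V. f x = 0}"
  then show "s c x \<in> {x \<in> V. f x = 0}" for c using linear_on_scale[OF assms(3), of x c] sub(3)[of x c] by simp
  fix y assume "y \<in> {x \<in> V. f x = 0}"
  then show "x + y \<in> {x \<in> V. f x = 0}" using x linear_on_add[OF assms(3), of x y] sub(2)[of x y] by simp
qed

lemma fin_dim_subspace: "vector_space s \<Longrightarrow> fin_dim s V \<Longrightarrow> module.subspace s V"
  by (metis fin_dim_def module.subspace_span module_if_vector_space)

lemma fin_dim_basis:
  assumes "vector_space s" "fin_dim s V"
  obtains B where "finite B" "\<not> module.dependent s B" "module.span s B = V"
proof -
  interpret vector_space s by fact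
  obtain A where A: "finite A" "V = span A" using assms(2) by (auto simp: fin_dim_def)
  obtain B where "B \<subseteq> A" "independent B" "A \<subseteq> span B" using maximal_independent_subset by blast
  then have "finite B" "span B = V"
    using A finite_subset span_eq[of B A] span_superset[of A] by auto
  then show ?thesis using that \<open>independent B\<close> by blast
qed

lemma representation_linear_on:
  assumes "vector_space s" "\<not> module.dependent s B"
  shows "functional_on s (module.span s B) (\<lambda>x. module.representation s B x b)"
proof -
  interpret vector_space s by fact
  show ?thesis
    by (auto simp: linear_on_def representation_add[OF assms(2)] representation_scale[OF assms(2)])
qed

lemma representation_eq_0:
  assumes "vector_space s" "finite B" "\<not> module.dependent s B" "x \<in> module.span s B"
    "\<And>b. b \<in> B \<Longrightarrow> module.representation s B x b = 0"
  shows "x = 0"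
proof -
  interpret vector_space s by fact
  have "(\<Sum>b\<in>B. s (representation B x b) b) = x"
    by (rule sum_representation_eq[OF assms(3,4,2)]) simp
  then show ?thesis using assms(5) by simp
qed

text \<open>Each functional cuts down the dimension by at most one, until only \<open>0\<close> is left.  All finiteness
  statements below (for subspaces, products and spaces of morphisms) come from this criterion.\<close>

lemma fin_dim_if_separated:
  assumes "vector_space s" "module.subspace s V" "finite T"
    and "\<And>\<xi>. \<xi> \<in> T \<Longrightarrow> functional_on s V \<xi>"
    and "\<And>x. x \<in> V \<Longrightarrow> (\<forall>\<xi>\<in>T. \<xi> x = 0) \<Longrightarrow> x = 0"
  shows "fin_dim s V"
  using assms(3,2,4,5)
proof (induction T arbitrary: V)
  case empty
  interpret vector_space s by fact
  have "V = {0}" using empty subspace_0 by auto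
  then have "V = span {}" by simp
  then show ?case unfolding fin_dim_def by blast
next
  case (insert \<xi> T)
  interpret vector_space s by fact
  let ?V = "{x \<in> V. \<xi> x = 0}"
  have \<xi>: "functional_on s V \<xi>" using insert by blast
  have sub: "subspace ?V" by (rule subspace_kernel[OF assms(1) insert.prems(1) \<xi> vector_space_field])
  have "fin_dim s ?V"
    by (rule insert.IH[OF sub]) (use insert.prems(2,3) in \<open>auto intro: linear_on_subset\<close>)
  then obtain B where B: "finite B" "?V = span B" by (auto simp: fin_dim_def)
  show ?case
  proof (cases "?V = V")
    case True
    then show ?thesis using B by (auto simp: fin_dim_def)
  next
    case False
    then obtain v where v: "v \<in> V" "\<xi> v \<noteq> 0" by blast
    have "V = span (insert v B)"
    proof
      show "V \<subseteq> span (insert v B)"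
      proof
        fix x assume x: "x \<in> V"
        let ?c = "\<xi> x / \<xi> v"
        have cv: "s ?c v \<in> V" using subspace_scaleD[OF assms(1) insert.prems(1) v(1)] .
        have "x - s ?c v \<in> V" using subspace_diffD[OF assms(1) insert.prems(1) x cv] .
        moreover have "\<xi> (x - s ?c v) = 0"
          using v(2) linear_on_diff[OF assms(1) insert.prems(1) \<xi> x cv] linear_on_scale[OF \<xi> v(1)] by simp
        ultimately have "x - s ?c v \<in> span B" using B by blast
        then show "x \<in> span (insert v B)" unfolding span_insert mem_Collect_eq by (rule exI)
      qed
    next
      have "B \<subseteq> V" using B(2) span_superset by blast
      then show "span (insert v B) \<subseteq> V" using v insert.prems(1) by (intro span_minimal) auto
    qed
    then show ?thesis using B(1) unfolding fin_dim_def by blast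
  qed
qed

lemma fin_dim_separating:
  assumes "vector_space s" "fin_dim s V"
  obtains T where "finite T" "\<And>\<xi>. \<xi> \<in> T \<Longrightarrow> functional_on s V \<xi>"
    "\<And>x. x \<in> V \<Longrightarrow> (\<forall>\<xi>\<in>T. \<xi> x = 0) \<Longrightarrow> x = 0"
proof -
  interpret vector_space s by fact
  obtain B where B: "finite B" "independent B" "span B = V" using fin_dim_basis[OF assms] .
  show thesis
  proof (rule that[of "(\<lambda>b x. representation B x b) ` B"])
    show "finite ((\<lambda>b x. representation B x b) ` B)" using B by simp
  next
    fix \<xi> assume "\<xi> \<in> (\<lambda>b x. representation B x b) ` B"
    then show "functional_on s V \<xi>" using representation_linear_on[OF assms(1) B(2)] B(3) by auto
  next
    fix x assume "x \<in> V" "\<forall>\<xi>\<in>(\<lambda>b x. representation B x b) ` B. \<xi> x = 0"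
    then show "x = 0" using representation_eq_0[OF assms(1) B(1,2)] B(3) by auto
  qed
qed

lemma fin_dim_if_injective:
  assumes "vector_space s" "vector_space t" "module.subspace s V" "fin_dim t W"
    and "linear_on s t V f" "f ` V \<subseteq> W" "inj_on f V"
  shows "fin_dim s V"
proof -
  obtain T where T: "finite T" "\<And>\<xi>. \<xi> \<in> T \<Longrightarrow> functional_on t W \<xi>"
    "\<And>x. x \<in> W \<Longrightarrow> (\<forall>\<xi>\<in>T. \<xi> x = 0) \<Longrightarrow> x = 0"
    using fin_dim_separating[OF assms(2,4)] by metis
  have inj: "\<forall>x\<in>V. f x = 0 \<longrightarrow> x = 0" using linear_on_inj_iff[OF assms(1,3,5)] assms(7) by blast
  show ?thesis
  proof (rule fin_dim_if_separated[OF assms(1,3)])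
    show "finite ((\<lambda>\<xi> x. \<xi> (f x)) ` T)" using T by simp
  next
    fix \<zeta> assume "\<zeta> \<in> (\<lambda>\<xi> x. \<xi> (f x)) ` T"
    then show "functional_on s V \<zeta>" using T(2) linear_on_compose[OF assms(5) _ assms(6)] by auto
  next
    fix x assume "x \<in> V" "\<forall>\<zeta>\<in>(\<lambda>\<xi> x. \<xi> (f x)) ` T. \<zeta> x = 0"
    then show "x = 0" using T(3)[of "f x"] inj assms(6) by auto
  qed
qed

lemma fin_dim_subset:
  "vector_space s \<Longrightarrow> fin_dim s W \<Longrightarrow> module.subspace s V \<Longrightarrow> V \<subseteq> W \<Longrightarrow> fin_dim s V"
  by (rule fin_dim_if_injective[where f = "\<lambda>x. x" and t = s]) (auto simp: linear_on_def)

lemma linear_on_sum: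
  assumes "vector_space s" "module.subspace s V" "linear_on s t V f" "\<And>i. i \<in> A \<Longrightarrow> g i \<in> V"
  shows "f (\<Sum>i\<in>A. g i) = (\<Sum>i\<in>A. f (g i))"
  using assms(4)
proof (induction A rule: infinite_finite_induct)
  case (insert i A)
  interpret vector_space s by fact
  have "sum g A \<in> V" by (rule subspace_sumD[OF assms(1,2)]) (use insert in auto)
  then show ?case using insert linear_on_add[OF assms(3)] by simp
qed (use assms(2) linear_on_zero[OF assms(3)] module.subspace_0[OF module_if_vector_space[OF assms(1)]] in auto)

lemma linear_on_extend:
  assumes "vector_space s" "vector_space t" "module.subspace s V" "linear_on s t V f"
  obtains F where "Vector_Spaces.linear s t F" "\<And>x. x \<in> V \<Longrightarrow> F x = f x"
proof -
  interpret S: vector_space s by fact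
  interpret T: vector_space t by fact
  interpret ST: vector_space_pair s t ..
  obtain B where B: "B \<subseteq> V" "S.independent B" "V \<subseteq> S.span B" using S.maximal_independent_subset by blast
  obtain F where F: "Vector_Spaces.linear s t F" "\<forall>x\<in>B. F x = f x"
    using ST.linear_independent_extend[OF B(2)] by blast
  interpret F: Vector_Spaces.linear s t F by fact
  have "F x = f x" if "x \<in> V" for x
  proof -
    have "x \<in> S.span B" using that B by blast
    then have "x \<in> V \<and> F x = f x"
    proof (induction rule: S.span_induct_alt)
      case base
      then show ?case using linear_on_zero[OF assms(4)] assms(3) S.subspace_0 F.zero by auto
    next
      case (step c b y)
      then have "b \<in> V" "s c b \<in> V" "y \<in> V" using B assms(3) S.subspace_scale by auto
      then show ?case using step F(2) linear_on_add[OF assms(4)] linear_on_scale[OF assms(4)] S.subspace_add[OF assms(3)]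
        by (auto simp: F.add F.scale)
    qed
    then show ?thesis by blast
  qed
  then show ?thesis using that F by blast
qed

lemma fin_dim_image:
  assumes "vector_space s" "vector_space t" "fin_dim s V" "linear_on s t V f"
  shows "fin_dim t (f ` V)"
proof -
  interpret S: vector_space s by fact
  interpret T: vector_space t by fact
  obtain F where F: "Vector_Spaces.linear s t F" "\<And>x. x \<in> V \<Longrightarrow> F x = f x"
    using linear_on_extend[OF assms(1,2) fin_dim_subspace[OF assms(1,3)] assms(4)] by blast
  interpret F: Vector_Spaces.linear s t F by fact
  obtain B where "finite B" "V = S.span B" using assms(3) by (auto simp: fin_dim_def)
  then have "f ` V = T.span (F ` B)" using F F.span_image by (metis image_cong)
  then show ?thesis using \<open>finite B\<close> unfolding fin_dim_def by blast
qed

text \<open>This is the injectivity of the ground field, and the reason why duals of representable functors are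
  injective.\<close>

lemma functional_extend_along_injection:
  assumes "vector_space s" "vector_space t" "module.subspace s V" "linear_on s t V f" "inj_on f V"
    "functional_on s V \<xi>"
  obtains \<zeta> where "functional_on t UNIV \<zeta>" "\<And>x. x \<in> V \<Longrightarrow> \<zeta> (f x) = \<xi> x"
proof -
  interpret S: vector_space s by fact
  interpret T: vector_space t by fact
  interpret ST: vector_space_pair s t ..
  obtain F where F: "Vector_Spaces.linear s t F" "\<And>x. x \<in> V \<Longrightarrow> F x = f x"
    using linear_on_extend[OF assms(1-4)] by blast
  have "inj_on F V" using assms(5) F(2) by (metis inj_on_cong)
  then obtain G where G: "G ` UNIV \<subseteq> V" "Vector_Spaces.linear t s G" "\<forall>v\<in>V. G (F v) = v"
    using ST.linear_exists_left_inverse_on[OF F(1) assms(3)] by blast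
  interpret G: Vector_Spaces.linear t s G by fact
  have "functional_on t UNIV (\<lambda>y. \<xi> (G y))"
  proof (intro linear_onI)
    have GV: "G y \<in> V" for y using G(1) by blast
    show "\<xi> (G (x + y)) = \<xi> (G x) + \<xi> (G y)" for x y
      using linear_on_add[OF assms(6) GV GV] by (simp add: G.add)
    show "\<xi> (G (t c x)) = c * \<xi> (G x)" for c x
      using linear_on_scale[OF assms(6) GV] by (simp add: G.scale)
  qed
  then show ?thesis using that[of "\<lambda>y. \<xi> (G y)"] G F by simp
qed

lemma functional_nonzero_at:
  assumes "vector_space s" "x \<noteq> 0"
  obtains \<zeta> where "functional_on s UNIV \<zeta>" "\<zeta> x = 1"
proof -
  interpret vector_space s by fact
  interpret K: vector_space "(*) :: 'a \<Rightarrow> 'a \<Rightarrow> 'a" by (rule vector_space_field)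
  have 1: "linear_on (*) s UNIV (\<lambda>c. s c x)" by (simp add: linear_on_def scale_left_distrib)
  have 2: "inj_on (\<lambda>c. s c x) UNIV" using assms(2) by (simp add: inj_on_def)
  have 3: "functional_on (*) UNIV (\<lambda>c :: 'a. c)" by (simp add: linear_on_def)
  obtain \<zeta> where \<zeta>: "functional_on s UNIV \<zeta>" "\<And>c. c \<in> UNIV \<Longrightarrow> \<zeta> (s c x) = c"
    using functional_extend_along_injection[OF vector_space_field assms(1) K.subspace_UNIV 1 2 3] by auto
  show thesis using that[OF \<zeta>(1)] \<zeta>(2)[of 1] by simp
qed

lemma independent_copy:
  assumes "vector_space s" "\<not> fin_dim s UNIV" "finite T"
  obtains e where "inj_on e T" "\<not> module.dependent s (e ` T)"
proof -
  interpret vector_space s by fact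
  have "\<exists>e. inj_on e T \<and> independent (e ` T)" using assms(3)
  proof induction
    case (insert t T)
    then obtain e where e: "inj_on e T" "independent (e ` T)" by blast
    have "span (e ` T) \<noteq> UNIV" using assms(2) insert(1) unfolding fin_dim_def by (metis finite_imageI)
    then obtain x where x: "x \<notin> span (e ` T)" by blast
    let ?e = "e(t := x)"
    have im: "?e ` T = e ` T" using insert(2) by auto
    have "x \<notin> e ` T" using x span_base by blast
    then have "inj_on ?e (insert t T)" using e insert(2) im by (auto simp: inj_on_def)
    moreover have "?e ` insert t T = insert x (e ` T)" using im by (metis fun_upd_same image_insert)
    then have "independent (?e ` insert t T)"
      using independent_insertI[OF x e(2)] by argo
    ultimately show ?case by blast
  qed (simp add: independent_empty)
  then show ?thesis using that by blast
qed

text \<open>An infinite-dimensional ambient space has room for any finite-dimensional vector space, whatever its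
  type.\<close>

lemma linear_embedding:
  assumes "vector_space s" "vector_space t" "\<not> fin_dim t UNIV" "fin_dim s V"
  obtains f where "linear_on s t V f" "inj_on f V"
proof -
  interpret S: vector_space s by fact
  interpret T: vector_space t by fact
  interpret ST: vector_space_pair s t ..
  obtain B where B: "finite B" "S.independent B" "S.span B = V" using fin_dim_basis[OF assms(1,4)] .
  obtain e where e: "inj_on e B" "T.independent (e ` B)" using independent_copy[OF assms(2,3) B(1)] .
  obtain F where F: "Vector_Spaces.linear s t F" "\<forall>x\<in>B. F x = e x"
    using ST.linear_independent_extend[OF B(2)] by blast
  interpret F: Vector_Spaces.linear s t F by fact
  have "F ` B = e ` B" "inj_on F B" using F e(1) by (auto simp: inj_on_def)
  then have "inj_on F V" using e(2) F.inj_on_span_independent_image B(3) by metis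
  then show ?thesis using that[of F] by (auto simp: linear_on_def F.add F.scale)
qed

text \<open>Induction on the generators of \<open>W\<close>: one generator \<open>b\<close> cuts \<open>V\<close> down to the kernel of \<open>\<beta>(-, b)\<close>; there the
  functional is represented by the remaining generators, and the difference is a multiple of \<open>\<beta>(-, b)\<close>.
  Duality of finite-dimensional spaces is used in this form throughout.\<close>

lemma double_annihilator:
  fixes \<beta> :: "'x::ab_group_add \<Rightarrow> 'y::ab_group_add \<Rightarrow> 'k::field"
  assumes "vector_space s" "vector_space t" "module.subspace s V" "fin_dim t W"
    and "\<And>w. w \<in> W \<Longrightarrow> functional_on s V (\<lambda>v. \<beta> v w)"
    and "\<And>v. v \<in> V \<Longrightarrow> functional_on t W (\<beta> v)"
    and "functional_on s V \<xi>"
    and "\<And>v. v \<in> V \<Longrightarrow> (\<forall>w\<in>W. \<beta> v w = 0) \<Longrightarrow> \<xi> v = 0"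
  shows "\<exists>w\<in>W. \<forall>v\<in>V. \<xi> v = \<beta> v w"
proof -
  interpret S: vector_space s by fact
  interpret T: vector_space t by fact
  obtain B where B: "finite B" "W = T.span B" using assms(4) by (auto simp: fin_dim_def)
  show ?thesis
    using B(1) assms(3,5-8) unfolding B(2)
  proof (induction B arbitrary: V \<xi>)
    case empty
    have "\<xi> v = 0 \<and> \<beta> v 0 = 0" if "v \<in> V" for v
    proof -
      have "\<beta> v 0 = 0" using linear_on_zero[OF empty.prems(3)[OF that]] by simp
      then show ?thesis using empty.prems(5)[OF that] by simp
    qed
    then show ?case by auto
  next
    case (insert b B)
    let ?V = "{v \<in> V. \<beta> v b = 0}"
    have mono: "T.span B \<subseteq> T.span (insert b B)" by (rule T.span_mono) auto
    have b: "b \<in> T.span (insert b B)" by (simp add: T.span_base)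
    note lb = insert.prems(2)[OF b]
    have sub: "S.subspace ?V" by (rule subspace_kernel[OF assms(1) insert.prems(1) lb vector_space_field])
    have "\<exists>w\<in>T.span B. \<forall>v\<in>?V. \<xi> v = \<beta> v w"
    proof (rule insert.IH[OF sub])
      fix w assume "w \<in> T.span B"
      then show "functional_on s ?V (\<lambda>v. \<beta> v w)"
        using insert.prems(2) mono by (auto intro: linear_on_subset)
    next
      fix v assume "v \<in> ?V"
      then show "functional_on t (T.span B) (\<beta> v)"
        using insert.prems(3) mono by (auto intro: linear_on_subset)
    next
      show "functional_on s ?V \<xi>" using insert.prems(4) by (auto intro: linear_on_subset)
    next
      fix v assume v: "v \<in> ?V" "\<forall>w\<in>T.span B. \<beta> v w = 0"
      have "\<beta> v w = 0" if wb: "w \<in> T.span (insert b B)" for w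
      proof -
        obtain c where c: "w - t c b \<in> T.span B" using wb unfolding T.span_insert by blast
        have "w - t c b \<in> T.span (insert b B)" "t c b \<in> T.span (insert b B)"
          using c mono T.span_scale[OF b] by auto
        then have "\<beta> v ((w - t c b) + t c b) = \<beta> v (w - t c b) + \<beta> v (t c b)"
          using linear_on_add insert.prems(3) v by blast
        then show ?thesis using c v linear_on_scale[OF insert.prems(3) b] by simp
      qed
      then show "\<xi> v = 0" using insert.prems(5) v by blast
    qed
    then obtain w where w: "w \<in> T.span B" "\<And>v. v \<in> ?V \<Longrightarrow> \<xi> v = \<beta> v w" by blast
    have wi: "w \<in> T.span (insert b B)" using w mono by blast
    note lw = insert.prems(2)[OF wi]
    show ?case
    proof (cases "?V = V")
      case True
      then show ?thesis using w mono by blast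
    next
      case False
      then obtain v0 where v0: "v0 \<in> V" "\<beta> v0 b \<noteq> 0" by blast
      define c where "c = (\<xi> v0 - \<beta> v0 w) / \<beta> v0 b"
      have wcb: "w + t c b \<in> T.span (insert b B)" using wi b T.span_add T.span_scale by blast
      have "\<xi> v = \<beta> v (w + t c b)" if v: "v \<in> V" for v
      proof -
        let ?d = "\<beta> v b / \<beta> v0 b"
        have d: "s ?d v0 \<in> V" using subspace_scaleD[OF assms(1) insert.prems(1) v0(1)] .
        have "v - s ?d v0 \<in> V" using subspace_diffD[OF assms(1) insert.prems(1) v d] .
        moreover have "\<beta> (v - s ?d v0) b = 0"
          using linear_on_diff[OF assms(1) insert.prems(1) lb v d] linear_on_scale[OF lb v0(1)] v0(2) by simp
        ultimately have "\<xi> (v - s ?d v0) = \<beta> (v - s ?d v0) w" using w by blast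
        then have e: "\<xi> v - ?d * \<xi> v0 = \<beta> v w - ?d * \<beta> v0 w"
          using linear_on_diff[OF assms(1) insert.prems(1) lw v d] linear_on_scale[OF lw v0(1)]
            linear_on_diff[OF assms(1) insert.prems(1) insert.prems(4) v d] linear_on_scale[OF insert.prems(4) v0(1)]
          by simp
        have "\<xi> v = \<beta> v w + c * \<beta> v b"
          using e v0(2) unfolding c_def by (simp add: field_simps)
        also have "\<dots> = \<beta> v (w + t c b)"
          using linear_on_add[OF insert.prems(3)[OF v] wi T.span_scale[OF b]] linear_on_scale[OF insert.prems(3)[OF v] b]
          by simp
        finally show ?thesis .
      qed
      then show ?thesis using wcb by blast
    qed
  qed
qed

section \<open>Contravariant functors on a linear category\<close>

lemma lin_iff: "f \<in> lin s V W \<longleftrightarrow> f ` V \<subseteq> W \<and> linear_on s s V f \<and> (\<forall>x. x \<notin> V \<longrightarrow> f x = 0)"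
  by (auto simp: lin_def linear_on_def)

lemma linD:
  assumes "f \<in> lin s V W"
  shows "x \<in> V \<Longrightarrow> f x \<in> W" and "linear_on s s V f" and "x \<notin> V \<Longrightarrow> f x = 0"
  using assms by (auto simp: lin_iff)

lemma lin_zero:
  assumes "vector_space s" "f \<in> lin s V W"
  shows "f 0 = 0"
  using linD(2,3)[OF assms(2)] linear_on_zero by metis

text \<open>Many maps below are not given by a formula but by a condition on their values.  A linear condition that
  only \<open>0\<close> satisfies at \<open>0\<close> has at most one solution at every point, and the solutions form a linear map.\<close>

lemma lin_of_relation:
  assumes s: "vector_space s" and V: "module.subspace s V" and W: "module.subspace s W"
    and ex: "\<And>x. x \<in> V \<Longrightarrow> \<exists>y\<in>W. r x y"
    and zero: "\<And>y. y \<in> W \<Longrightarrow> r 0 y \<Longrightarrow> y = 0"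
    and add: "\<And>x y x' y'. x \<in> V \<Longrightarrow> y \<in> W \<Longrightarrow> x' \<in> V \<Longrightarrow> y' \<in> W \<Longrightarrow> r x y \<Longrightarrow> r x' y' \<Longrightarrow> r (x + x') (y + y')"
    and scale: "\<And>c x y. x \<in> V \<Longrightarrow> y \<in> W \<Longrightarrow> r x y \<Longrightarrow> r (s c x) (s c y)"
  shows "\<exists>f\<in>lin s V W. \<forall>x\<in>V. r x (f x) \<and> (\<forall>y\<in>W. r x y \<longrightarrow> y = f x)"
proof -
  interpret vector_space s by fact
  note V' = subspace_addD[OF s V] subspace_scaleD[OF s V] and W' = subspace_addD[OF s W] subspace_scaleD[OF s W]
  have uniq: "y = y'" if "x \<in> V" "y \<in> W" "y' \<in> W" "r x y" "r x y'" for x y y'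
  proof -
    have "r (x + s (-1) x) (y + s (-1) y')"
      by (intro add scale V' W' that)
    then have "r 0 (y - y')" by simp
    then have "y - y' = 0" using zero subspace_diffD[OF s W that(2,3)] by blast
    then show ?thesis by simp
  qed
  obtain f0 where f0: "\<And>x. x \<in> V \<Longrightarrow> f0 x \<in> W \<and> r x (f0 x)" using ex by metis
  define f where "f x = (if x \<in> V then f0 x else 0)" for x
  have f: "f x \<in> W" "r x (f x)" if "x \<in> V" for x using f0[OF that] that by (simp_all add: f_def)
  have "linear_on s s V f"
  proof (rule linear_onI)
    fix x y assume x: "x \<in> V" and y: "y \<in> V"
    show "f (x + y) = f x + f y" by (rule uniq[of "x + y"]) (intro V' W' f add x y)+
  next
    fix c x assume x: "x \<in> V"
    show "f (s c x) = s c (f x)" by (rule uniq[of "s c x"]) (intro V' W' f scale x)+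
  qed
  then have "f \<in> lin s V W" using f(1) unfolding lin_iff by (auto simp: f_def)
  then show ?thesis using f uniq by blast
qed

text \<open>The values of the functors are subspaces of an ambient space with scalar multiplication \<open>s\<close>.  It is
  infinite-dimensional, so that morphism spaces, their duals and direct sums embed into it.\<close>

locale fd_category =
  fixes C :: "('o, 'm::ab_group_add, 'k::field) lincat"
    and s :: "'k \<Rightarrow> 'w::ab_group_add \<Rightarrow> 'w"
  assumes vs_Hom: "vector_space (Scal C)"
    and vs: "vector_space s"
    and infinite_ambient: "\<not> fin_dim s UNIV"
    and fin_dim_Hom: "X \<in> Obj C \<Longrightarrow> Y \<in> Obj C \<Longrightarrow> fin_dim (Scal C) (Hom C X Y)"
    and Id_Hom: "X \<in> Obj C \<Longrightarrow> Id C X \<in> Hom C X X"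
    and Comp_Hom: "X \<in> Obj C \<Longrightarrow> Y \<in> Obj C \<Longrightarrow> Z \<in> Obj C \<Longrightarrow>
      f \<in> Hom C X Y \<Longrightarrow> g \<in> Hom C Y Z \<Longrightarrow> Comp C g f \<in> Hom C X Z"
    and Comp_assoc: "Comp C (Comp C h g) f = Comp C h (Comp C g f)"
    and Comp_Id: "X \<in> Obj C \<Longrightarrow> Y \<in> Obj C \<Longrightarrow> f \<in> Hom C X Y \<Longrightarrow> Comp C f (Id C X) = f"
    and Id_Comp: "X \<in> Obj C \<Longrightarrow> Y \<in> Obj C \<Longrightarrow> f \<in> Hom C X Y \<Longrightarrow> Comp C (Id C Y) f = f"
    and Comp_add_right: "X \<in> Obj C \<Longrightarrow> Y \<in> Obj C \<Longrightarrow> Z \<in> Obj C \<Longrightarrow>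
      f \<in> Hom C X Y \<Longrightarrow> f' \<in> Hom C X Y \<Longrightarrow> g \<in> Hom C Y Z \<Longrightarrow> Comp C g (f + f') = Comp C g f + Comp C g f'"
    and Comp_scale_right: "X \<in> Obj C \<Longrightarrow> Y \<in> Obj C \<Longrightarrow> Z \<in> Obj C \<Longrightarrow>
      f \<in> Hom C X Y \<Longrightarrow> g \<in> Hom C Y Z \<Longrightarrow> Comp C g (Scal C c f) = Scal C c (Comp C g f)"
    and Comp_add_left: "X \<in> Obj C \<Longrightarrow> Y \<in> Obj C \<Longrightarrow> Z \<in> Obj C \<Longrightarrow>
      f \<in> Hom C X Y \<Longrightarrow> g \<in> Hom C Y Z \<Longrightarrow> g' \<in> Hom C Y Z \<Longrightarrow> Comp C (g + g') f = Comp C g f + Comp C g' f"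
    and Comp_scale_left: "X \<in> Obj C \<Longrightarrow> Y \<in> Obj C \<Longrightarrow> Z \<in> Obj C \<Longrightarrow>
      f \<in> Hom C X Y \<Longrightarrow> g \<in> Hom C Y Z \<Longrightarrow> Comp C (Scal C c g) f = Scal C c (Comp C g f)"
begin

lemma subspace_Hom: "X \<in> Obj C \<Longrightarrow> Y \<in> Obj C \<Longrightarrow> module.subspace (Scal C) (Hom C X Y)"
  using fin_dim_subspace[OF vs_Hom fin_dim_Hom] .

lemma
  assumes "F \<in> mod_op C t" "X \<in> Obj C"
  shows fobj_fin_dim: "fin_dim t (fobj F X)"
    and fmap_Id: "x \<in> fobj F X \<Longrightarrow> fmap F X X (Id C X) x = x"
  using assms by (auto simp: mod_op_def id_on_def)

lemma
  assumes "F \<in> mod_op C t" "X \<in> Obj C" "Y \<in> Obj C" "f \<in> Hom C X Y"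
  shows fmap_lin: "fmap F X Y f \<in> lin t (fobj F Y) (fobj F X)"
    and fmap_in: "y \<in> fobj F Y \<Longrightarrow> fmap F X Y f y \<in> fobj F X"
    and fmap_linear_on: "linear_on t t (fobj F Y) (fmap F X Y f)"
    and fmap_outside: "y \<notin> fobj F Y \<Longrightarrow> fmap F X Y f y = 0"
    and fmap_add_Hom: "f' \<in> Hom C X Y \<Longrightarrow> fmap F X Y (f + f') y = fmap F X Y f y + fmap F X Y f' y"
    and fmap_scale_Hom: "fmap F X Y (Scal C c f) y = t c (fmap F X Y f y)"
    and fmap_Comp: "Z \<in> Obj C \<Longrightarrow> g \<in> Hom C Y Z \<Longrightarrow> fmap F X Z (Comp C g f) z = fmap F X Y f (fmap F Y Z g z)"
proof -
  show l: "fmap F X Y f \<in> lin t (fobj F Y) (fobj F X)"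
    using assms unfolding mod_op_def by blast
  show "y \<in> fobj F Y \<Longrightarrow> fmap F X Y f y \<in> fobj F X" "linear_on t t (fobj F Y) (fmap F X Y f)"
    "y \<notin> fobj F Y \<Longrightarrow> fmap F X Y f y = 0"
    using linD[OF l] by blast+
  show "f' \<in> Hom C X Y \<Longrightarrow> fmap F X Y (f + f') y = fmap F X Y f y + fmap F X Y f' y"
    using assms unfolding mod_op_def by simp
  show "fmap F X Y (Scal C c f) y = t c (fmap F X Y f y)"
    using assms unfolding mod_op_def by simp
  show "Z \<in> Obj C \<Longrightarrow> g \<in> Hom C Y Z \<Longrightarrow> fmap F X Z (Comp C g f) z = fmap F X Y f (fmap F Y Z g z)"
    using assms unfolding mod_op_def by simp
qed

lemma mod_opI:
  assumes "vector_space t"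
    and "\<And>X. X \<in> Obj C \<Longrightarrow> fin_dim t (fobj F X)"
    and "\<And>X Y f y. X \<in> Obj C \<Longrightarrow> Y \<in> Obj C \<Longrightarrow> f \<in> Hom C X Y \<Longrightarrow> y \<in> fobj F Y \<Longrightarrow> fmap F X Y f y \<in> fobj F X"
    and "\<And>X Y f. X \<in> Obj C \<Longrightarrow> Y \<in> Obj C \<Longrightarrow> f \<in> Hom C X Y \<Longrightarrow> linear_on t t (fobj F Y) (fmap F X Y f)"
    and outside: "\<And>X Y f y. X \<in> Obj C \<Longrightarrow> Y \<in> Obj C \<Longrightarrow> f \<in> Hom C X Y \<Longrightarrow> y \<notin> fobj F Y \<Longrightarrow> fmap F X Y f y = 0"
    and "\<And>X x. X \<in> Obj C \<Longrightarrow> x \<in> fobj F X \<Longrightarrow> fmap F X X (Id C X) x = x"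
    and comp: "\<And>X Y Z f g z. X \<in> Obj C \<Longrightarrow> Y \<in> Obj C \<Longrightarrow> Z \<in> Obj C \<Longrightarrow> f \<in> Hom C X Y \<Longrightarrow> g \<in> Hom C Y Z \<Longrightarrow>
      z \<in> fobj F Z \<Longrightarrow> fmap F X Z (Comp C g f) z = fmap F X Y f (fmap F Y Z g z)"
    and add: "\<And>X Y f f' y. X \<in> Obj C \<Longrightarrow> Y \<in> Obj C \<Longrightarrow> f \<in> Hom C X Y \<Longrightarrow> f' \<in> Hom C X Y \<Longrightarrow> y \<in> fobj F Y \<Longrightarrow>
      fmap F X Y (f + f') y = fmap F X Y f y + fmap F X Y f' y"
    and scale: "\<And>X Y f c y. X \<in> Obj C \<Longrightarrow> Y \<in> Obj C \<Longrightarrow> f \<in> Hom C X Y \<Longrightarrow> y \<in> fobj F Y \<Longrightarrow>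
      fmap F X Y (Scal C c f) y = t c (fmap F X Y f y)"
  shows "F \<in> mod_op C t"
proof -
  interpret T: vector_space t by fact
  have l: "fmap F X Y f \<in> lin t (fobj F Y) (fobj F X)" if "X \<in> Obj C" "Y \<in> Obj C" "f \<in> Hom C X Y" for X Y f
    using that assms(3,4,5) unfolding lin_iff by blast
  have zero: "fmap F X Y f 0 = 0" if "X \<in> Obj C" "Y \<in> Obj C" "f \<in> Hom C X Y" for X Y f
    using lin_zero[OF assms(1) l[OF that]] .
  have 1: "fmap F X X (Id C X) = id_on (fobj F X)" if "X \<in> Obj C" for X
  proof
    show "fmap F X X (Id C X) x = id_on (fobj F X) x" for x
      using assms(6)[OF that, of x] outside[OF that that Id_Hom[OF that], of x] by (simp add: id_on_def)
  qed
  have 2: "fmap F X Z (Comp C g f) = fmap F X Y f \<circ> fmap F Y Z g"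
    if "X \<in> Obj C" "Y \<in> Obj C" "Z \<in> Obj C" "f \<in> Hom C X Y" "g \<in> Hom C Y Z" for X Y Z f g
  proof
    show "fmap F X Z (Comp C g f) z = (fmap F X Y f \<circ> fmap F Y Z g) z" for z
      using comp[OF that, of z] outside[OF that(1,3) Comp_Hom[OF that], of z]
        outside[OF that(2,3,5), of z] zero[OF that(1,2,4)]
      by (cases "z \<in> fobj F Z") simp_all
  qed
  have 3: "fmap F X Y (f + f') = fmap F X Y f + fmap F X Y f'"
    if "X \<in> Obj C" "Y \<in> Obj C" "f \<in> Hom C X Y" "f' \<in> Hom C X Y" for X Y f f'
  proof
    have ff: "f + f' \<in> Hom C X Y" using subspace_addD[OF vs_Hom subspace_Hom] that by blast
    show "fmap F X Y (f + f') y = (fmap F X Y f + fmap F X Y f') y" for y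
      using add[OF that, of y] outside[OF that(1,2) ff, of y] outside[OF that(1-3), of y] outside[OF that(1,2,4), of y]
      by (cases "y \<in> fobj F Y") simp_all
  qed
  have 4: "fmap F X Y (Scal C c f) = (\<lambda>y. t c (fmap F X Y f y))"
    if "X \<in> Obj C" "Y \<in> Obj C" "f \<in> Hom C X Y" for X Y f c
  proof
    have cf: "Scal C c f \<in> Hom C X Y" using subspace_scaleD[OF vs_Hom subspace_Hom] that by blast
    show "fmap F X Y (Scal C c f) y = t c (fmap F X Y f y)" for y
      using scale[OF that, of y c] outside[OF that(1,2) cf, of y] outside[OF that, of y]
      by (cases "y \<in> fobj F Y") simp_all
  qed
  show ?thesis
    unfolding mod_op_def using assms(2) l 1 2 3 4 by simp
qed

lemma
  assumes "\<eta> \<in> nat_trans C t F G" "X \<in> Obj C"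
  shows nat_trans_lin: "\<eta> X \<in> lin t (fobj F X) (fobj G X)"
    and nat_trans_in: "x \<in> fobj F X \<Longrightarrow> \<eta> X x \<in> fobj G X"
    and nat_trans_linear_on: "linear_on t t (fobj F X) (\<eta> X)"
    and nat_trans_outside: "x \<notin> fobj F X \<Longrightarrow> \<eta> X x = 0"
    and nat_trans_natural: "Y \<in> Obj C \<Longrightarrow> f \<in> Hom C X Y \<Longrightarrow> \<eta> X (fmap F X Y f y) = fmap G X Y f (\<eta> Y y)"
proof -
  show l: "\<eta> X \<in> lin t (fobj F X) (fobj G X)"
    using assms unfolding nat_trans_def lin_fam_def by simp
  show "x \<in> fobj F X \<Longrightarrow> \<eta> X x \<in> fobj G X" "linear_on t t (fobj F X) (\<eta> X)" "x \<notin> fobj F X \<Longrightarrow> \<eta> X x = 0"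
    using linD[OF l] by blast+
  assume Y: "Y \<in> Obj C" "f \<in> Hom C X Y"
  then have "\<eta> X \<circ> fmap F X Y f = fmap G X Y f \<circ> \<eta> Y"
    using assms unfolding nat_trans_def by simp
  then show "\<eta> X (fmap F X Y f y) = fmap G X Y f (\<eta> Y y)" by (metis comp_apply)
qed

lemma nat_trans_outside_Obj: "\<eta> \<in> nat_trans C t F G \<Longrightarrow> X \<notin> Obj C \<Longrightarrow> \<eta> X x = 0"
  by (simp add: nat_trans_def lin_fam_def)

lemma nat_transI:
  assumes "vector_space t" "F \<in> mod_op C t" "G \<in> mod_op C t"
    and "\<And>X x. X \<in> Obj C \<Longrightarrow> x \<in> fobj F X \<Longrightarrow> \<eta> X x \<in> fobj G X"
    and "\<And>X. X \<in> Obj C \<Longrightarrow> linear_on t t (fobj F X) (\<eta> X)"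
    and out: "\<And>X x. \<not> (X \<in> Obj C \<and> x \<in> fobj F X) \<Longrightarrow> \<eta> X x = 0"
    and nat: "\<And>X Y f y. X \<in> Obj C \<Longrightarrow> Y \<in> Obj C \<Longrightarrow> f \<in> Hom C X Y \<Longrightarrow> y \<in> fobj F Y \<Longrightarrow>
      \<eta> X (fmap F X Y f y) = fmap G X Y f (\<eta> Y y)"
  shows "\<eta> \<in> nat_trans C t F G"
proof -
  have l: "\<eta> X \<in> lin t (fobj F X) (fobj G X)" if "X \<in> Obj C" for X
    using that assms(4,5) out unfolding lin_iff by blast
  have "\<eta> X \<circ> fmap F X Y f = fmap G X Y f \<circ> \<eta> Y" if "X \<in> Obj C" "Y \<in> Obj C" "f \<in> Hom C X Y" for X Y f
  proof
    show "(\<eta> X \<circ> fmap F X Y f) y = (fmap G X Y f \<circ> \<eta> Y) y" for y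
      using nat[OF that, of y] out[of Y y] fmap_outside[OF assms(2) that, of y] lin_zero[OF assms(1) l[OF that(1)]]
        lin_zero[OF assms(1) fmap_lin[OF assms(3) that]]
      by (cases "y \<in> fobj F Y") simp_all
  qed
  moreover have "\<eta> X = 0" if "X \<notin> Obj C" for X using out that by (simp add: fun_eq_iff)
  ultimately show ?thesis using l unfolding nat_trans_def lin_fam_def by simp
qed

lemma nat_trans_eqI:
  assumes "\<eta> \<in> nat_trans C s F H" "\<theta> \<in> nat_trans C s F G" "\<pi> \<in> nat_trans C s G H"
    and "\<And>X x. X \<in> Obj C \<Longrightarrow> x \<in> fobj F X \<Longrightarrow> \<pi> X (\<theta> X x) = \<eta> X x"
  shows "\<pi> \<circ>\<circ> \<theta> = \<eta>"
proof (intro ext)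
  fix X x
  show "(\<pi> \<circ>\<circ> \<theta>) X x = \<eta> X x"
  proof (cases "X \<in> Obj C \<and> x \<in> fobj F X")
    case False
    then have "\<eta> X x = 0" "\<theta> X x = 0"
      using assms(1,2) nat_trans_outside nat_trans_outside_Obj by metis+
    moreover have "\<pi> X 0 = 0"
      using lin_zero[OF vs nat_trans_lin[OF assms(3)]] nat_trans_outside_Obj[OF assms(3)] by (cases "X \<in> Obj C") auto
    ultimately show ?thesis by (simp add: comp_fam_def)
  qed (use assms(4) in \<open>simp add: comp_fam_def\<close>)
qed

lemmas fobj_subspace = fin_dim_subspace[OF _ fobj_fin_dim]

text \<open>Evaluation at the universal element \<open>u\<close> identifies \<open>Hom(-, Y)\<close> with \<open>P\<close>.\<close>

definition represents :: "('o, 'm, 'w) cofunctor \<Rightarrow> 'o \<Rightarrow> 'w \<Rightarrow> bool" where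
  "represents P Y u \<longleftrightarrow> P \<in> mod_op C s \<and> Y \<in> Obj C \<and> u \<in> fobj P Y \<and>
     (\<forall>X\<in>Obj C. \<forall>x\<in>fobj P X. \<exists>f\<in>Hom C X Y. x = fmap P X Y f u) \<and>
     (\<forall>X\<in>Obj C. \<forall>f\<in>Hom C X Y. fmap P X Y f u = 0 \<longrightarrow> f = 0)"

text \<open>The pairing \<open>(f, x) \<mapsto> u (J f x)\<close> of \<open>Hom(Y, X)\<close> with \<open>J X\<close> is nondegenerate on both sides.  As both spaces
  are finite-dimensional, this identifies \<open>J\<close> with the dual \<open>D Hom(Y, -)\<close>.\<close>

definition corepresents :: "('o, 'm, 'w) cofunctor \<Rightarrow> 'o \<Rightarrow> ('w \<Rightarrow> 'k) \<Rightarrow> bool" where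
  "corepresents J Y u \<longleftrightarrow> J \<in> mod_op C s \<and> Y \<in> Obj C \<and> functional_on s (fobj J Y) u \<and>
     (\<forall>X\<in>Obj C. \<forall>x\<in>fobj J X. (\<forall>f\<in>Hom C Y X. u (fmap J Y X f x) = 0) \<longrightarrow> x = 0) \<and>
     (\<forall>X\<in>Obj C. \<forall>f\<in>Hom C Y X. (\<forall>x\<in>fobj J X. u (fmap J Y X f x) = 0) \<longrightarrow> f = 0)"

lemma fmap_functional_Hom:
  assumes "F \<in> mod_op C t" "X \<in> Obj C" "Y \<in> Obj C" "y \<in> fobj F Y"
  shows "linear_on (Scal C) t (Hom C X Y) (\<lambda>f. fmap F X Y f y)"
  using assms fmap_add_Hom fmap_scale_Hom by (intro linear_onI) blast+

lemma nat_trans_of_relation: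
  assumes F: "F \<in> mod_op C s" and G: "G \<in> mod_op C s"
    and ex: "\<And>X x. X \<in> Obj C \<Longrightarrow> x \<in> fobj F X \<Longrightarrow> \<exists>y\<in>fobj G X. r X x y"
    and zero: "\<And>X y. X \<in> Obj C \<Longrightarrow> y \<in> fobj G X \<Longrightarrow> r X 0 y \<Longrightarrow> y = 0"
    and add: "\<And>X x y x' y'. X \<in> Obj C \<Longrightarrow> x \<in> fobj F X \<Longrightarrow> y \<in> fobj G X \<Longrightarrow> x' \<in> fobj F X \<Longrightarrow> y' \<in> fobj G X \<Longrightarrow>
      r X x y \<Longrightarrow> r X x' y' \<Longrightarrow> r X (x + x') (y + y')"
    and scale: "\<And>X c x y. X \<in> Obj C \<Longrightarrow> x \<in> fobj F X \<Longrightarrow> y \<in> fobj G X \<Longrightarrow> r X x y \<Longrightarrow> r X (s c x) (s c y)"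
    and nat: "\<And>X Y f x y. X \<in> Obj C \<Longrightarrow> Y \<in> Obj C \<Longrightarrow> f \<in> Hom C X Y \<Longrightarrow> x \<in> fobj F Y \<Longrightarrow> y \<in> fobj G Y \<Longrightarrow>
      r Y x y \<Longrightarrow> r X (fmap F X Y f x) (fmap G X Y f y)"
  obtains \<theta> where "\<theta> \<in> nat_trans C s F G"
    "\<And>X x y. X \<in> Obj C \<Longrightarrow> x \<in> fobj F X \<Longrightarrow> y \<in> fobj G X \<Longrightarrow> r X x y \<longleftrightarrow> y = \<theta> X x"
proof -
  have "\<exists>f\<in>lin s (fobj F X) (fobj G X). \<forall>x\<in>fobj F X. r X x (f x) \<and> (\<forall>y\<in>fobj G X. r X x y \<longrightarrow> y = f x)"
    if X: "X \<in> Obj C" for X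
    by (rule lin_of_relation[OF vs fobj_subspace[OF vs F X] fobj_subspace[OF vs G X]]) (fact ex[OF X] zero[OF X] add[OF X] scale[OF X])+
  then obtain \<theta>0 where \<theta>0: "\<And>X. X \<in> Obj C \<Longrightarrow> \<theta>0 X \<in> lin s (fobj F X) (fobj G X) \<and>
    (\<forall>x\<in>fobj F X. r X x (\<theta>0 X x) \<and> (\<forall>y\<in>fobj G X. r X x y \<longrightarrow> y = \<theta>0 X x))" by metis
  define \<theta> where "\<theta> X = (if X \<in> Obj C then \<theta>0 X else 0)" for X
  have l: "\<theta> X \<in> lin s (fobj F X) (fobj G X)" and r: "x \<in> fobj F X \<Longrightarrow> r X x (\<theta> X x)"
    and u: "x \<in> fobj F X \<Longrightarrow> y \<in> fobj G X \<Longrightarrow> r X x y \<Longrightarrow> y = \<theta> X x" if "X \<in> Obj C" for X x y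
    using \<theta>0[OF that] that by (simp_all add: \<theta>_def)
  have "\<theta> \<in> nat_trans C s F G"
  proof (rule nat_transI[OF vs F G])
    fix X Y f y assume X: "X \<in> Obj C" and Y: "Y \<in> Obj C" and f: "f \<in> Hom C X Y" and y: "y \<in> fobj F Y"
    note ty = linD(1)[OF l[OF Y] y]
    show "\<theta> X (fmap F X Y f y) = fmap G X Y f (\<theta> Y y)"
      by (rule u[OF X, symmetric]) (intro fmap_in[OF F X Y f y] fmap_in[OF G X Y f ty] nat[OF X Y f y ty r[OF Y y]])+
  next
    fix X x assume "\<not> (X \<in> Obj C \<and> x \<in> fobj F X)"
    then show "\<theta> X x = 0" using linD(3)[OF l, of X x] by (cases "X \<in> Obj C") (simp_all add: \<theta>_def)
  qed (use linD[OF l] in blast)+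
  then show thesis using that r u by blast
qed

text \<open>A functor generated by one element \<open>z\<close> maps to \<open>E\<close> by sending \<open>z\<close> to any element that satisfies all
  relations of \<open>z\<close>.\<close>

lemma nat_trans_from_generator:
  assumes F: "F \<in> mod_op C s" and E: "E \<in> mod_op C s" and Y: "Y \<in> Obj C" and z: "z \<in> fobj F Y" and a: "a \<in> fobj E Y"
    and gen: "\<And>X x. X \<in> Obj C \<Longrightarrow> x \<in> fobj F X \<Longrightarrow> \<exists>f\<in>Hom C X Y. x = fmap F X Y f z"
    and rel: "\<And>X f. X \<in> Obj C \<Longrightarrow> f \<in> Hom C X Y \<Longrightarrow> fmap F X Y f z = 0 \<Longrightarrow> fmap E X Y f a = 0"
  obtains \<theta> where "\<theta> \<in> nat_trans C s F E"
    "\<And>X f. X \<in> Obj C \<Longrightarrow> f \<in> Hom C X Y \<Longrightarrow> \<theta> X (fmap F X Y f z) = fmap E X Y f a"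
proof -
  let ?r = "\<lambda>X x y. \<exists>f\<in>Hom C X Y. x = fmap F X Y f z \<and> y = fmap E X Y f a"
  obtain \<theta> where \<theta>: "\<theta> \<in> nat_trans C s F E"
    "\<And>X x y. X \<in> Obj C \<Longrightarrow> x \<in> fobj F X \<Longrightarrow> y \<in> fobj E X \<Longrightarrow> ?r X x y \<longleftrightarrow> y = \<theta> X x"
  proof (rule nat_trans_of_relation[OF F E, of ?r])
    fix X assume X: "X \<in> Obj C"
    show "\<exists>y\<in>fobj E X. ?r X x y" if "x \<in> fobj F X" for x using gen[OF X that] fmap_in[OF E X Y _ a] by blast
    show "y = 0" if "?r X 0 y" for y using that rel[OF X] by force
    show "?r X (s c x) (s c y)" if "?r X x y" for c x y
      using that fmap_scale_Hom[OF F X Y] fmap_scale_Hom[OF E X Y] subspace_scaleD[OF vs_Hom subspace_Hom[OF X Y]] by metis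
    show "?r X (x + x') (y + y')" if "?r X x y" "?r X x' y'" for x y x' y'
      using that fmap_add_Hom[OF F X Y] fmap_add_Hom[OF E X Y] subspace_addD[OF vs_Hom subspace_Hom[OF X Y]] by metis
    fix X' h x y assume X': "X' \<in> Obj C" and h: "h \<in> Hom C X X'" and "?r X' x y"
    then obtain f where f: "f \<in> Hom C X' Y" "x = fmap F X' Y f z" "y = fmap E X' Y f a" by blast
    show "?r X (fmap F X X' h x) (fmap E X X' h y)"
      using Comp_Hom[OF X X' Y h f(1)] fmap_Comp[OF F X X' h Y f(1)] fmap_Comp[OF E X X' h Y f(1)] f(2,3) by metis
  qed blast
  have "\<theta> X (fmap F X Y f z) = fmap E X Y f a" if X: "X \<in> Obj C" and f: "f \<in> Hom C X Y" for X f
    using \<theta>(2)[OF X fmap_in[OF F X Y f z] fmap_in[OF E X Y f a]] f by auto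
  then show thesis using that \<theta>(1) by blast
qed

lemma yoneda:
  assumes P: "represents P Y u" and F: "F \<in> mod_op C s" and a: "a \<in> fobj F Y"
  obtains \<theta> where "\<theta> \<in> nat_trans C s P F"
    "\<And>X f. X \<in> Obj C \<Longrightarrow> f \<in> Hom C X Y \<Longrightarrow> \<theta> X (fmap P X Y f u) = fmap F X Y f a"
proof -
  have Y: "Y \<in> Obj C" using P unfolding represents_def by blast
  have "fmap F X Y f a = 0" if X: "X \<in> Obj C" and f: "f \<in> Hom C X Y" "fmap P X Y f u = 0" for X f
  proof -
    have "f = 0" using P X f unfolding represents_def by blast
    then show ?thesis
      using linear_on_zero[OF fmap_functional_Hom[OF F X Y a] subspace_zeroD[OF vs_Hom subspace_Hom[OF X Y]]] by simp
  qed
  then show thesis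
    using nat_trans_from_generator[OF _ F Y _ a, of P u] P that unfolding represents_def by blast
qed

lemma represents_projective:
  assumes P: "represents P Y u"
  shows "projective_functor C s P"
  unfolding projective_functor_def
proof (intro conjI ballI impI)
  show Pm: "P \<in> mod_op C s" using P unfolding represents_def by blast
  fix F G \<pi> \<eta>
  assume F: "F \<in> mod_op C s" and G: "G \<in> mod_op C s" and \<pi>: "\<pi> \<in> nat_trans C s F G"
    and \<eta>: "\<eta> \<in> nat_trans C s P G" and epi: "nt_epi C F G \<pi>"
  have Y: "Y \<in> Obj C" and u: "u \<in> fobj P Y" using P unfolding represents_def by blast+
  have "\<eta> Y u \<in> \<pi> Y ` fobj F Y" using nat_trans_in[OF \<eta> Y u] epi Y unfolding nt_epi_def by blast
  then obtain a where a: "a \<in> fobj F Y" "\<pi> Y a = \<eta> Y u" by auto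
  obtain \<theta> where \<theta>: "\<theta> \<in> nat_trans C s P F"
    "\<And>X f. X \<in> Obj C \<Longrightarrow> f \<in> Hom C X Y \<Longrightarrow> \<theta> X (fmap P X Y f u) = fmap F X Y f a"
    using yoneda[OF P F a(1)] by blast
  have "\<pi> \<circ>\<circ> \<theta> = \<eta>"
  proof (rule nat_trans_eqI[OF \<eta> \<theta>(1) \<pi>])
    fix X x assume X: "X \<in> Obj C" and "x \<in> fobj P X"
    then obtain f where f: "f \<in> Hom C X Y" "x = fmap P X Y f u" using P unfolding represents_def by blast
    show "\<pi> X (\<theta> X x) = \<eta> X x"
      using \<theta>(2)[OF X f(1)] nat_trans_natural[OF \<pi> X Y f(1), of a] nat_trans_natural[OF \<eta> X Y f(1), of u] a(2) f(2)
      by simp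
  qed
  then show "\<exists>\<theta>\<in>nat_trans C s P F. \<pi> \<circ>\<circ> \<theta> = \<eta>" using \<theta>(1) by blast
qed

lemma
  assumes J: "J \<in> mod_op C s" and X: "X \<in> Obj C" and Y: "Y \<in> Obj C" and u: "functional_on s (fobj J Y) u"
  shows pairing_functional_Hom: "x \<in> fobj J X \<Longrightarrow> functional_on (Scal C) (Hom C Y X) (\<lambda>f. u (fmap J Y X f x))"
    and pairing_functional_fobj: "f \<in> Hom C Y X \<Longrightarrow> functional_on s (fobj J X) (\<lambda>x. u (fmap J Y X f x))"
proof -
  show "functional_on (Scal C) (Hom C Y X) (\<lambda>f. u (fmap J Y X f x))" if "x \<in> fobj J X"
    by (rule linear_on_compose[OF fmap_functional_Hom[OF J Y X that] u]) (use fmap_in[OF J Y X _ that] in blast)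
  show "functional_on s (fobj J X) (\<lambda>x. u (fmap J Y X f x))" if "f \<in> Hom C Y X"
    by (rule linear_on_compose[OF fmap_linear_on[OF J Y X that] u]) (use fmap_in[OF J Y X that] in blast)
qed

text \<open>The functional \<open>f \<mapsto> w (F f x)\<close> on \<open>Hom(Y, X)\<close> is represented by a unique element of \<open>J X\<close>, which is
  taken as the image of \<open>x\<close>.  In this way functionals on \<open>F Y\<close> give maps from \<open>F\<close> to \<open>D Hom(Y, -)\<close>.\<close>

lemma coyoneda:
  assumes J: "corepresents J Y u" and F: "F \<in> mod_op C s" and w: "functional_on s (fobj F Y) w"
  obtains \<theta> where "\<theta> \<in> nat_trans C s F J"
    "\<And>X f x. X \<in> Obj C \<Longrightarrow> f \<in> Hom C Y X \<Longrightarrow> x \<in> fobj F X \<Longrightarrow> u (fmap J Y X f (\<theta> X x)) = w (fmap F Y X f x)"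
proof -
  have Jm: "J \<in> mod_op C s" and Y: "Y \<in> Obj C" and u: "functional_on s (fobj J Y) u"
    and inj: "\<And>X x. X \<in> Obj C \<Longrightarrow> x \<in> fobj J X \<Longrightarrow> (\<And>f. f \<in> Hom C Y X \<Longrightarrow> u (fmap J Y X f x) = 0) \<Longrightarrow> x = 0"
    and nd: "\<And>X f. X \<in> Obj C \<Longrightarrow> f \<in> Hom C Y X \<Longrightarrow> (\<forall>x\<in>fobj J X. u (fmap J Y X f x) = 0) \<Longrightarrow> f = 0"
    using J unfolding corepresents_def by blast+
  let ?r = "\<lambda>X x y. \<forall>f\<in>Hom C Y X. u (fmap J Y X f y) = w (fmap F Y X f x)"
  have ex: "\<exists>y\<in>fobj J X. ?r X x y"
    if X: "X \<in> Obj C" and x: "x \<in> fobj F X" for X x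
  proof -
    have "\<exists>y\<in>fobj J X. \<forall>f\<in>Hom C Y X. w (fmap F Y X f x) = u (fmap J Y X f y)"
    proof (rule double_annihilator[OF vs_Hom vs subspace_Hom[OF Y X] fobj_fin_dim[OF Jm X]])
      show "functional_on (Scal C) (Hom C Y X) (\<lambda>f. w (fmap F Y X f x))"
        by (rule pairing_functional_Hom[OF F X Y w x])
      show "w (fmap F Y X f x) = 0" if "f \<in> Hom C Y X" "\<forall>x\<in>fobj J X. u (fmap J Y X f x) = 0" for f
      proof -
        have "f = 0" using nd[OF X that] .
        then show ?thesis
          using linear_on_zero[OF pairing_functional_Hom[OF F X Y w x] subspace_zeroD[OF vs_Hom subspace_Hom[OF Y X]]]
          by simp
      qed
    qed (use pairing_functional_Hom[OF Jm X Y u] pairing_functional_fobj[OF Jm X Y u] in blast)+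
    then show ?thesis by force
  qed
  obtain \<theta> where \<theta>: "\<theta> \<in> nat_trans C s F J"
    "\<And>X x y. X \<in> Obj C \<Longrightarrow> x \<in> fobj F X \<Longrightarrow> y \<in> fobj J X \<Longrightarrow> ?r X x y \<longleftrightarrow> y = \<theta> X x"
  proof (rule nat_trans_of_relation[OF F Jm, of ?r])
    fix X assume X: "X \<in> Obj C"
    note lJ = pairing_functional_fobj[OF Jm X Y u] and lF = pairing_functional_fobj[OF F X Y w]
    show "\<exists>y\<in>fobj J X. ?r X x y" if "x \<in> fobj F X" for x by (rule ex[OF X that])
    show "y = 0" if "y \<in> fobj J X" "?r X 0 y" for y
      using inj[OF X that(1)] that(2) linear_on_zero[OF lF subspace_zeroD[OF vs fobj_subspace[OF vs F X]]] by simp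
    show "?r X (s c x) (s c y)" if "x \<in> fobj F X" "y \<in> fobj J X" "?r X x y" for c x y
      using linear_on_scale[OF lF that(1)] linear_on_scale[OF lJ that(2)] that(3) by simp
    show "?r X (x + x') (y + y')"
      if "x \<in> fobj F X" "y \<in> fobj J X" "x' \<in> fobj F X" "y' \<in> fobj J X" "?r X x y" "?r X x' y'" for x y x' y'
      using linear_on_add[OF lF that(1,3)] linear_on_add[OF lJ that(2,4)] that(5,6) by simp
    fix X' h x y assume X': "X' \<in> Obj C" and h: "h \<in> Hom C X X'" and "?r X' x y"
    show "?r X (fmap F X X' h x) (fmap J X X' h y)"
    proof
      fix f assume f: "f \<in> Hom C Y X"
      show "u (fmap J Y X f (fmap J X X' h y)) = w (fmap F Y X f (fmap F X X' h x))"
        using \<open>?r X' x y\<close> Comp_Hom[OF Y X X' f h] fmap_Comp[OF F Y X f X' h] fmap_Comp[OF Jm Y X f X' h] by metis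
    qed
  qed blast
  then show thesis using that nat_trans_in[OF \<theta>(1)] by blast
qed

lemma corepresents_eqI:
  assumes J: "corepresents J Y u" and X: "X \<in> Obj C" and x: "x \<in> fobj J X" and y: "y \<in> fobj J X"
    and eq: "\<And>f. f \<in> Hom C Y X \<Longrightarrow> u (fmap J Y X f x) = u (fmap J Y X f y)"
  shows "x = y"
proof -
  have Jm: "J \<in> mod_op C s" and Y: "Y \<in> Obj C" and u: "functional_on s (fobj J Y) u"
    using J unfolding corepresents_def by blast+
  note sub = fobj_subspace[OF vs Jm X]
  have "u (fmap J Y X f (x - y)) = 0" if f: "f \<in> Hom C Y X" for f
    using linear_on_diff[OF vs sub pairing_functional_fobj[OF Jm X Y u f] x y] eq[OF f] by simp
  then have "x - y = 0" using J X subspace_diffD[OF vs sub x y] unfolding corepresents_def by blast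
  then show ?thesis by simp
qed

text \<open>By \<open>coyoneda\<close>, extending a map to \<open>J\<close> along a monomorphism means extending one functional along the
  injection at the object \<open>Y\<close>.\<close>

lemma corepresents_injective:
  assumes J: "corepresents J Y u"
  shows "injective_functor C s J"
  unfolding injective_functor_def
proof (intro conjI ballI impI)
  show Jm: "J \<in> mod_op C s" using J unfolding corepresents_def by blast
  fix F G \<mu> \<eta>
  assume F: "F \<in> mod_op C s" and G: "G \<in> mod_op C s" and \<mu>: "\<mu> \<in> nat_trans C s F G"
    and \<eta>: "\<eta> \<in> nat_trans C s F J" and mono: "nt_mono C F \<mu>"
  have Y: "Y \<in> Obj C" and u: "functional_on s (fobj J Y) u" using J unfolding corepresents_def by blast+
  have "functional_on s (fobj F Y) (\<lambda>x. u (\<eta> Y x))"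
    by (rule linear_on_compose[OF nat_trans_linear_on[OF \<eta> Y] u]) (use nat_trans_in[OF \<eta> Y] in blast)
  then obtain w where w: "functional_on s UNIV w" "\<And>x. x \<in> fobj F Y \<Longrightarrow> w (\<mu> Y x) = u (\<eta> Y x)"
    using functional_extend_along_injection[OF vs vs fobj_subspace[OF vs F Y] nat_trans_linear_on[OF \<mu> Y]] mono Y
    unfolding nt_mono_def by metis
  have "functional_on s (fobj G Y) w" using w(1) by (rule linear_on_subset) simp
  then obtain \<theta> where \<theta>: "\<theta> \<in> nat_trans C s G J"
    "\<And>X f x. X \<in> Obj C \<Longrightarrow> f \<in> Hom C Y X \<Longrightarrow> x \<in> fobj G X \<Longrightarrow> u (fmap J Y X f (\<theta> X x)) = w (fmap G Y X f x)"
    using coyoneda[OF J G] by blast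
  have "\<theta> \<circ>\<circ> \<mu> = \<eta>"
  proof (rule nat_trans_eqI[OF \<eta> \<mu> \<theta>(1)])
    fix X x assume X: "X \<in> Obj C" and x: "x \<in> fobj F X"
    note mx = nat_trans_in[OF \<mu> X x]
    show "\<theta> X (\<mu> X x) = \<eta> X x"
    proof (rule corepresents_eqI[OF J X nat_trans_in[OF \<theta>(1) X mx] nat_trans_in[OF \<eta> X x]])
      fix f assume f: "f \<in> Hom C Y X"
      show "u (fmap J Y X f (\<theta> X (\<mu> X x))) = u (fmap J Y X f (\<eta> X x))"
        using \<theta>(2)[OF X f mx] nat_trans_natural[OF \<mu> Y X f, of x] w(2)[OF fmap_in[OF F Y X f x]]
          nat_trans_natural[OF \<eta> Y X f, of x] by simp
    qed
  qed
  then show "\<exists>\<theta>\<in>nat_trans C s G J. \<theta> \<circ>\<circ> \<mu> = \<eta>" using \<theta>(1) by blast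
qed

text \<open>Choose an embedding of the value at each object, independently of the other objects, and conjugate the
  maps of the functor with these embeddings.\<close>

lemma transport:
  fixes t :: "'k \<Rightarrow> 'x::ab_group_add \<Rightarrow> 'x"
  assumes t: "vector_space t" and F: "F \<in> mod_op C t"
  obtains F' e where "F' \<in> mod_op C s" "\<And>X. X \<in> Obj C \<Longrightarrow> linear_on t s (fobj F X) (e X)"
    "\<And>X. X \<in> Obj C \<Longrightarrow> bij_betw (e X) (fobj F X) (fobj F' X)"
    "\<And>X Y f y. X \<in> Obj C \<Longrightarrow> Y \<in> Obj C \<Longrightarrow> f \<in> Hom C X Y \<Longrightarrow> y \<in> fobj F Y \<Longrightarrow>
      fmap F' X Y f (e Y y) = e X (fmap F X Y f y)"
proof -
  have "\<exists>e. linear_on t s (fobj F X) e \<and> inj_on e (fobj F X)" if "X \<in> Obj C" for X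
    using linear_embedding[OF t vs infinite_ambient fobj_fin_dim[OF F that]] by metis
  then obtain e where e: "\<And>X. X \<in> Obj C \<Longrightarrow> linear_on t s (fobj F X) (e X) \<and> inj_on (e X) (fobj F X)" by metis
  define i where "i X = the_inv_into (fobj F X) (e X)" for X
  have i: "i X (e X x) = x" if "X \<in> Obj C" "x \<in> fobj F X" for X x
    using the_inv_into_f_f e that unfolding i_def by metis
  let ?F = "\<lparr> fobj = \<lambda>X. e X ` fobj F X,
    fmap = \<lambda>X Y f y. if y \<in> e Y ` fobj F Y then e X (fmap F X Y f (i Y y)) else 0 \<rparr>"
  have nat: "fmap ?F X Y f (e Y y) = e X (fmap F X Y f y)" if "Y \<in> Obj C" "y \<in> fobj F Y" for X Y f y
    using that i by simp
  have "?F \<in> mod_op C s"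
  proof (rule mod_opI[OF vs])
    fix X assume X: "X \<in> Obj C"
    show "fin_dim s (fobj ?F X)" using fin_dim_image[OF t vs fobj_fin_dim[OF F X]] e[OF X] by simp
    show "fmap ?F X X (Id C X) x = x" if "x \<in> fobj ?F X" for x
    proof -
      obtain x' where x': "x' \<in> fobj F X" "x = e X x'" using \<open>x \<in> fobj ?F X\<close> by auto
      show ?thesis using nat[OF X x'(1), of X "Id C X"] fmap_Id[OF F X x'(1)] x'(2) by simp
    qed
    fix Y f assume Y: "Y \<in> Obj C" and f: "f \<in> Hom C X Y"
    show "linear_on s s (fobj ?F Y) (fmap ?F X Y f)"
    proof (rule linear_onI)
      fix x assume "x \<in> fobj ?F Y"
      then obtain x' where x': "x' \<in> fobj F Y" "x = e Y x'" by auto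
      note eY = conjunct1[OF e[OF Y]] and eX = conjunct1[OF e[OF X]] and fm = fmap_linear_on[OF F X Y f]
        and sub = fobj_subspace[OF t F Y]
      show "fmap ?F X Y f (s c x) = s c (fmap ?F X Y f x)" for c
        using nat[OF Y subspace_scaleD[OF t sub x'(1)], of X f c] nat[OF Y x'(1), of X f] x'(2)
          linear_on_scale[OF eY x'(1), of c] linear_on_scale[OF fm x'(1), of c]
          linear_on_scale[OF eX fmap_in[OF F X Y f x'(1)], of c] by simp
      fix y assume "y \<in> fobj ?F Y"
      then obtain y' where y': "y' \<in> fobj F Y" "y = e Y y'" by auto
      show "fmap ?F X Y f (x + y) = fmap ?F X Y f x + fmap ?F X Y f y"
        using nat[OF Y subspace_addD[OF t sub x'(1) y'(1)], of X f] nat[OF Y x'(1), of X f] nat[OF Y y'(1), of X f] x'(2) y'(2)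
          linear_on_add[OF eY x'(1) y'(1)] linear_on_add[OF fm x'(1) y'(1)]
          linear_on_add[OF eX fmap_in[OF F X Y f x'(1)] fmap_in[OF F X Y f y'(1)]] by simp
    qed
    fix y assume "y \<in> fobj ?F Y"
    then obtain y' where y': "y' \<in> fobj F Y" "y = e Y y'" by auto
    note ny = nat[OF Y y'(1), of X]
    show "fmap ?F X Y f y \<in> fobj ?F X" using ny[of f] fmap_in[OF F X Y f y'(1)] y'(2) by simp
    show "fmap ?F X Y (f + f') y = fmap ?F X Y f y + fmap ?F X Y f' y" if f': "f' \<in> Hom C X Y" for f'
      using ny[of f] ny[of f'] ny[of "f + f'"] fmap_add_Hom[OF F X Y f f', of y'] y'(2)
        linear_on_add[OF conjunct1[OF e[OF X]] fmap_in[OF F X Y f y'(1)] fmap_in[OF F X Y f' y'(1)]] by simp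
    show "fmap ?F X Y (Scal C c f) y = s c (fmap ?F X Y f y)" for c
      using ny[of f] ny[of "Scal C c f"] fmap_scale_Hom[OF F X Y f, of c y'] y'(2)
        linear_on_scale[OF conjunct1[OF e[OF X]] fmap_in[OF F X Y f y'(1)]] by simp
  next
    fix X Y Z f g z
    assume X: "X \<in> Obj C" and Y: "Y \<in> Obj C" and Z: "Z \<in> Obj C" and f: "f \<in> Hom C X Y" and g: "g \<in> Hom C Y Z"
      and "z \<in> fobj ?F Z"
    then obtain z' where z': "z' \<in> fobj F Z" "z = e Z z'" by auto
    show "fmap ?F X Z (Comp C g f) z = fmap ?F X Y f (fmap ?F Y Z g z)"
      using nat[OF Z z'(1), of X "Comp C g f"] nat[OF Z z'(1), of Y g] nat[OF Y fmap_in[OF F Y Z g z'(1)], of X f]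
        fmap_Comp[OF F X Y f Z g, of z'] z'(2) by simp
  qed auto
  moreover have "bij_betw (e X) (fobj F X) (fobj ?F X)" if "X \<in> Obj C" for X
    using e[OF that] by (simp add: bij_betw_def)
  ultimately show ?thesis using that[of ?F e] e nat by blast
qed

lemma representable_exists:
  assumes Y: "Y \<in> Obj C"
  obtains P u where "represents P Y u"
proof -
  let ?H = "\<lparr> fobj = \<lambda>X. Hom C X Y, fmap = \<lambda>X X' f g. if g \<in> Hom C X' Y then Comp C g f else 0 \<rparr>
    :: ('o, 'm, 'm) cofunctor"
  have H: "?H \<in> mod_op C (Scal C)"
  proof (rule mod_opI[OF vs_Hom])
    fix X X' f assume X: "X \<in> Obj C" "X' \<in> Obj C" "f \<in> Hom C X X'"
    show "linear_on (Scal C) (Scal C) (fobj ?H X') (fmap ?H X X' f)"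
      using X Y Comp_add_left Comp_scale_left subspace_addD[OF vs_Hom subspace_Hom] subspace_scaleD[OF vs_Hom subspace_Hom]
      by (intro linear_onI) auto
  qed (use Y Comp_assoc Comp_Hom Comp_Id Comp_add_right Comp_scale_right fin_dim_Hom in auto)
  obtain P e where P: "P \<in> mod_op C s" "\<And>X. X \<in> Obj C \<Longrightarrow> linear_on (Scal C) s (fobj ?H X) (e X)"
    "\<And>X. X \<in> Obj C \<Longrightarrow> bij_betw (e X) (fobj ?H X) (fobj P X)"
    "\<And>X X' f y. X \<in> Obj C \<Longrightarrow> X' \<in> Obj C \<Longrightarrow> f \<in> Hom C X X' \<Longrightarrow> y \<in> fobj ?H X' \<Longrightarrow>
      fmap P X X' f (e X' y) = e X (fmap ?H X X' f y)"
    by (rule transport[OF vs_Hom H]) blast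
  let ?u = "e Y (Id C Y)"
  have u: "fmap P X Y f ?u = e X f" if "X \<in> Obj C" "f \<in> Hom C X Y" for X f
    using P(4)[OF that(1) Y that(2), of "Id C Y"] Id_Hom[OF Y] Id_Comp[OF that(1) Y that(2)] by simp
  have "represents P Y ?u"
    unfolding represents_def
  proof (intro conjI ballI impI)
    show "?u \<in> fobj P Y" using P(3)[OF Y] Id_Hom[OF Y] bij_betwE by fastforce
    fix X assume X: "X \<in> Obj C"
    show "\<exists>f\<in>Hom C X Y. x = fmap P X Y f ?u" if "x \<in> fobj P X" for x
      using P(3)[OF X] that u[OF X] unfolding bij_betw_def by force
    show "f = 0" if f: "f \<in> Hom C X Y" "fmap P X Y f ?u = 0" for f
    proof -
      have "inj_on (e X) (Hom C X Y)" using P(3)[OF X] unfolding bij_betw_def by simp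
      moreover have "linear_on (Scal C) s (Hom C X Y) (e X)" using P(2)[OF X] by simp
      ultimately show ?thesis
        using linear_on_inj_iff[OF vs_Hom subspace_Hom[OF X Y]] f u[OF X f(1)] by auto
    qed
  qed (use P(1) Y in auto)
  then show ?thesis using that by blast
qed

end

section \<open>Functors with short resolutions\<close>

lemma vector_space_functional: "vector_space (\<lambda>(c::'k::field) (\<xi> :: 'm \<Rightarrow> 'k) x. c * \<xi> x)"
  by unfold_locales (auto simp: algebra_simps)

context fd_category
begin

text \<open>The dual of \<open>Hom(Y, -)\<close>, with evaluation at the identity as the universal functional.\<close>

lemma corepresentable_exists:
  assumes Y: "Y \<in> Obj C"
  obtains J u where "corepresents J Y u"
proof -
  define t :: "'k \<Rightarrow> ('m \<Rightarrow> 'k) \<Rightarrow> 'm \<Rightarrow> 'k" where "t = (\<lambda>c \<xi> x. c * \<xi> x)"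
  have vt: "vector_space t" unfolding t_def by (rule vector_space_functional)
  interpret T: vector_space t by fact
  let ?D = "\<lparr> fobj = \<lambda>X. {\<xi>. functional_on (Scal C) (Hom C Y X) \<xi> \<and> (\<forall>f. f \<notin> Hom C Y X \<longrightarrow> \<xi> f = 0)},
    fmap = \<lambda>X X' h \<xi>. if functional_on (Scal C) (Hom C Y X') \<xi> \<and> (\<forall>f. f \<notin> Hom C Y X' \<longrightarrow> \<xi> f = 0)
      then (\<lambda>f. if f \<in> Hom C Y X then \<xi> (Comp C h f) else 0) else 0 \<rparr> :: ('o, 'm, 'm \<Rightarrow> 'k) cofunctor"
  note subH = subspace_addD[OF vs_Hom subspace_Hom] subspace_scaleD[OF vs_Hom subspace_Hom]
  have memD: "\<xi> \<in> fobj ?D X \<longleftrightarrow> functional_on (Scal C) (Hom C Y X) \<xi> \<and> (\<forall>f. f \<notin> Hom C Y X \<longrightarrow> \<xi> f = 0)" for \<xi> X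
    by simp
  have mapD: "fmap ?D X X' h \<xi> = (\<lambda>f. if f \<in> Hom C Y X then \<xi> (Comp C h f) else 0)" if "\<xi> \<in> fobj ?D X'" for X X' h \<xi>
    using that by simp
  have subD: "T.subspace (fobj ?D X)" if "X \<in> Obj C" for X
    by (rule T.subspaceI) (auto simp: t_def linear_on_def algebra_simps)
  have D: "?D \<in> mod_op C t"
  proof (rule mod_opI[OF vt])
    fix X assume X: "X \<in> Obj C"
    obtain B where B: "finite B" "Hom C Y X = module.span (Scal C) B"
      using fin_dim_Hom[OF Y X] unfolding fin_dim_def by blast
    show "fin_dim t (fobj ?D X)"
    proof (rule fin_dim_if_separated[OF vt subD[OF X]])
      show "finite ((\<lambda>b \<xi>. \<xi> b) ` B)" using B by simp
      show "functional_on t (fobj ?D X) \<zeta>" if "\<zeta> \<in> (\<lambda>b \<xi>. \<xi> b) ` B" for \<zeta>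
        using that by (auto simp: linear_on_def t_def)
      show "\<xi> = 0" if \<xi>: "\<xi> \<in> fobj ?D X" "\<forall>\<zeta>\<in>(\<lambda>b \<xi>. \<xi> b) ` B. \<zeta> \<xi> = 0" for \<xi>
      proof -
        interpret H: vector_space "Scal C" by (rule vs_Hom)
        have lin: "functional_on (Scal C) (Hom C Y X) \<xi>" and out: "\<And>f. f \<notin> Hom C Y X \<Longrightarrow> \<xi> f = 0"
          using \<xi>(1) by auto
        have "H.subspace {f \<in> Hom C Y X. \<xi> f = 0}"
          by (rule subspace_kernel[OF vs_Hom subspace_Hom[OF Y X] lin vector_space_field])
        moreover have "B \<subseteq> {f \<in> Hom C Y X. \<xi> f = 0}" using \<xi>(2) B(2) H.span_superset by auto
        ultimately have "H.span B \<subseteq> {f \<in> Hom C Y X. \<xi> f = 0}" by (rule H.span_minimal[rotated])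
        then show "\<xi> = 0" using out B(2) by fastforce
      qed
    qed
    show "fmap ?D X X (Id C X) \<xi> = \<xi>" if "\<xi> \<in> fobj ?D X" for \<xi>
      using mapD[OF that, of X] that Id_Comp[OF Y X] by (auto simp: fun_eq_iff)
    fix X' h assume X': "X' \<in> Obj C" and h: "h \<in> Hom C X X'"
    note hC = Comp_Hom[OF Y X X' _ h]
    show "linear_on t t (fobj ?D X') (fmap ?D X X' h)"
    proof (rule linear_onI)
      fix \<xi> assume \<xi>: "\<xi> \<in> fobj ?D X'"
      show "fmap ?D X X' h (t c \<xi>) = t c (fmap ?D X X' h \<xi>)" for c
        unfolding mapD[OF \<xi>] mapD[OF subspace_scaleD[OF vt subD[OF X'] \<xi>]] by (auto simp: t_def)
      fix \<zeta> assume \<zeta>: "\<zeta> \<in> fobj ?D X'"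
      show "fmap ?D X X' h (\<xi> + \<zeta>) = fmap ?D X X' h \<xi> + fmap ?D X X' h \<zeta>"
        unfolding mapD[OF \<xi>] mapD[OF \<zeta>] mapD[OF subspace_addD[OF vt subD[OF X'] \<xi> \<zeta>]] by auto
    qed
    fix \<xi> assume \<xi>: "\<xi> \<in> fobj ?D X'"
    then have lin: "functional_on (Scal C) (Hom C Y X') \<xi>" by simp
    show "fmap ?D X X' h \<xi> \<in> fobj ?D X"
      unfolding mapD[OF \<xi>] memD using hC lin subH[OF Y X] Comp_add_right[OF Y X X' _ _ h] Comp_scale_right[OF Y X X' _ h]
      by (auto simp: linear_on_def)
    show "fmap ?D X X' (h + h') \<xi> = fmap ?D X X' h \<xi> + fmap ?D X X' h' \<xi>" if h': "h' \<in> Hom C X X'" for h'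
      unfolding mapD[OF \<xi>] using hC Comp_Hom[OF Y X X' _ h'] lin Comp_add_left[OF Y X X' _ h h']
      by (auto simp: linear_on_def)
    show "fmap ?D X X' (Scal C c h) \<xi> = t c (fmap ?D X X' h \<xi>)" for c
      unfolding mapD[OF \<xi>] using hC lin Comp_scale_left[OF Y X X' _ h]
      by (auto simp: linear_on_def t_def)
  next
    fix X X' X'' h h' \<zeta>
    assume X: "X \<in> Obj C" and X': "X' \<in> Obj C" and X'': "X'' \<in> Obj C"
      and h: "h \<in> Hom C X X'" and h': "h' \<in> Hom C X' X''" and \<zeta>: "\<zeta> \<in> fobj ?D X''"
    note hC = Comp_Hom[OF Y X X' _ h]
    have z: "(\<lambda>f. if f \<in> Hom C Y X' then \<zeta> (Comp C h' f) else 0) \<in> fobj ?D X'"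
      using \<zeta> Comp_Hom[OF Y X' X'' _ h'] subH[OF Y X'] Comp_add_right[OF Y X' X'' _ _ h'] Comp_scale_right[OF Y X' X'' _ h']
      by (auto simp: linear_on_def)
    show "fmap ?D X X'' (Comp C h' h) \<zeta> = fmap ?D X X' h (fmap ?D X' X'' h' \<zeta>)"
      unfolding mapD[OF \<zeta>] mapD[OF z] using hC by (auto simp: Comp_assoc)
  qed (auto)
  obtain J e where J: "J \<in> mod_op C s" "\<And>X. X \<in> Obj C \<Longrightarrow> linear_on t s (fobj ?D X) (e X)"
    "\<And>X. X \<in> Obj C \<Longrightarrow> bij_betw (e X) (fobj ?D X) (fobj J X)"
    "\<And>X X' f y. X \<in> Obj C \<Longrightarrow> X' \<in> Obj C \<Longrightarrow> f \<in> Hom C X X' \<Longrightarrow> y \<in> fobj ?D X' \<Longrightarrow>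
      fmap J X X' f (e X' y) = e X (fmap ?D X X' f y)"
    by (rule transport[OF vt D]) blast
  define i where "i X = the_inv_into (fobj ?D X) (e X)" for X
  have i: "i X (e X \<xi>) = \<xi>" if "X \<in> Obj C" "\<xi> \<in> fobj ?D X" for X \<xi>
    using the_inv_into_f_f[OF bij_betw_imp_inj_on[OF J(3)[OF that(1)]] that(2)] unfolding i_def .
  define u where "u x = i Y x (Id C Y)" for x
  have onto: "\<exists>\<xi>\<in>fobj ?D X. x = e X \<xi>" if "X \<in> Obj C" "x \<in> fobj J X" for X x
  proof -
    have "x \<in> e X ` fobj ?D X" unfolding bij_betw_imp_surj_on[OF J(3)[OF that(1)]] by (rule that(2))
    then show ?thesis by (rule imageE) (rule bexI)
  qed
  have u: "u (fmap J Y X f (e X \<xi>)) = \<xi> f" if "X \<in> Obj C" "f \<in> Hom C Y X" "\<xi> \<in> fobj ?D X" for X f \<xi>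
    using J(4)[OF Y that] i[OF Y fmap_in[OF D Y that]] Comp_Id[OF Y that(1,2)] Id_Hom[OF Y] mapD[OF that(3), of Y f]
    unfolding u_def by simp
  have "corepresents J Y u"
    unfolding corepresents_def
  proof (intro conjI ballI impI)
    show "functional_on s (fobj J Y) u"
    proof (rule linear_onI)
      fix x assume "x \<in> fobj J Y"
      then obtain \<xi> where \<xi>: "\<xi> \<in> fobj ?D Y" "x = e Y \<xi>" using onto[OF Y] by blast
      have "s c x = e Y (t c \<xi>)" for c
        using linear_on_scale[OF J(2)[OF Y] \<xi>(1), of c] \<xi>(2) by simp
      then show "u (s c x) = c * u x" for c
        using i[OF Y \<xi>(1)] i[OF Y subspace_scaleD[OF vt subD[OF Y] \<xi>(1)], of c] \<xi>(2) by (simp add: u_def t_def)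
      fix y assume "y \<in> fobj J Y"
      then obtain \<zeta> where \<zeta>: "\<zeta> \<in> fobj ?D Y" "y = e Y \<zeta>" using onto[OF Y] by blast
      have "x + y = e Y (\<xi> + \<zeta>)" using linear_on_add[OF J(2)[OF Y] \<xi>(1) \<zeta>(1)] \<xi>(2) \<zeta>(2) by simp
      then show "u (x + y) = u x + u y"
        using i[OF Y \<xi>(1)] i[OF Y \<zeta>(1)] i[OF Y subspace_addD[OF vt subD[OF Y] \<xi>(1) \<zeta>(1)]] \<xi>(2) \<zeta>(2) by (simp add: u_def)
    qed
    fix X assume X: "X \<in> Obj C"
    show "x = 0" if x: "x \<in> fobj J X" "\<forall>f\<in>Hom C Y X. u (fmap J Y X f x) = 0" for x
    proof -
      obtain \<xi> where \<xi>: "\<xi> \<in> fobj ?D X" "x = e X \<xi>" using onto[OF X x(1)] by blast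
      have "\<xi> f = 0" for f using x(2) u[OF X _ \<xi>(1), of f] \<xi> by (cases "f \<in> Hom C Y X") auto
      then have "\<xi> = 0" by (simp add: fun_eq_iff)
      then show ?thesis using linear_on_zero[OF J(2)[OF X] subspace_zeroD[OF vt subD[OF X]]] \<xi>(2) by simp
    qed
    show "f = 0" if f: "f \<in> Hom C Y X" "\<forall>x\<in>fobj J X. u (fmap J Y X f x) = 0" for f
    proof (rule ccontr)
      assume "f \<noteq> 0"
      then obtain \<zeta> where \<zeta>: "functional_on (Scal C) UNIV \<zeta>" "\<zeta> f = 1" using functional_nonzero_at[OF vs_Hom] by blast
      let ?\<xi> = "\<lambda>g. if g \<in> Hom C Y X then \<zeta> g else 0"
      have \<xi>: "?\<xi> \<in> fobj ?D X" using \<zeta>(1) subH[OF Y X] by (auto simp: linear_on_def)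
      have "e X ?\<xi> \<in> fobj J X" using bij_betwE[OF J(3)[OF X]] \<xi> by blast
      then have "u (fmap J Y X f (e X ?\<xi>)) = 0" using f(2) by blast
      then have "?\<xi> f = 0" using u[OF X f(1) \<xi>] by metis
      then show False using f(1) \<zeta>(2) by simp
    qed
  qed (use J(1) Y in auto)
  then show ?thesis using that by blast
qed

definition zero_cofunctor :: "('o, 'm, 'w) cofunctor" where
  "zero_cofunctor = \<lparr> fobj = \<lambda>X. {0}, fmap = \<lambda>X Y f x. 0 \<rparr>"

lemma zero_cofunctor_simps [simp]:
  "fobj zero_cofunctor X = {0}" "fmap zero_cofunctor X Y f x = 0"
  by (simp_all add: zero_cofunctor_def)

lemma zero_cofunctor_mod_op: "zero_cofunctor \<in> mod_op C s"
proof (rule mod_opI[OF vs])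
  interpret vector_space s by (rule vs)
  have "{0} = span {}" by simp
  then show "fin_dim s (fobj zero_cofunctor X)" for X unfolding fin_dim_def by auto
  show "linear_on s s (fobj zero_cofunctor Y) (fmap zero_cofunctor X Y f)" for X Y f
    by (simp add: linear_on_def)
qed (use module.scale_zero_right[OF module_if_vector_space[OF vs]] in auto)

lemma zero_nat_trans: "F \<in> mod_op C s \<Longrightarrow> G \<in> mod_op C s \<Longrightarrow> 0 \<in> nat_trans C s F G"
  by (rule nat_transI[OF vs])
    (use subspace_zeroD[OF vs fobj_subspace[OF vs]] lin_zero[OF vs fmap_lin]
      module.scale_zero_right[OF module_if_vector_space[OF vs]] in \<open>auto simp: linear_on_def\<close>)

lemma zero_cofunctor_projective: "projective_functor C s zero_cofunctor"
  unfolding projective_functor_def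
proof (intro conjI ballI impI)
  fix F G \<pi> \<eta> assume F: "F \<in> mod_op C s" and "G \<in> mod_op C s" and \<pi>: "\<pi> \<in> nat_trans C s F G"
    and \<eta>: "\<eta> \<in> nat_trans C s zero_cofunctor G"
  note z = zero_nat_trans[OF zero_cofunctor_mod_op F]
  have "\<pi> \<circ>\<circ> 0 = \<eta>"
    by (rule nat_trans_eqI[OF \<eta> z \<pi>]) (use lin_zero[OF vs nat_trans_lin[OF \<pi>]] lin_zero[OF vs nat_trans_lin[OF \<eta>]] in simp)
  then show "\<exists>\<theta>\<in>nat_trans C s zero_cofunctor F. \<pi> \<circ>\<circ> \<theta> = \<eta>" using z by blast
qed (rule zero_cofunctor_mod_op)

lemma zero_cofunctor_injective: "injective_functor C s zero_cofunctor"
  unfolding injective_functor_def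
proof (intro conjI ballI impI)
  fix F G \<mu> \<eta> assume "F \<in> mod_op C s" and G: "G \<in> mod_op C s" and \<mu>: "\<mu> \<in> nat_trans C s F G"
    and \<eta>: "\<eta> \<in> nat_trans C s F zero_cofunctor"
  note z = zero_nat_trans[OF G zero_cofunctor_mod_op]
  have "0 \<circ>\<circ> \<mu> = \<eta>"
    by (rule nat_trans_eqI[OF \<eta> \<mu> z]) (use nat_trans_in[OF \<eta>] in simp)
  then show "\<exists>\<theta>\<in>nat_trans C s G zero_cofunctor. \<theta> \<circ>\<circ> \<mu> = \<eta>" using z by blast
qed (rule zero_cofunctor_mod_op)

text \<open>Exactness of \<open>0 \<rightarrow> Hom(-, Y1) \<rightarrow> Hom(-, Y0) \<rightarrow> F \<rightarrow> 0\<close>, where the maps are composition with \<open>m\<close> and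
  \<open>f \<mapsto> F f z\<close>.\<close>

definition presents :: "('o, 'm, 'w) cofunctor \<Rightarrow> 'o \<Rightarrow> 'o \<Rightarrow> 'm \<Rightarrow> 'w \<Rightarrow> bool" where
  "presents F Y0 Y1 m z \<longleftrightarrow> Y0 \<in> Obj C \<and> Y1 \<in> Obj C \<and> m \<in> Hom C Y1 Y0 \<and> z \<in> fobj F Y0 \<and>
     (\<forall>X\<in>Obj C. \<forall>x\<in>fobj F X. \<exists>f\<in>Hom C X Y0. x = fmap F X Y0 f z) \<and>
     fmap F Y1 Y0 m z = 0 \<and>
     (\<forall>X\<in>Obj C. \<forall>f\<in>Hom C X Y0. fmap F X Y0 f z = 0 \<longrightarrow> (\<exists>g\<in>Hom C X Y1. f = Comp C m g)) \<and>
     (\<forall>X\<in>Obj C. \<forall>g\<in>Hom C X Y1. Comp C m g = 0 \<longrightarrow> g = 0)"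

lemma proj_dim_le_1:
  assumes F: "F \<in> mod_op C s" and pr: "presents F Y0 Y1 m z"
  shows "proj_dim C s F \<le> 1"
proof -
  have Y0: "Y0 \<in> Obj C" and Y1: "Y1 \<in> Obj C" and m: "m \<in> Hom C Y1 Y0" and z: "z \<in> fobj F Y0"
    and sur: "\<And>X x. X \<in> Obj C \<Longrightarrow> x \<in> fobj F X \<Longrightarrow> \<exists>f\<in>Hom C X Y0. x = fmap F X Y0 f z"
    and mz: "fmap F Y1 Y0 m z = 0"
    and ex: "\<And>X f. X \<in> Obj C \<Longrightarrow> f \<in> Hom C X Y0 \<Longrightarrow> fmap F X Y0 f z = 0 \<Longrightarrow> \<exists>g\<in>Hom C X Y1. f = Comp C m g"
    and inj: "\<And>X g. X \<in> Obj C \<Longrightarrow> g \<in> Hom C X Y1 \<Longrightarrow> Comp C m g = 0 \<Longrightarrow> g = 0"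
    using pr unfolding presents_def by blast+
  obtain P0 u0 where P0: "represents P0 Y0 u0" using representable_exists[OF Y0] .
  obtain P1 u1 where P1: "represents P1 Y1 u1" using representable_exists[OF Y1] .
  have P0m: "P0 \<in> mod_op C s" and u0: "u0 \<in> fobj P0 Y0" and P1m: "P1 \<in> mod_op C s" and u1: "u1 \<in> fobj P1 Y1"
    using P0 P1 unfolding represents_def by blast+
  have P0ex: "\<exists>f\<in>Hom C X Y0. x = fmap P0 X Y0 f u0" if "X \<in> Obj C" "x \<in> fobj P0 X" for X x
    using P0 that unfolding represents_def by blast
  have P1ex: "\<exists>f\<in>Hom C X Y1. x = fmap P1 X Y1 f u1" if "X \<in> Obj C" "x \<in> fobj P1 X" for X x
    using P1 that unfolding represents_def by blast
  obtain d0 where d0: "d0 \<in> nat_trans C s P0 F"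
    "\<And>X f. X \<in> Obj C \<Longrightarrow> f \<in> Hom C X Y0 \<Longrightarrow> d0 X (fmap P0 X Y0 f u0) = fmap F X Y0 f z"
    using yoneda[OF P0 F z] by blast
  obtain d1 where d1: "d1 \<in> nat_trans C s P1 P0"
    "\<And>X f. X \<in> Obj C \<Longrightarrow> f \<in> Hom C X Y1 \<Longrightarrow> d1 X (fmap P1 X Y1 f u1) = fmap P0 X Y1 f (fmap P0 Y1 Y0 m u0)"
    using yoneda[OF P1 P0m fmap_in[OF P0m Y1 Y0 m u0]] by blast
  have d1': "d1 X (fmap P1 X Y1 f u1) = fmap P0 X Y0 (Comp C m f) u0" if "X \<in> Obj C" "f \<in> Hom C X Y1" for X f
    using d1(2)[OF that] fmap_Comp[OF P0m that(1) Y1 that(2) Y0 m] by simp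
  define P where "P n = (if n = 0 then P0 else if n = 1 then P1 else zero_cofunctor)" for n :: nat
  define d where "d n = (if n = 0 then d0 else if n = 1 then d1 else 0)" for n :: nat
  have zero: "0 \<in> fobj P1 X" if "X \<in> Obj C" for X using subspace_zeroD[OF vs fobj_subspace[OF vs P1m that]] .
  have "projective_resolution C s F 1 P d"
    unfolding projective_resolution_def
  proof (intro conjI allI impI)
    show "projective_functor C s (P i)" for i
      unfolding P_def using represents_projective[OF P0] represents_projective[OF P1] zero_cofunctor_projective by simp
    show "d 0 \<in> nat_trans C s (P 0) F" by (simp add: d_def P_def d0)
    show "nt_epi C (P 0) F (d 0)"
      unfolding nt_epi_def
    proof (intro ballI set_eqI iffI)
      fix X x assume X: "X \<in> Obj C"
      show "x \<in> fobj F X" if "x \<in> d 0 X ` fobj (P 0) X"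
        using that nat_trans_in[OF d0(1) X] by (auto simp: d_def P_def)
      assume "x \<in> fobj F X"
      then obtain f where f: "f \<in> Hom C X Y0" "x = fmap F X Y0 f z" using sur[OF X] by blast
      then show "x \<in> d 0 X ` fobj (P 0) X"
        using d0(2)[OF X f(1)] fmap_in[OF P0m X Y0 f(1) u0] by (auto simp: d_def P_def intro!: rev_image_eqI)
    qed
    fix i
    show "d (Suc i) \<in> nat_trans C s (P (Suc i)) (P i)"
      using d1(1) zero_nat_trans[OF zero_cofunctor_mod_op P1m] zero_nat_trans[OF zero_cofunctor_mod_op zero_cofunctor_mod_op]
      by (auto simp: d_def P_def)
    consider "i = 0" | "i = 1" | "i > 1" by linarith
    then show "nt_exact C (P (Suc i)) (P i) (d (Suc i)) (d i)"
    proof cases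
      case 1
      have "d1 X ` fobj P1 X = {x \<in> fobj P0 X. d0 X x = 0}" if X: "X \<in> Obj C" for X
      proof (intro set_eqI iffI)
        fix x assume "x \<in> d1 X ` fobj P1 X"
        then obtain f where f: "f \<in> Hom C X Y1" "x = fmap P0 X Y0 (Comp C m f) u0"
          using P1ex[OF X] d1'[OF X] by force
        have mf: "Comp C m f \<in> Hom C X Y0" using Comp_Hom[OF X Y1 Y0 f(1) m] .
        have "d0 X x = fmap F X Y1 f (fmap F Y1 Y0 m z)"
          using d0(2)[OF X mf] fmap_Comp[OF F X Y1 f(1) Y0 m] f(2) by simp
        then show "x \<in> {x \<in> fobj P0 X. d0 X x = 0}"
          using fmap_in[OF P0m X Y0 mf u0] f(2) mz lin_zero[OF vs fmap_lin[OF F X Y1 f(1)]] by simp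
      next
        fix x assume x: "x \<in> {x \<in> fobj P0 X. d0 X x = 0}"
        then obtain f where f: "f \<in> Hom C X Y0" "x = fmap P0 X Y0 f u0" using P0ex[OF X] by blast
        then obtain g where g: "g \<in> Hom C X Y1" "f = Comp C m g" using ex[OF X f(1)] d0(2)[OF X f(1)] x by auto
        then show "x \<in> d1 X ` fobj P1 X"
          using d1'[OF X g(1)] f fmap_in[OF P1m X Y1 g(1) u1] by (auto intro!: rev_image_eqI)
      qed
      then show ?thesis using 1 by (simp add: nt_exact_def d_def P_def)
    next
      case 2
      have "x = 0" if X: "X \<in> Obj C" and x: "x \<in> fobj P1 X" "d1 X x = 0" for X x
      proof -
        obtain f where f: "f \<in> Hom C X Y1" "x = fmap P1 X Y1 f u1" using P1ex[OF X x(1)] by blast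
        have "Comp C m f = 0"
          using P0 d1'[OF X f(1)] Comp_Hom[OF X Y1 Y0 f(1) m] x(2) f(2) X unfolding represents_def by simp
        then have "f = 0" using inj[OF X f(1)] by blast
        then show ?thesis
          using f linear_on_zero[OF fmap_functional_Hom[OF P1m X Y1 u1] subspace_zeroD[OF vs_Hom subspace_Hom[OF X Y1]]]
          by simp
      qed
      then show ?thesis using 2 zero lin_zero[OF vs nat_trans_lin[OF d1(1)]] by (auto simp: nt_exact_def d_def P_def)
    next
      case 3
      then show ?thesis by (auto simp: nt_exact_def d_def P_def)
    qed
  qed (auto simp: P_def zero_functor_def)
  then have "proj_dim C s F \<le> enat 1" unfolding proj_dim_def by (intro Inf_lower) blast
  then show ?thesis by (simp add: one_enat_def)
qed

text \<open>Exactness of \<open>0 \<rightarrow> F \<rightarrow> D Hom(Y0, -) \<rightarrow> D Hom(Y1, -) \<rightarrow> 0\<close>, where the maps are \<open>x \<mapsto> (f \<mapsto> z (F f x))\<close> and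
  restriction along composition with \<open>m\<close>.  Exactness in the middle is expressed by annihilators in
  \<open>Hom(Y0, X)\<close>, and surjectivity of the last map by its transpose.\<close>

definition copresents :: "('o, 'm, 'w) cofunctor \<Rightarrow> 'o \<Rightarrow> 'o \<Rightarrow> 'm \<Rightarrow> ('w \<Rightarrow> 'k) \<Rightarrow> bool" where
  "copresents F Y0 Y1 m z \<longleftrightarrow> Y0 \<in> Obj C \<and> Y1 \<in> Obj C \<and> m \<in> Hom C Y0 Y1 \<and> functional_on s (fobj F Y0) z \<and>
     (\<forall>X\<in>Obj C. \<forall>x\<in>fobj F X. (\<forall>f\<in>Hom C Y0 X. z (fmap F Y0 X f x) = 0) \<longrightarrow> x = 0) \<and>
     (\<forall>x\<in>fobj F Y1. z (fmap F Y0 Y1 m x) = 0) \<and>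
     (\<forall>X\<in>Obj C. \<forall>f\<in>Hom C Y0 X. (\<forall>x\<in>fobj F X. z (fmap F Y0 X f x) = 0) \<longrightarrow> (\<exists>g\<in>Hom C Y1 X. f = Comp C g m)) \<and>
     (\<forall>X\<in>Obj C. \<forall>g\<in>Hom C Y1 X. Comp C g m = 0 \<longrightarrow> g = 0)"

text \<open>The last two conditions of \<open>copresents\<close> are statements about \<open>Hom(Y0, -)\<close> and \<open>Hom(Y1, -)\<close>; the
  elements whose existence exactness demands are obtained from them by \<open>double_annihilator\<close>.\<close>

lemma inj_dim_le_1:
  assumes F: "F \<in> mod_op C s" and pr: "copresents F Y0 Y1 m z"
  shows "inj_dim C s F \<le> 1"
proof -
  have Y0: "Y0 \<in> Obj C" and Y1: "Y1 \<in> Obj C" and m: "m \<in> Hom C Y0 Y1" and z: "functional_on s (fobj F Y0) z"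
    and sep: "\<And>X x. X \<in> Obj C \<Longrightarrow> x \<in> fobj F X \<Longrightarrow> (\<And>f. f \<in> Hom C Y0 X \<Longrightarrow> z (fmap F Y0 X f x) = 0) \<Longrightarrow> x = 0"
    and mz: "\<And>x. x \<in> fobj F Y1 \<Longrightarrow> z (fmap F Y0 Y1 m x) = 0"
    and ex: "\<And>X f. X \<in> Obj C \<Longrightarrow> f \<in> Hom C Y0 X \<Longrightarrow> (\<forall>x\<in>fobj F X. z (fmap F Y0 X f x) = 0) \<Longrightarrow> \<exists>g\<in>Hom C Y1 X. f = Comp C g m"
    and inj: "\<And>X g. X \<in> Obj C \<Longrightarrow> g \<in> Hom C Y1 X \<Longrightarrow> Comp C g m = 0 \<Longrightarrow> g = 0"
    using pr unfolding copresents_def by blast+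
  obtain J0 u0 where J0: "corepresents J0 Y0 u0" using corepresentable_exists[OF Y0] .
  obtain J1 u1 where J1: "corepresents J1 Y1 u1" using corepresentable_exists[OF Y1] .
  have J0m: "J0 \<in> mod_op C s" and u0: "functional_on s (fobj J0 Y0) u0"
    and J1m: "J1 \<in> mod_op C s" and u1: "functional_on s (fobj J1 Y1) u1"
    using J0 J1 unfolding corepresents_def by blast+
  obtain d0 where d0: "d0 \<in> nat_trans C s F J0"
    "\<And>X f x. X \<in> Obj C \<Longrightarrow> f \<in> Hom C Y0 X \<Longrightarrow> x \<in> fobj F X \<Longrightarrow> u0 (fmap J0 Y0 X f (d0 X x)) = z (fmap F Y0 X f x)"
    using coyoneda[OF J0 F z] by blast
  have um: "functional_on s (fobj J0 Y1) (\<lambda>y. u0 (fmap J0 Y0 Y1 m y))" by (rule pairing_functional_fobj[OF J0m Y1 Y0 u0 m])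
  obtain d1 where d1: "d1 \<in> nat_trans C s J0 J1"
    "\<And>X f x. X \<in> Obj C \<Longrightarrow> f \<in> Hom C Y1 X \<Longrightarrow> x \<in> fobj J0 X \<Longrightarrow>
      u1 (fmap J1 Y1 X f (d1 X x)) = u0 (fmap J0 Y0 Y1 m (fmap J0 Y1 X f x))"
    using coyoneda[OF J1 J0m um] by blast
  have gm: "Comp C g m \<in> Hom C Y0 X" if "X \<in> Obj C" "g \<in> Hom C Y1 X" for X g
    using Comp_Hom[OF Y0 Y1 that(1) m that(2)] .
  have d1': "u1 (fmap J1 Y1 X g (d1 X x)) = u0 (fmap J0 Y0 X (Comp C g m) x)"
    if "X \<in> Obj C" "g \<in> Hom C Y1 X" "x \<in> fobj J0 X" for X g x
    using d1(2)[OF that] fmap_Comp[OF J0m Y0 Y1 m that(1,2)] by simp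
  define J where "J n = (if n = 0 then J0 else if n = 1 then J1 else zero_cofunctor)" for n :: nat
  define d where "d n = (if n = 0 then d0 else if n = 1 then d1 else 0)" for n :: nat
  have exact0: "d0 X ` fobj F X = {x \<in> fobj J0 X. d1 X x = 0}" if X: "X \<in> Obj C" for X
  proof (intro set_eqI iffI)
    fix y assume "y \<in> d0 X ` fobj F X"
    then obtain x where x: "x \<in> fobj F X" "y = d0 X x" by blast
    note y = nat_trans_in[OF d0(1) X x(1)]
    have "d1 X y = 0"
    proof (rule corepresents_eqI[OF J1 X])
      fix g assume g: "g \<in> Hom C Y1 X"
      have "u1 (fmap J1 Y1 X g (d1 X y)) = z (fmap F Y0 Y1 m (fmap F Y1 X g x))"
        using d1'[OF X g y] d0(2)[OF X gm[OF X g] x(1)] fmap_Comp[OF F Y0 Y1 m X g, of x] x(2) by simp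
      then show "u1 (fmap J1 Y1 X g (d1 X y)) = u1 (fmap J1 Y1 X g 0)"
        using mz[OF fmap_in[OF F Y1 X g x(1)]] lin_zero[OF vs fmap_lin[OF J1m Y1 X g]]
          linear_on_zero[OF u1 subspace_zeroD[OF vs fobj_subspace[OF vs J1m Y1]]] by simp
    qed (use nat_trans_in[OF d1(1) X y] x(2) subspace_zeroD[OF vs fobj_subspace[OF vs J1m X]] in auto)
    then show "y \<in> {x \<in> fobj J0 X. d1 X x = 0}" using x y by simp
  next
    fix y assume y: "y \<in> {x \<in> fobj J0 X. d1 X x = 0}"
    then have y0: "y \<in> fobj J0 X" and y1: "d1 X y = 0" by auto
    have "\<exists>x\<in>fobj F X. \<forall>f\<in>Hom C Y0 X. u0 (fmap J0 Y0 X f y) = z (fmap F Y0 X f x)"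
    proof (rule double_annihilator[OF vs_Hom vs subspace_Hom[OF Y0 X] fobj_fin_dim[OF F X]])
      fix f assume f: "f \<in> Hom C Y0 X" "\<forall>x\<in>fobj F X. z (fmap F Y0 X f x) = 0"
      then obtain g where g: "g \<in> Hom C Y1 X" "f = Comp C g m" using ex[OF X] by blast
      show "u0 (fmap J0 Y0 X f y) = 0"
        using d1'[OF X g(1) y0] y1 g(2) lin_zero[OF vs fmap_lin[OF J1m Y1 X g(1)]]
          linear_on_zero[OF u1 subspace_zeroD[OF vs fobj_subspace[OF vs J1m Y1]]] by simp
    qed (use pairing_functional_Hom[OF F X Y0 z] pairing_functional_fobj[OF F X Y0 z]
        pairing_functional_Hom[OF J0m X Y0 u0 y0] in blast)+
    then obtain x where x: "x \<in> fobj F X" "\<And>f. f \<in> Hom C Y0 X \<Longrightarrow> u0 (fmap J0 Y0 X f y) = z (fmap F Y0 X f x)" by blast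
    have "d0 X x = y"
      by (rule corepresents_eqI[OF J0 X nat_trans_in[OF d0(1) X x(1)] y0]) (use d0(2)[OF X _ x(1)] x(2) in simp)
    then show "y \<in> d0 X ` fobj F X" using x(1) by blast
  qed
  have d1_epi: "d1 X ` fobj J0 X = fobj J1 X" if X: "X \<in> Obj C" for X
  proof
    show "d1 X ` fobj J0 X \<subseteq> fobj J1 X" using nat_trans_in[OF d1(1) X] by blast
    show "fobj J1 X \<subseteq> d1 X ` fobj J0 X"
    proof
      fix y assume y: "y \<in> fobj J1 X"
      note pJ1 = pairing_functional_Hom[OF J1m X Y1 u1 y]
      have "\<exists>x\<in>fobj J0 X. \<forall>g\<in>Hom C Y1 X. u1 (fmap J1 Y1 X g y) = u0 (fmap J0 Y0 X (Comp C g m) x)"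
      proof (rule double_annihilator[OF vs_Hom vs subspace_Hom[OF Y1 X] fobj_fin_dim[OF J0m X]])
        fix g assume g: "g \<in> Hom C Y1 X" "\<forall>x\<in>fobj J0 X. u0 (fmap J0 Y0 X (Comp C g m) x) = 0"
        have "Comp C g m = 0" using J0 X gm[OF X g(1)] g(2) unfolding corepresents_def by blast
        then have "g = 0" using inj[OF X g(1)] by blast
        then show "u1 (fmap J1 Y1 X g y) = 0"
          using linear_on_zero[OF pJ1 subspace_zeroD[OF vs_Hom subspace_Hom[OF Y1 X]]] by simp
      next
        show "functional_on s (fobj J0 X) (\<lambda>x. u0 (fmap J0 Y0 X (Comp C g m) x))" if "g \<in> Hom C Y1 X" for g
          by (rule pairing_functional_fobj[OF J0m X Y0 u0 gm[OF X that]])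
        show "functional_on (Scal C) (Hom C Y1 X) (\<lambda>g. u0 (fmap J0 Y0 X (Comp C g m) x))" if x: "x \<in> fobj J0 X" for x
          by (rule linear_on_compose[OF _ pairing_functional_Hom[OF J0m X Y0 u0 x]])
            (use gm[OF X] Comp_add_left[OF Y0 Y1 X m] Comp_scale_left[OF Y0 Y1 X m] in \<open>auto simp: linear_on_def\<close>)
      qed (rule pJ1)
      then obtain x where x: "x \<in> fobj J0 X"
        "\<And>g. g \<in> Hom C Y1 X \<Longrightarrow> u1 (fmap J1 Y1 X g y) = u0 (fmap J0 Y0 X (Comp C g m) x)" by blast
      have "d1 X x = y"
        by (rule corepresents_eqI[OF J1 X nat_trans_in[OF d1(1) X x(1)] y]) (use d1'[OF X _ x(1)] x(2) in simp)
      then show "y \<in> d1 X ` fobj J0 X" using x(1) by blast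
    qed
  qed
  have zero: "0 \<in> fobj J1 X" if "X \<in> Obj C" for X using subspace_zeroD[OF vs fobj_subspace[OF vs J1m that]] .
  have "injective_coresolution C s F 1 J d"
    unfolding injective_coresolution_def
  proof (intro conjI allI impI)
    show "injective_functor C s (J i)" for i
      unfolding J_def using corepresents_injective[OF J0] corepresents_injective[OF J1] zero_cofunctor_injective by simp
    show "d 0 \<in> nat_trans C s F (J 0)" by (simp add: d_def J_def d0)
    have "x = 0" if X: "X \<in> Obj C" and x: "x \<in> fobj F X" "d0 X x = 0" for X x
    proof (rule sep[OF X x(1)])
      show "z (fmap F Y0 X f x) = 0" if f: "f \<in> Hom C Y0 X" for f
        using d0(2)[OF X f x(1)] x(2) lin_zero[OF vs fmap_lin[OF J0m Y0 X f]]
          linear_on_zero[OF u0 subspace_zeroD[OF vs fobj_subspace[OF vs J0m Y0]]] by simp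
    qed
    then show "nt_mono C F (d 0)"
      using linear_on_inj_iff[OF vs fobj_subspace[OF vs F] nat_trans_linear_on[OF d0(1)]]
      unfolding nt_mono_def d_def by simp
    show "nt_exact C F (J 0) (d 0) (d 1)" using exact0 by (simp add: nt_exact_def d_def J_def)
    fix i
    show "d (Suc i) \<in> nat_trans C s (J i) (J (Suc i))"
      using d1(1) zero_nat_trans[OF J1m zero_cofunctor_mod_op] zero_nat_trans[OF zero_cofunctor_mod_op zero_cofunctor_mod_op]
      by (auto simp: d_def J_def)
    consider "i = 0" | "i > 0" by linarith
    then show "nt_exact C (J i) (J (Suc i)) (d (Suc i)) (d (Suc (Suc i)))"
    proof cases
      case 1
      then show ?thesis using d1_epi by (simp add: nt_exact_def d_def J_def)
    next
      case 2
      have "0 \<in> fobj (J i) X" if "X \<in> Obj C" for X using zero[OF that] 2 by (simp add: J_def)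
      then have "\<forall>X\<in>Obj C. (\<lambda>x. 0 :: 'w) ` fobj (J i) X = {0}" by blast
      moreover have "J (Suc i) = zero_cofunctor" "d (Suc i) = 0" "d (Suc (Suc i)) = 0"
        using 2 by (simp_all add: J_def d_def)
      ultimately show ?thesis by (simp add: nt_exact_def zero_fun_def)
    qed
  qed (auto simp: J_def zero_functor_def)
  then have "inj_dim C s F \<le> enat 1" unfolding inj_dim_def by (intro Inf_lower) blast
  then show ?thesis by (simp add: one_enat_def)
qed

end

section \<open>Extensions of a presented functor\<close>

lemma vector_space_prod:
  assumes "vector_space s" "vector_space t"
  shows "vector_space (\<lambda>c p. (s c (fst p), t c (snd p)))"
proof -
  interpret S: vector_space s by fact
  interpret T: vector_space t by fact
  show ?thesis
    by unfold_locales (auto simp: S.scale_right_distrib T.scale_right_distrib S.scale_left_distrib T.scale_left_distrib)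
qed

lemma subspace_times:
  assumes "vector_space s" "vector_space t" "module.subspace s V" "module.subspace t W"
  shows "module.subspace (\<lambda>c p. (s c (fst p), t c (snd p))) (V \<times> W)"
proof (rule module.subspaceI[OF module_if_vector_space[OF vector_space_prod[OF assms(1,2)]]])
  note V = subspace_zeroD[OF assms(1,3)] subspace_addD[OF assms(1,3)] subspace_scaleD[OF assms(1,3)]
  note W = subspace_zeroD[OF assms(2,4)] subspace_addD[OF assms(2,4)] subspace_scaleD[OF assms(2,4)]
  show "0 \<in> V \<times> W" using V(1) W(1) by (simp add: zero_prod_def)
  show "x + y \<in> V \<times> W" if "x \<in> V \<times> W" "y \<in> V \<times> W" for x y using V(2) W(2) that by auto
  show "(s c (fst x), t c (snd x)) \<in> V \<times> W" if "x \<in> V \<times> W" for c x using V(3) W(3) that by auto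
qed

lemma fin_dim_times:
  assumes "vector_space s" "vector_space t" "fin_dim s V" "fin_dim t W"
  shows "fin_dim (\<lambda>c p. (s c (fst p), t c (snd p))) (V \<times> W)"
proof -
  obtain S where S: "finite S" "\<And>\<xi>. \<xi> \<in> S \<Longrightarrow> functional_on s V \<xi>" "\<And>x. x \<in> V \<Longrightarrow> (\<forall>\<xi>\<in>S. \<xi> x = 0) \<Longrightarrow> x = 0"
    using fin_dim_separating[OF assms(1,3)] by metis
  obtain T where T: "finite T" "\<And>\<xi>. \<xi> \<in> T \<Longrightarrow> functional_on t W \<xi>" "\<And>x. x \<in> W \<Longrightarrow> (\<forall>\<xi>\<in>T. \<xi> x = 0) \<Longrightarrow> x = 0"
    using fin_dim_separating[OF assms(2,4)] by metis
  let ?U = "(\<lambda>\<xi> p. \<xi> (fst p)) ` S \<union> (\<lambda>\<xi> p. \<xi> (snd p)) ` T"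
  show ?thesis
  proof (rule fin_dim_if_separated[OF vector_space_prod[OF assms(1,2)]
        subspace_times[OF assms(1,2) fin_dim_subspace[OF assms(1,3)] fin_dim_subspace[OF assms(2,4)]]])
    show "finite ?U" using S(1) T(1) by simp
    show "functional_on (\<lambda>c p. (s c (fst p), t c (snd p))) (V \<times> W) \<xi>" if "\<xi> \<in> ?U" for \<xi>
      using that S(2) T(2) by (fastforce simp: linear_on_def)
    show "x = 0" if x: "x \<in> V \<times> W" "\<forall>\<xi>\<in>?U. \<xi> x = 0" for x
    proof -
      have "\<xi> (fst x) = 0" if "\<xi> \<in> S" for \<xi> using bspec[OF x(2) UnI1[OF imageI[OF that]]] .
      then have "fst x = 0" using S(3)[of "fst x"] x(1) by auto
      moreover have "\<xi> (snd x) = 0" if "\<xi> \<in> T" for \<xi> using bspec[OF x(2) UnI2[OF imageI[OF that]]] .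
      then have "snd x = 0" using T(3)[of "snd x"] x(1) by auto
      ultimately show ?thesis by (simp add: prod_eq_iff)
    qed
  qed
qed

context fd_category
begin

lemma extensionsD:
  assumes "(E, i, p) \<in> extensions C s F G"
  shows "E \<in> mod_op C s" "i \<in> nat_trans C s G E" "p \<in> nat_trans C s E F" "nt_mono C G i" "nt_exact C G E i p" "nt_epi C E F p"
  using assms unfolding extensions_def by auto

text \<open>The set \<open>Ext1\<close> is a quotient of the set of extensions, so it contains the zero class only if the trivial
  extension exists.  The direct sum lives in a product type and is moved into the ambient space.\<close>

lemma direct_sum_extension:
  assumes F: "F \<in> mod_op C s" and G: "G \<in> mod_op C s"
  shows "extensions C s F G \<noteq> {}"
proof -
  define t :: "'k \<Rightarrow> 'w \<times> 'w \<Rightarrow> 'w \<times> 'w" where "t = (\<lambda>c p. (s c (fst p), s c (snd p)))"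
  have vt: "vector_space t" unfolding t_def by (rule vector_space_prod[OF vs vs])
  interpret V: vector_space s by (rule vs)
  let ?S = "\<lparr> fobj = \<lambda>X. fobj G X \<times> fobj F X,
    fmap = \<lambda>X Y f p. if p \<in> fobj G Y \<times> fobj F Y then (fmap G X Y f (fst p), fmap F X Y f (snd p)) else 0 \<rparr>"
  note subs = subspace_addD[OF vs fobj_subspace[OF vs F]] subspace_scaleD[OF vs fobj_subspace[OF vs F]]
    subspace_addD[OF vs fobj_subspace[OF vs G]] subspace_scaleD[OF vs fobj_subspace[OF vs G]]
  have S: "?S \<in> mod_op C t"
  proof (rule mod_opI[OF vt])
    fix X assume X: "X \<in> Obj C"
    show "fin_dim t (fobj ?S X)"
      unfolding t_def using fin_dim_times[OF vs vs fobj_fin_dim[OF G X] fobj_fin_dim[OF F X]] by simp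
    show "fmap ?S X X (Id C X) x = x" if "x \<in> fobj ?S X" for x
      using that fmap_Id[OF F X] fmap_Id[OF G X] by auto
    fix Y f assume Y: "Y \<in> Obj C" and f: "f \<in> Hom C X Y"
    show "linear_on t t (fobj ?S Y) (fmap ?S X Y f)"
      using fmap_linear_on[OF F X Y f] fmap_linear_on[OF G X Y f] subs[OF Y]
      by (auto simp: linear_on_def t_def)
    fix y assume y: "y \<in> fobj ?S Y"
    show "fmap ?S X Y f y \<in> fobj ?S X" using y fmap_in[OF F X Y f] fmap_in[OF G X Y f] by auto
    show "fmap ?S X Y (f + f') y = fmap ?S X Y f y + fmap ?S X Y f' y" if f': "f' \<in> Hom C X Y" for f'
      using y fmap_add_Hom[OF F X Y f f'] fmap_add_Hom[OF G X Y f f'] by auto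
    show "fmap ?S X Y (Scal C c f) y = t c (fmap ?S X Y f y)" for c
      using y fmap_scale_Hom[OF F X Y f] fmap_scale_Hom[OF G X Y f] by (auto simp: t_def)
  next
    fix X Y Z f g z
    assume X: "X \<in> Obj C" and Y: "Y \<in> Obj C" and Z: "Z \<in> Obj C" and f: "f \<in> Hom C X Y" and g: "g \<in> Hom C Y Z"
      and z: "z \<in> fobj ?S Z"
    show "fmap ?S X Z (Comp C g f) z = fmap ?S X Y f (fmap ?S Y Z g z)"
      using z fmap_Comp[OF F X Y f Z g] fmap_Comp[OF G X Y f Z g] fmap_in[OF F Y Z g] fmap_in[OF G Y Z g] by auto
  qed auto
  obtain E e where E: "E \<in> mod_op C s" "\<And>X. X \<in> Obj C \<Longrightarrow> linear_on t s (fobj ?S X) (e X)"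
    "\<And>X. X \<in> Obj C \<Longrightarrow> bij_betw (e X) (fobj ?S X) (fobj E X)"
    "\<And>X X' f y. X \<in> Obj C \<Longrightarrow> X' \<in> Obj C \<Longrightarrow> f \<in> Hom C X X' \<Longrightarrow> y \<in> fobj ?S X' \<Longrightarrow>
      fmap E X X' f (e X' y) = e X (fmap ?S X X' f y)"
    by (rule transport[OF vt S]) blast
  define r where "r X = the_inv_into (fobj ?S X) (e X)" for X
  have r: "r X (e X x) = x" if "X \<in> Obj C" "x \<in> fobj ?S X" for X x
    using the_inv_into_f_f[OF bij_betw_imp_inj_on[OF E(3)[OF that(1)]] that(2)] unfolding r_def .
  have eE: "e X x \<in> fobj E X" if "X \<in> Obj C" "x \<in> fobj ?S X" for X x
    using bij_betwE[OF E(3)[OF that(1)]] that(2) by blast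
  have onto: "\<exists>a\<in>fobj G X. \<exists>b\<in>fobj F X. x = e X (a, b)" if X: "X \<in> Obj C" and x: "x \<in> fobj E X" for X x
  proof -
    have "x \<in> e X ` fobj ?S X" unfolding bij_betw_imp_surj_on[OF E(3)[OF X]] by (rule x)
    then show ?thesis by auto
  qed
  have zF: "0 \<in> fobj F X" and zG: "0 \<in> fobj G X" if "X \<in> Obj C" for X
    using subspace_zeroD[OF vs fobj_subspace[OF vs F that]] subspace_zeroD[OF vs fobj_subspace[OF vs G that]] .
  define i where "i X x = (if X \<in> Obj C \<and> x \<in> fobj G X then e X (x, 0) else 0)" for X x
  define p where "p X x = (if X \<in> Obj C \<and> x \<in> fobj E X then snd (r X x) else 0)" for X x
  have i: "i X x = e X (x, 0)" if "X \<in> Obj C" "x \<in> fobj G X" for X x using that by (simp add: i_def)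
  have p: "p X (e X (x, y)) = y" if "X \<in> Obj C" "x \<in> fobj G X" "y \<in> fobj F X" for X x y
    using that r[OF that(1), of "(x, y)"] eE[OF that(1), of "(x, y)"] by (simp add: p_def)
  have add: "e X (a, b) + e X (a', b') = e X (a + a', b + b')"
    if "X \<in> Obj C" "a \<in> fobj G X" "b \<in> fobj F X" "a' \<in> fobj G X" "b' \<in> fobj F X" for X a b a' b'
    using linear_on_add[OF E(2)[OF that(1)], of "(a, b)" "(a', b')"] that by simp
  have scale: "s c (e X (a, b)) = e X (s c a, s c b)" if "X \<in> Obj C" "a \<in> fobj G X" "b \<in> fobj F X" for X a b c
    using linear_on_scale[OF E(2)[OF that(1)], of "(a, b)" c] that by (simp add: t_def)
  have map: "fmap E X Y f (e Y (a, b)) = e X (fmap G X Y f a, fmap F X Y f b)"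
    if "X \<in> Obj C" "Y \<in> Obj C" "f \<in> Hom C X Y" "a \<in> fobj G Y" "b \<in> fobj F Y" for X Y f a b
    using E(4)[OF that(1-3), of "(a, b)"] that by simp
  have inat: "i \<in> nat_trans C s G E"
  proof (rule nat_transI[OF vs G E(1)])
    fix X assume X: "X \<in> Obj C"
    show "i X x \<in> fobj E X" if "x \<in> fobj G X" for x using i[OF X that] eE[OF X] zF[OF X] that by simp
    show "linear_on s s (fobj G X) (i X)"
      using i[OF X] subs[OF X] add[OF X] scale[OF X] zF[OF X] by (auto simp: linear_on_def)
    fix X' f y assume X': "X' \<in> Obj C" "f \<in> Hom C X X'" "y \<in> fobj G X'"
    show "i X (fmap G X X' f y) = fmap E X X' f (i X' y)"
      using i[OF X fmap_in[OF G X X']] i[OF X'(1,3)] map[OF X X' zF[OF X'(1)]] lin_zero[OF vs fmap_lin[OF F X X'(1,2)]] by simp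
  qed (auto simp: i_def)
  have pnat: "p \<in> nat_trans C s E F"
  proof (rule nat_transI[OF vs E(1) F])
    fix X assume X: "X \<in> Obj C"
    show "p X x \<in> fobj F X" if "x \<in> fobj E X" for x using onto[OF X that] p[OF X] by auto
    show "linear_on s s (fobj E X) (p X)"
    proof (rule linear_onI)
      fix x assume "x \<in> fobj E X"
      then obtain a b where x: "a \<in> fobj G X" "b \<in> fobj F X" "x = e X (a, b)" using onto[OF X] by blast
      show "p X (s c x) = s c (p X x)" for c
        using scale[OF X x(1,2), of c] p[OF X x(1,2)] p[OF X subs(4)[OF X x(1)] subs(2)[OF X x(2)], of c c] x(3) by simp
      fix y assume "y \<in> fobj E X"
      then obtain c d where y: "c \<in> fobj G X" "d \<in> fobj F X" "y = e X (c, d)" using onto[OF X] by blast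
      show "p X (x + y) = p X x + p X y"
        using add[OF X x(1,2) y(1,2)] p[OF X x(1,2)] p[OF X y(1,2)]
          p[OF X subs(3)[OF X x(1) y(1)] subs(1)[OF X x(2) y(2)]] x(3) y(3) by simp
    qed
    fix X' f y assume X': "X' \<in> Obj C" "f \<in> Hom C X X'" "y \<in> fobj E X'"
    then obtain a b where y: "a \<in> fobj G X'" "b \<in> fobj F X'" "y = e X' (a, b)" using onto by blast
    show "p X (fmap E X X' f y) = fmap F X X' f (p X' y)"
      using map[OF X X'(1,2) y(1,2)] p[OF X'(1) y(1,2)] y(3)
        p[OF X fmap_in[OF G X X'(1,2) y(1)] fmap_in[OF F X X'(1,2) y(2)]] by simp
  qed (auto simp: p_def)
  have "(E, i, p) \<in> extensions C s F G"
    unfolding extensions_def mem_Collect_eq prod.case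
  proof (intro conjI inat pnat E(1))
    show "nt_mono C G i" unfolding nt_mono_def
    proof (intro ballI inj_onI)
      fix X x y assume X: "X \<in> Obj C" and x: "x \<in> fobj G X" and y: "y \<in> fobj G X" and "i X x = i X y"
      then have "e X (x, 0) = e X (y, 0)" using i[OF X] by simp
      then have "r X (e X (x, 0)) = r X (e X (y, 0))" by simp
      then show "x = y" using r[OF X] x y zF[OF X] by simp
    qed
    show "nt_exact C G E i p" unfolding nt_exact_def
    proof (intro ballI set_eqI iffI)
      fix X x assume X: "X \<in> Obj C"
      show "x \<in> {x \<in> fobj E X. p X x = 0}" if "x \<in> i X ` fobj G X"
        using that i[OF X] p[OF X _ zF[OF X]] eE[OF X] zF[OF X] by auto
      assume x: "x \<in> {x \<in> fobj E X. p X x = 0}"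
      then obtain a b where ab: "a \<in> fobj G X" "b \<in> fobj F X" "x = e X (a, b)" using onto[OF X] by blast
      then have "x = i X a" using x p[OF X ab(1,2)] i[OF X ab(1)] by simp
      then show "x \<in> i X ` fobj G X" using ab(1) by (rule image_eqI)
    qed
    show "nt_epi C E F p" unfolding nt_epi_def
    proof (intro ballI set_eqI iffI)
      fix X x assume X: "X \<in> Obj C"
      show "x \<in> fobj F X" if "x \<in> p X ` fobj E X" using that nat_trans_in[OF pnat X] by auto
      show "x \<in> p X ` fobj E X" if "x \<in> fobj F X"
        using that p[OF X zG[OF X] that] eE[OF X, of "(0, x)"] zG[OF X] by (auto intro!: rev_image_eqI)
    qed
  qed
  then show ?thesis by blast
qed

text \<open>A section \<open>\<sigma>\<close> decomposes every element of \<open>E\<close> as \<open>i y + \<sigma> x\<close>, and likewise for \<open>E'\<close>; the equivalence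
  matches the two decompositions.\<close>

lemma split_extensions_equiv:
  assumes F: "F \<in> mod_op C s" and G: "G \<in> mod_op C s"
    and A: "(E, i, p) \<in> Ext1_zero C s F G" and B: "(E', i', p') \<in> Ext1_zero C s F G"
  shows "((E, i, p), (E', i', p')) \<in> ext_equiv C s F G"
proof -
  have A': "(E, i, p) \<in> extensions C s F G" and B': "(E', i', p') \<in> extensions C s F G"
    using A B unfolding Ext1_zero_def by auto
  note e = extensionsD[OF A'] and e' = extensionsD[OF B']
  obtain \<sigma> where \<sigma>: "\<sigma> \<in> nat_trans C s F E" "p \<circ>\<circ> \<sigma> = id_fam (Obj C) (fobj F)" using A unfolding Ext1_zero_def by auto
  obtain \<sigma>' where \<sigma>': "\<sigma>' \<in> nat_trans C s F E'" "p' \<circ>\<circ> \<sigma>' = id_fam (Obj C) (fobj F)" using B unfolding Ext1_zero_def by auto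
  have ps: "p X (\<sigma> X x) = x" if "X \<in> Obj C" "x \<in> fobj F X" for X x
    using fun_cong[OF fun_cong[OF \<sigma>(2)], of X x] that by (simp add: comp_fam_def id_fam_def id_on_def)
  have ps': "p' X (\<sigma>' X x) = x" if "X \<in> Obj C" "x \<in> fobj F X" for X x
    using fun_cong[OF fun_cong[OF \<sigma>'(2)], of X x] that by (simp add: comp_fam_def id_fam_def id_on_def)
  have pi: "p X (i X y) = 0" if "X \<in> Obj C" "y \<in> fobj G X" for X y
    using e(5) that unfolding nt_exact_def by blast
  have pi': "p' X (i' X y) = 0" if "X \<in> Obj C" "y \<in> fobj G X" for X y
    using e'(5) that unfolding nt_exact_def by blast
  \<comment> \<open>every element is \<open>i y + \<sigma> x\<close> for unique \<open>y\<close> and \<open>x\<close>\<close>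
  have dec: "\<exists>y\<in>fobj G X. \<exists>x\<in>fobj F X. a = i X y + \<sigma> X x" if X: "X \<in> Obj C" and a: "a \<in> fobj E X" for X a
  proof -
    note pa = nat_trans_in[OF e(3) X a]
    note spa = nat_trans_in[OF \<sigma>(1) X pa]
    note sub = fobj_subspace[OF vs e(1) X]
    have "p X (a - \<sigma> X (p X a)) = 0"
      using linear_on_diff[OF vs sub nat_trans_linear_on[OF e(3) X] a spa] ps[OF X pa] by simp
    then have "a - \<sigma> X (p X a) \<in> i X ` fobj G X"
      using e(5) X subspace_diffD[OF vs sub a spa] unfolding nt_exact_def by blast
    then obtain y where "y \<in> fobj G X" "a - \<sigma> X (p X a) = i X y" by blast
    then show ?thesis using pa by (metis diff_add_cancel)
  qed
  have val: "p X (i X y + \<sigma> X x) = x" if X: "X \<in> Obj C" and y: "y \<in> fobj G X" and x: "x \<in> fobj F X" for X x y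
    using linear_on_add[OF nat_trans_linear_on[OF e(3) X] nat_trans_in[OF e(2) X y] nat_trans_in[OF \<sigma>(1) X x]]
      pi[OF X y] ps[OF X x] by simp
  let ?r = "\<lambda>X a b. \<exists>y\<in>fobj G X. \<exists>x\<in>fobj F X. a = i X y + \<sigma> X x \<and> b = i' X y + \<sigma>' X x"
  have sum: "i X y + \<sigma> X x \<in> fobj E X" "i' X y + \<sigma>' X x \<in> fobj E' X"
    if X: "X \<in> Obj C" and y: "y \<in> fobj G X" and x: "x \<in> fobj F X" for X x y
    using subspace_addD[OF vs fobj_subspace[OF vs e(1) X] nat_trans_in[OF e(2) X y] nat_trans_in[OF \<sigma>(1) X x]]
      subspace_addD[OF vs fobj_subspace[OF vs e'(1) X] nat_trans_in[OF e'(2) X y] nat_trans_in[OF \<sigma>'(1) X x]] .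
  obtain \<theta> where \<theta>nat: "\<theta> \<in> nat_trans C s E E'"
    and \<theta>r: "\<And>X a b. X \<in> Obj C \<Longrightarrow> a \<in> fobj E X \<Longrightarrow> b \<in> fobj E' X \<Longrightarrow> ?r X a b \<longleftrightarrow> b = \<theta> X a"
  proof (rule nat_trans_of_relation[OF e(1) e'(1), of ?r])
    interpret V: vector_space s by (rule vs)
    fix X assume X: "X \<in> Obj C"
    note il = nat_trans_linear_on[OF e(2) X] and sl = nat_trans_linear_on[OF \<sigma>(1) X]
      and il' = nat_trans_linear_on[OF e'(2) X] and sl' = nat_trans_linear_on[OF \<sigma>'(1) X]
      and subF = fobj_subspace[OF vs F X] and subG = fobj_subspace[OF vs G X]
    show "\<exists>b\<in>fobj E' X. ?r X a b" if a: "a \<in> fobj E X" for a using dec[OF X a] sum(2)[OF X] by blast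
    show "b = 0" if "?r X 0 b" for b
    proof -
      obtain y x where yx: "y \<in> fobj G X" "x \<in> fobj F X" "0 = i X y + \<sigma> X x" "b = i' X y + \<sigma>' X x" using \<open>?r X 0 b\<close> by blast
      have "x = 0" using val[OF X yx(1,2)] yx(3) lin_zero[OF vs nat_trans_lin[OF e(3) X]] by simp
      moreover from this have "y = 0"
        using yx(1,3) e(4) X linear_on_inj_iff[OF vs subG il] lin_zero[OF vs nat_trans_lin[OF \<sigma>(1) X]] unfolding nt_mono_def by auto
      ultimately show ?thesis
        using yx(4) lin_zero[OF vs nat_trans_lin[OF \<sigma>'(1) X]] lin_zero[OF vs nat_trans_lin[OF e'(2) X]] by simp
    qed
    show "?r X (s c a) (s c b)" if "?r X a b" for c a b
    proof -
      obtain y x where yx: "y \<in> fobj G X" "x \<in> fobj F X" "a = i X y + \<sigma> X x" "b = i' X y + \<sigma>' X x" using \<open>?r X a b\<close> by blast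
      show ?thesis
        by (rule bexI[OF _ subspace_scaleD[OF vs subG yx(1), of c]], rule bexI[OF _ subspace_scaleD[OF vs subF yx(2), of c]])
          (simp add: yx(3,4) linear_on_scale[OF il yx(1)] linear_on_scale[OF sl yx(2)] linear_on_scale[OF il' yx(1)]
            linear_on_scale[OF sl' yx(2)] V.scale_right_distrib)
    qed
    show "?r X (a + a') (b + b')" if "?r X a b" "?r X a' b'" for a b a' b'
    proof -
      obtain y x y' x' where yx: "y \<in> fobj G X" "x \<in> fobj F X" "a = i X y + \<sigma> X x" "b = i' X y + \<sigma>' X x"
        and yx': "y' \<in> fobj G X" "x' \<in> fobj F X" "a' = i X y' + \<sigma> X x'" "b' = i' X y' + \<sigma>' X x'"
        using \<open>?r X a b\<close> \<open>?r X a' b'\<close> by blast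
      show ?thesis
        by (rule bexI[OF _ subspace_addD[OF vs subG yx(1) yx'(1)]], rule bexI[OF _ subspace_addD[OF vs subF yx(2) yx'(2)]])
          (simp add: yx(3,4) yx'(3,4) linear_on_add[OF il yx(1) yx'(1)] linear_on_add[OF sl yx(2) yx'(2)]
            linear_on_add[OF il' yx(1) yx'(1)] linear_on_add[OF sl' yx(2) yx'(2)] add.assoc add.left_commute)
    qed
    fix Y f a b assume Y: "Y \<in> Obj C" and f: "f \<in> Hom C X Y" and "?r Y a b"
    then obtain y x where yx: "y \<in> fobj G Y" "x \<in> fobj F Y" "a = i Y y + \<sigma> Y x" "b = i' Y y + \<sigma>' Y x" by blast
    show "?r X (fmap E X Y f a) (fmap E' X Y f b)"
      by (rule bexI[OF _ fmap_in[OF G X Y f yx(1)]], rule bexI[OF _ fmap_in[OF F X Y f yx(2)]])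
        (simp add: yx(3,4) linear_on_add[OF fmap_linear_on[OF e(1) X Y f] nat_trans_in[OF e(2) Y yx(1)] nat_trans_in[OF \<sigma>(1) Y yx(2)]]
          linear_on_add[OF fmap_linear_on[OF e'(1) X Y f] nat_trans_in[OF e'(2) Y yx(1)] nat_trans_in[OF \<sigma>'(1) Y yx(2)]]
          nat_trans_natural[OF e(2) X Y f] nat_trans_natural[OF \<sigma>(1) X Y f]
          nat_trans_natural[OF e'(2) X Y f] nat_trans_natural[OF \<sigma>'(1) X Y f])
  qed blast
  have \<theta>: "\<theta> X (i X y + \<sigma> X x) = i' X y + \<sigma>' X x" if X: "X \<in> Obj C" and y: "y \<in> fobj G X" and x: "x \<in> fobj F X" for X x y
    by (rule iffD1[OF \<theta>r[OF X sum[OF X y x]], symmetric]) (rule bexI[OF _ y], rule bexI[OF _ x], simp)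
  have "\<theta> \<circ>\<circ> i = i'"
  proof (rule nat_trans_eqI[OF e'(2) e(2) \<theta>nat])
    fix X y assume X: "X \<in> Obj C" and y: "y \<in> fobj G X"
    note z = subspace_zeroD[OF vs fobj_subspace[OF vs F X]]
    show "\<theta> X (i X y) = i' X y"
      using \<theta>[OF X y z] lin_zero[OF vs nat_trans_lin[OF \<sigma>(1) X]] lin_zero[OF vs nat_trans_lin[OF \<sigma>'(1) X]] by simp
  qed
  moreover have "p' \<circ>\<circ> \<theta> = p"
  proof (rule nat_trans_eqI[OF e(3) \<theta>nat e'(3)])
    fix X a assume X: "X \<in> Obj C" and "a \<in> fobj E X"
    then obtain y x where a: "y \<in> fobj G X" "x \<in> fobj F X" "a = i X y + \<sigma> X x" using dec[OF X] by blast
    show "p' X (\<theta> X a) = p X a"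
      using \<theta>[OF X a(1,2)] val[OF X a(1,2)] a(3) pi'[OF X a(1)] ps'[OF X a(2)]
        linear_on_add[OF nat_trans_linear_on[OF e'(3) X] nat_trans_in[OF e'(2) X a(1)] nat_trans_in[OF \<sigma>'(1) X a(2)]] by simp
  qed
  ultimately show ?thesis using A' B' \<theta>nat unfolding ext_equiv_def by blast
qed

lemma Ext1_eq_zero:
  assumes F: "F \<in> mod_op C s" and G: "G \<in> mod_op C s"
    and split: "\<And>E i p. (E, i, p) \<in> extensions C s F G \<Longrightarrow> (E, i, p) \<in> Ext1_zero C s F G"
  shows "Ext1 C s F G = {Ext1_zero C s F G}"
proof -
  have eq: "Ext1_zero C s F G = extensions C s F G"
    using split by (auto simp: Ext1_zero_def)
  have "ext_equiv C s F G `` {x} = extensions C s F G" if "x \<in> extensions C s F G" for x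
  proof
    show "ext_equiv C s F G `` {x} \<subseteq> extensions C s F G" unfolding ext_equiv_def by auto
    show "extensions C s F G \<subseteq> ext_equiv C s F G `` {x}"
    proof
      fix y assume y: "y \<in> extensions C s F G"
      have "(x, y) \<in> ext_equiv C s F G"
        using split_extensions_equiv[OF F G] that y unfolding eq by (cases x, cases y) auto
      then show "y \<in> ext_equiv C s F G `` {x}" by blast
    qed
  qed
  then have "Ext1 C s F G = {extensions C s F G}"
    using direct_sum_extension[OF F G] unfolding Ext1_def quotient_def by auto
  then show ?thesis using eq by simp
qed

text \<open>The sequence of \<open>presents\<close> computes \<open>Ext\<^sup>1(F, G)\<close> as the cokernel of \<open>G Y0 \<rightarrow> G Y1\<close>.  In terms of an
  extension \<open>E\<close>: a preimage \<open>a\<close> of the generator \<open>z\<close> restricts along \<open>m\<close> to an element of \<open>G Y1\<close>; if that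
  comes from \<open>G Y0\<close>, then \<open>a\<close> can be corrected to satisfy all relations of \<open>z\<close>, which gives a section.\<close>

lemma Ext1_presented:
  assumes F: "F \<in> mod_op C s" and G: "G \<in> mod_op C s" and pr: "presents F Y0 Y1 m z"
    and onto: "fmap G Y1 Y0 m ` fobj G Y0 = fobj G Y1"
  shows "Ext1 C s F G = {Ext1_zero C s F G}"
proof (rule Ext1_eq_zero[OF F G])
  fix E i p assume A: "(E, i, p) \<in> extensions C s F G"
  note e = extensionsD[OF A]
  have Y0: "Y0 \<in> Obj C" and Y1: "Y1 \<in> Obj C" and m: "m \<in> Hom C Y1 Y0" and z: "z \<in> fobj F Y0"
    and sur: "\<And>X x. X \<in> Obj C \<Longrightarrow> x \<in> fobj F X \<Longrightarrow> \<exists>f\<in>Hom C X Y0. x = fmap F X Y0 f z"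
    and mz: "fmap F Y1 Y0 m z = 0"
    and ex: "\<And>X f. X \<in> Obj C \<Longrightarrow> f \<in> Hom C X Y0 \<Longrightarrow> fmap F X Y0 f z = 0 \<Longrightarrow> \<exists>g\<in>Hom C X Y1. f = Comp C m g"
    using pr unfolding presents_def by blast+
  have "z \<in> p Y0 ` fobj E Y0" using e(6) Y0 z unfolding nt_epi_def by simp
  then obtain a where a: "a \<in> fobj E Y0" "p Y0 a = z" by blast
  note ma = fmap_in[OF e(1) Y1 Y0 m a(1)]
  have "p Y1 (fmap E Y1 Y0 m a) = 0" using nat_trans_natural[OF e(3) Y1 Y0 m, of a] a(2) mz by simp
  then have "fmap E Y1 Y0 m a \<in> i Y1 ` fobj G Y1" using e(5) Y1 ma unfolding nt_exact_def by blast
  then have "fmap E Y1 Y0 m a \<in> i Y1 ` fmap G Y1 Y0 m ` fobj G Y0" unfolding onto .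
  then obtain b where b: "b \<in> fobj G Y0" "fmap E Y1 Y0 m a = i Y1 (fmap G Y1 Y0 m b)" by blast
  note ib = nat_trans_in[OF e(2) Y0 b(1)]
  define a' where "a' = a - i Y0 b"
  have a': "a' \<in> fobj E Y0" unfolding a'_def using subspace_diffD[OF vs fobj_subspace[OF vs e(1) Y0] a(1) ib] .
  have "p Y0 (i Y0 b) = 0" using e(5) Y0 b(1) unfolding nt_exact_def by blast
  then have pa': "p Y0 a' = z"
    using linear_on_diff[OF vs fobj_subspace[OF vs e(1) Y0] nat_trans_linear_on[OF e(3) Y0] a(1) ib] a(2) by (simp add: a'_def)
  have ma': "fmap E Y1 Y0 m a' = 0"
    using linear_on_diff[OF vs fobj_subspace[OF vs e(1) Y0] fmap_linear_on[OF e(1) Y1 Y0 m] a(1) ib] b(2)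
      nat_trans_natural[OF e(2) Y1 Y0 m, of b] by (simp add: a'_def)
  have kill: "fmap E X Y0 f a' = 0" if X: "X \<in> Obj C" and f: "f \<in> Hom C X Y0" "fmap F X Y0 f z = 0" for X f
  proof -
    obtain g where g: "g \<in> Hom C X Y1" "f = Comp C m g" using ex[OF X f] by blast
    show ?thesis using fmap_Comp[OF e(1) X Y1 g(1) Y0 m, of a'] ma' g(2) lin_zero[OF vs fmap_lin[OF e(1) X Y1 g(1)]] by simp
  qed
  obtain \<sigma> where \<sigma>nat: "\<sigma> \<in> nat_trans C s F E"
    and \<sigma>: "\<And>X f. X \<in> Obj C \<Longrightarrow> f \<in> Hom C X Y0 \<Longrightarrow> \<sigma> X (fmap F X Y0 f z) = fmap E X Y0 f a'"
    using nat_trans_from_generator[OF F e(1) Y0 z a' sur kill] by blast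
  have ps: "p X (\<sigma> X x) = x" if X: "X \<in> Obj C" and x: "x \<in> fobj F X" for X x
  proof -
    obtain f where f: "f \<in> Hom C X Y0" "x = fmap F X Y0 f z" using sur[OF X x] by blast
    then show ?thesis using \<sigma>[OF X f(1)] nat_trans_natural[OF e(3) X Y0 f(1), of a'] pa' by simp
  qed
  have "p \<circ>\<circ> \<sigma> = id_fam (Obj C) (fobj F)"
  proof (intro ext)
    fix X x
    show "(p \<circ>\<circ> \<sigma>) X x = id_fam (Obj C) (fobj F) X x"
      using ps[of X x] nat_trans_outside[OF \<sigma>nat, of X x] nat_trans_outside_Obj[OF \<sigma>nat, of X x]
        nat_trans_outside_Obj[OF e(3), of X] lin_zero[OF vs nat_trans_lin[OF e(3), of X]]
      by (auto simp: comp_fam_def id_fam_def id_on_def)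
  qed
  then show "(E, i, p) \<in> Ext1_zero C s F G" using A \<sigma>nat unfolding Ext1_zero_def by blast
qed

end

section \<open>Quiver representations\<close>

lemma comp_fam_apply [simp]: "(g \<circ>\<circ> f) i x = g i (f i x)"
  by (simp add: comp_fam_def)

lemma comp_fam_assoc: "(h \<circ>\<circ> g) \<circ>\<circ> f = h \<circ>\<circ> (g \<circ>\<circ> f)"
  by (simp add: comp_fam_def comp_assoc)

lemma id_fam_apply: "id_fam I V i x = (if i \<in> I \<and> x \<in> V i then x else 0)"
  by (simp add: id_fam_def id_on_def)

lemma vector_space_scale_fam: "vector_space s \<Longrightarrow> vector_space (scale_fam s)"
proof -
  assume "vector_space s"
  then interpret vector_space s .
  show ?thesis
    by unfold_locales (auto simp: scale_fam_def fun_eq_iff scale_right_distrib scale_left_distrib)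
qed

locale quiver_reps =
  fixes s :: "'k::field \<Rightarrow> 'u::ab_group_add \<Rightarrow> 'u"
    and Q :: "('v, 'a) pre_digraph"
  assumes vs: "vector_space s"
    and infinite_ambient: "\<not> fin_dim s UNIV"
    and wf_digraph: "wf_digraph Q"
    and finite_verts: "finite (verts Q)"
begin

abbreviation reps :: "('v, 'a, 'u) qrep set" where "reps \<equiv> fd_reps s Q"
abbreviation rhom :: "('v, 'a, 'u) qrep \<Rightarrow> ('v, 'a, 'u) qrep \<Rightarrow> ('v \<Rightarrow> 'u \<Rightarrow> 'u) set" where
  "rhom \<equiv> rep_hom s Q"
abbreviation rid :: "('v, 'a, 'u) qrep \<Rightarrow> 'v \<Rightarrow> 'u \<Rightarrow> 'u" where
  "rid M \<equiv> id_fam (verts Q) (space M)"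

lemmas vs_fam = vector_space_scale_fam[OF vs]

lemma ends_in_verts: "a \<in> arcs Q \<Longrightarrow> tail Q a \<in> verts Q" "a \<in> arcs Q \<Longrightarrow> head Q a \<in> verts Q"
  using wf_digraph by (auto simp: wf_digraph_def)

lemma
  assumes "M \<in> reps"
  shows space_fin_dim: "v \<in> verts Q \<Longrightarrow> fin_dim s (space M v)"
    and act_lin: "a \<in> arcs Q \<Longrightarrow> act M a \<in> lin s (space M (tail Q a)) (space M (head Q a))"
  using assms by (auto simp: fd_reps_def)

lemma act_in: "M \<in> reps \<Longrightarrow> a \<in> arcs Q \<Longrightarrow> x \<in> space M (tail Q a) \<Longrightarrow> act M a x \<in> space M (head Q a)"
  using linD(1)[OF act_lin] .

lemma space_subspace: "M \<in> reps \<Longrightarrow> v \<in> verts Q \<Longrightarrow> module.subspace s (space M v)"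
  using fin_dim_subspace[OF vs space_fin_dim] .

lemmas space_zero = subspace_zeroD[OF vs space_subspace]
lemmas space_add = subspace_addD[OF vs space_subspace]
lemmas space_scale = subspace_scaleD[OF vs space_subspace]
lemmas space_diff = subspace_diffD[OF vs space_subspace]
lemmas act_zero = lin_zero[OF vs act_lin]

lemma
  assumes "f \<in> rhom M N"
  shows hom_lin: "v \<in> verts Q \<Longrightarrow> f v \<in> lin s (space M v) (space N v)"
    and hom_natural: "a \<in> arcs Q \<Longrightarrow> f (head Q a) (act M a x) = act N a (f (tail Q a) x)"
    and hom_outside_verts: "v \<notin> verts Q \<Longrightarrow> f v x = 0"
proof -
  show "v \<in> verts Q \<Longrightarrow> f v \<in> lin s (space M v) (space N v)" "v \<notin> verts Q \<Longrightarrow> f v x = 0"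
    using assms by (auto simp: rep_hom_def lin_fam_def)
  assume "a \<in> arcs Q"
  then have "f (head Q a) \<circ> act M a = act N a \<circ> f (tail Q a)" using assms by (auto simp: rep_hom_def)
  then show "f (head Q a) (act M a x) = act N a (f (tail Q a) x)" by (metis comp_apply)
qed

lemma
  assumes "f \<in> rhom M N" "v \<in> verts Q"
  shows hom_in: "x \<in> space M v \<Longrightarrow> f v x \<in> space N v"
    and hom_linear_on: "linear_on s s (space M v) (f v)"
    and hom_outside: "x \<notin> space M v \<Longrightarrow> f v x = 0"
    and hom_zero: "f v 0 = 0"
  using linD[OF hom_lin[OF assms]] lin_zero[OF vs hom_lin[OF assms]] by blast+

lemma hom_outside': "f \<in> rhom M N \<Longrightarrow> \<not> (v \<in> verts Q \<and> x \<in> space M v) \<Longrightarrow> f v x = 0"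
  using hom_outside hom_outside_verts by blast

lemma rhomI:
  assumes M: "M \<in> reps" and N: "N \<in> reps"
    and 1: "\<And>v x. v \<in> verts Q \<Longrightarrow> x \<in> space M v \<Longrightarrow> f v x \<in> space N v"
    and 2: "\<And>v. v \<in> verts Q \<Longrightarrow> linear_on s s (space M v) (f v)"
    and 3: "\<And>v x. \<not> (v \<in> verts Q \<and> x \<in> space M v) \<Longrightarrow> f v x = 0"
    and 4: "\<And>a x. a \<in> arcs Q \<Longrightarrow> x \<in> space M (tail Q a) \<Longrightarrow> f (head Q a) (act M a x) = act N a (f (tail Q a) x)"
  shows "f \<in> rhom M N"
proof -
  have l: "f v \<in> lin s (space M v) (space N v)" if "v \<in> verts Q" for v
    using that 1 2 3 unfolding lin_iff by blast
  have "f (head Q a) \<circ> act M a = act N a \<circ> f (tail Q a)" if a: "a \<in> arcs Q" for a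
  proof
    show "(f (head Q a) \<circ> act M a) x = (act N a \<circ> f (tail Q a)) x" for x
      using 4[OF a, of x] 3[of "tail Q a" x] linD(3)[OF act_lin[OF M a], of x] act_zero[OF N a]
        lin_zero[OF vs l[OF ends_in_verts(2)[OF a]]]
      by (cases "x \<in> space M (tail Q a)") simp_all
  qed
  moreover have "f v = 0" if "v \<notin> verts Q" for v using 3 that by (simp add: fun_eq_iff)
  ultimately show ?thesis using l unfolding rep_hom_def lin_fam_def by simp
qed

lemma hom_eqI:
  assumes "f \<in> rhom M N" "g \<in> rhom M N'" "\<And>v x. v \<in> verts Q \<Longrightarrow> x \<in> space M v \<Longrightarrow> f v x = g v x"
  shows "f = g"
proof (intro ext)
  show "f v x = g v x" for v x
    using assms hom_outside'[OF assms(1), of v x] hom_outside'[OF assms(2), of v x]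
    by (cases "v \<in> verts Q \<and> x \<in> space M v") simp_all
qed

lemma hom_comp:
  assumes "M \<in> reps" "K \<in> reps" "f \<in> rhom M N" "g \<in> rhom N K"
  shows "g \<circ>\<circ> f \<in> rhom M K"
proof (rule rhomI[OF assms(1,2)])
  show "linear_on s s (space M v) ((g \<circ>\<circ> f) v)" if v: "v \<in> verts Q" for v
    using linear_on_compose[OF hom_linear_on[OF assms(3) v] hom_linear_on[OF assms(4) v]] hom_in[OF assms(3) v]
    by (auto simp: linear_on_def)
  show "(g \<circ>\<circ> f) v x = 0" if "\<not> (v \<in> verts Q \<and> x \<in> space M v)" for v x
    using that hom_outside'[OF assms(3) that] hom_zero[OF assms(4), of v] hom_outside_verts[OF assms(4), of v] by auto
  show "(g \<circ>\<circ> f) (head Q a) (act M a x) = act K a ((g \<circ>\<circ> f) (tail Q a) x)" if "a \<in> arcs Q" for a x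
    using hom_natural[OF assms(3) that] hom_natural[OF assms(4) that] by simp
qed (use hom_in[OF assms(3)] hom_in[OF assms(4)] in simp)

lemma rid_hom: "M \<in> reps \<Longrightarrow> rid M \<in> rhom M M"
  by (rule rhomI) (use space_add space_scale ends_in_verts act_in in \<open>auto simp: id_fam_apply linear_on_def\<close>)

lemma comp_rid: "f \<in> rhom M N \<Longrightarrow> f \<circ>\<circ> rid M = f"
  using hom_outside' hom_zero hom_outside_verts by (fastforce simp: id_fam_apply fun_eq_iff)

lemma rid_comp: "f \<in> rhom M N \<Longrightarrow> rid N \<circ>\<circ> f = f"
  using hom_outside' hom_in by (fastforce simp: id_fam_apply fun_eq_iff)

lemma rhom_subspace:
  assumes M: "M \<in> reps" and N: "N \<in> reps"
  shows "module.subspace (scale_fam s) (rhom M N)"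
proof (rule module.subspaceI[OF module_if_vector_space[OF vs_fam]])
  interpret V: vector_space s by (rule vs)
  show "0 \<in> rhom M N"
    by (rule rhomI[OF M N]) (use space_zero[OF N] act_zero[OF N] in \<open>auto simp: linear_on_def\<close>)
  fix f assume f: "f \<in> rhom M N"
  show "scale_fam s c f \<in> rhom M N" for c
  proof (rule rhomI[OF M N])
    fix a x assume a: "a \<in> arcs Q" and x: "x \<in> space M (tail Q a)"
    show "scale_fam s c f (head Q a) (act M a x) = act N a (scale_fam s c f (tail Q a) x)"
      using hom_natural[OF f a] linear_on_scale[OF linD(2)[OF act_lin[OF N a]] hom_in[OF f ends_in_verts(1)[OF a] x]]
      by (simp add: scale_fam_def)
  qed (use hom_in[OF f] space_scale[OF N] hom_linear_on[OF f] hom_outside'[OF f] in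
      \<open>auto simp: scale_fam_def linear_on_def V.scale_right_distrib V.scale_left_commute\<close>)
  fix g assume g: "g \<in> rhom M N"
  show "f + g \<in> rhom M N"
  proof (rule rhomI[OF M N])
    fix a x assume a: "a \<in> arcs Q" and x: "x \<in> space M (tail Q a)"
    show "(f + g) (head Q a) (act M a x) = act N a ((f + g) (tail Q a) x)"
      using hom_natural[OF f a] hom_natural[OF g a]
        linear_on_add[OF linD(2)[OF act_lin[OF N a]] hom_in[OF f ends_in_verts(1)[OF a] x] hom_in[OF g ends_in_verts(1)[OF a] x]]
      by simp
  qed (use hom_in[OF f] hom_in[OF g] space_add[OF N] hom_linear_on[OF f] hom_linear_on[OF g] hom_outside'[OF f] hom_outside'[OF g] in
      \<open>auto simp: linear_on_def V.scale_right_distrib algebra_simps\<close>)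
qed

lemmas rhom_zero = subspace_zeroD[OF vs_fam rhom_subspace]
lemmas rhom_diff = subspace_diffD[OF vs_fam rhom_subspace]

lemma linear_on_eval: "linear_on (scale_fam s) s W (\<lambda>f. f v x)"
  by (simp add: linear_on_def scale_fam_def)

lemma rhom_fin_dim:
  assumes M: "M \<in> reps" and N: "N \<in> reps"
  shows "fin_dim (scale_fam s) (rhom M N)"
proof -
  interpret V: vector_space s by (rule vs)
  have "\<exists>B. finite B \<and> V.span B = space M v" if "v \<in> verts Q" for v
    using space_fin_dim[OF M that] unfolding fin_dim_def by metis
  then obtain B where B: "\<And>v. v \<in> verts Q \<Longrightarrow> finite (B v) \<and> V.span (B v) = space M v" by metis
  have "\<exists>T. finite T \<and> (\<forall>\<xi>\<in>T. functional_on s (space N v) \<xi>) \<and> (\<forall>x\<in>space N v. (\<forall>\<xi>\<in>T. \<xi> x = 0) \<longrightarrow> x = 0)"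
    if "v \<in> verts Q" for v
    using fin_dim_separating[OF vs space_fin_dim[OF N that]] by metis
  then obtain T where T: "\<And>v. v \<in> verts Q \<Longrightarrow> finite (T v) \<and> (\<forall>\<xi>\<in>T v. functional_on s (space N v) \<xi>) \<and>
    (\<forall>x\<in>space N v. (\<forall>\<xi>\<in>T v. \<xi> x = 0) \<longrightarrow> x = 0)" by metis
  let ?E = "\<Union>v\<in>verts Q. (\<lambda>(b, \<xi>) f. \<xi> (f v b)) ` (B v \<times> T v)"
  have Bv: "b \<in> space M v" if "v \<in> verts Q" "b \<in> B v" for v b using B[OF that(1)] V.span_base[OF that(2)] by blast
  show ?thesis
  proof (rule fin_dim_if_separated[OF vs_fam rhom_subspace[OF M N]])
    show "finite ?E" using finite_verts B T by simp
    fix \<zeta> assume "\<zeta> \<in> ?E"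
    then obtain v b \<xi> where v: "v \<in> verts Q" "b \<in> B v" "\<xi> \<in> T v" "\<zeta> = (\<lambda>f. \<xi> (f v b))" by auto
    have "functional_on s (space N v) \<xi>" using T[OF v(1)] v(3) by blast
    then show "functional_on (scale_fam s) (rhom M N) \<zeta>"
      unfolding v(4) by (rule linear_on_compose[OF linear_on_eval]) (use hom_in[OF _ v(1) Bv[OF v(1,2)]] in blast)
  next
    fix f assume f: "f \<in> rhom M N" "\<forall>\<zeta>\<in>?E. \<zeta> f = 0"
    have "f v x = 0" for v x
    proof (cases "v \<in> verts Q \<and> x \<in> space M v")
      case True
      then have v: "v \<in> verts Q" ..
      have fb: "f v b = 0" if b: "b \<in> B v" for b
      proof -
        have "\<xi> (f v b) = 0" if "\<xi> \<in> T v" for \<xi>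
        proof -
          have "(\<lambda>f. \<xi> (f v b)) \<in> ?E" using v b that by force
          from bspec[OF f(2) this] show ?thesis .
        qed
        then show ?thesis using T[OF v] hom_in[OF f(1) v Bv[OF v b]] by blast
      qed
      have "V.span (B v) \<subseteq> {x \<in> space M v. f v x = 0}"
        by (rule V.span_minimal[OF _ subspace_kernel[OF vs space_subspace[OF M v] hom_linear_on[OF f(1) v] vs]])
          (use Bv[OF v] fb in blast)
      then show ?thesis using B[OF v] True by blast
    qed (rule hom_outside'[OF f(1)])
    then show "f = 0" by (simp add: fun_eq_iff)
  qed
qed

lemma linear_on_comp_left: "linear_on (scale_fam s) (scale_fam s) W (\<lambda>g. g \<circ>\<circ> f)"
  by (simp add: linear_on_def scale_fam_def fun_eq_iff)

lemma linear_on_comp_right: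
  assumes g: "g \<in> rhom N K" and N: "N \<in> reps"
  shows "linear_on (scale_fam s) (scale_fam s) (rhom M N) (\<lambda>f. g \<circ>\<circ> f)"
proof -
  have z: "0 \<in> space N v" if "v \<in> verts Q" for v using space_zero[OF N that] .
  have in': "f v x \<in> space N v" if "f \<in> rhom M N" "v \<in> verts Q" for f v x
    using hom_in[OF that] hom_outside[OF that] z[OF that(2)] by metis
  show ?thesis
  proof (rule linear_onI)
    fix f assume f: "f \<in> rhom M N"
    show "g \<circ>\<circ> scale_fam s c f = scale_fam s c (g \<circ>\<circ> f)" for c
    proof (intro ext)
      interpret V: vector_space s by (rule vs)
      show "(g \<circ>\<circ> scale_fam s c f) v x = scale_fam s c (g \<circ>\<circ> f) v x" for v x
        using linear_on_scale[OF hom_linear_on[OF g] in'[OF f]] hom_outside_verts[OF g, of v]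
        by (cases "v \<in> verts Q") (simp_all add: scale_fam_def)
    qed
    fix f' assume f': "f' \<in> rhom M N"
    show "g \<circ>\<circ> (f + f') = (g \<circ>\<circ> f) + (g \<circ>\<circ> f')"
    proof (intro ext)
      show "(g \<circ>\<circ> (f + f')) v x = ((g \<circ>\<circ> f) + (g \<circ>\<circ> f')) v x" for v x
        using linear_on_add[OF hom_linear_on[OF g] in'[OF f] in'[OF f']] hom_outside_verts[OF g, of v]
        by (cases "v \<in> verts Q") simp_all
    qed
  qed
qed

lemma comp_zero_left [simp]: "0 \<circ>\<circ> f = 0"
  by (simp add: fun_eq_iff)

lemma comp_zero_right:
  assumes "g \<in> rhom N K"
  shows "g \<circ>\<circ> 0 = 0"
proof (intro ext)
  show "(g \<circ>\<circ> 0) v x = 0 v x" for v x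
    using hom_zero[OF assms, of v] hom_outside_verts[OF assms, of v] by (cases "v \<in> verts Q") simp_all
qed

lemma comp_diff_right:
  assumes "M \<in> reps" "N \<in> reps" "g \<in> rhom N K" "f \<in> rhom M N" "f' \<in> rhom M N"
  shows "g \<circ>\<circ> (f - f') = (g \<circ>\<circ> f) - (g \<circ>\<circ> f')"
  using linear_on_diff[OF vs_fam rhom_subspace[OF assms(1,2)] linear_on_comp_right[OF assms(3,2)] assms(4,5)] .

lemma comp_diff_left: "(g - g') \<circ>\<circ> f = (g \<circ>\<circ> f) - (g' \<circ>\<circ> f)"
  by (simp add: fun_eq_iff)

lemma mono_iff:
  assumes "M \<in> reps" "f \<in> rhom M N"
  shows "rep_mono Q M f \<longleftrightarrow> (\<forall>v\<in>verts Q. \<forall>x\<in>space M v. f v x = 0 \<longrightarrow> x = 0)"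
  unfolding rep_mono_def using linear_on_inj_iff[OF vs space_subspace[OF assms(1)] hom_linear_on[OF assms(2)]] by simp

lemma mono_cancel:
  assumes M: "M \<in> reps" and f: "f \<in> rhom M N" and mono: "rep_mono Q M f" and g: "g \<in> rhom L M" "f \<circ>\<circ> g = 0"
  shows "g = 0"
proof (intro ext)
  fix v x
  have "f v (g v x) = 0" using fun_cong[OF fun_cong[OF g(2)], of v x] by simp
  then show "g v x = 0 v x"
    using mono hom_in[OF g(1), of v x] hom_outside'[OF g(1), of v x] unfolding mono_iff[OF M f] by auto
qed

lemma epi_cancel:
  assumes f: "f \<in> rhom M N" and epi: "rep_epi Q M N f" and g: "g \<in> rhom N L" "g \<circ>\<circ> f = 0"
  shows "g = 0"
proof (intro ext)
  fix v x
  show "g v x = 0 v x"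
  proof (cases "v \<in> verts Q \<and> x \<in> space N v")
    case True
    then have "x \<in> f v ` space M v" using epi unfolding rep_epi_def by simp
    then obtain y where "x = f v y" by blast
    then show ?thesis using fun_cong[OF fun_cong[OF g(2)], of v y] by simp
  next
    case False
    then show ?thesis using hom_outside'[OF g(1)] by simp
  qed
qed

lemma rhom_of_relation:
  assumes M: "M \<in> reps" and N: "N \<in> reps"
    and ex: "\<And>v x. v \<in> verts Q \<Longrightarrow> x \<in> space M v \<Longrightarrow> \<exists>y\<in>space N v. r v x y"
    and zero: "\<And>v y. v \<in> verts Q \<Longrightarrow> y \<in> space N v \<Longrightarrow> r v 0 y \<Longrightarrow> y = 0"
    and add: "\<And>v x y x' y'. v \<in> verts Q \<Longrightarrow> x \<in> space M v \<Longrightarrow> y \<in> space N v \<Longrightarrow> x' \<in> space M v \<Longrightarrow> y' \<in> space N v \<Longrightarrow>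
      r v x y \<Longrightarrow> r v x' y' \<Longrightarrow> r v (x + x') (y + y')"
    and scale: "\<And>v c x y. v \<in> verts Q \<Longrightarrow> x \<in> space M v \<Longrightarrow> y \<in> space N v \<Longrightarrow> r v x y \<Longrightarrow> r v (s c x) (s c y)"
    and act: "\<And>a x y. a \<in> arcs Q \<Longrightarrow> x \<in> space M (tail Q a) \<Longrightarrow> y \<in> space N (tail Q a) \<Longrightarrow>
      r (tail Q a) x y \<Longrightarrow> r (head Q a) (act M a x) (act N a y)"
  obtains f where "f \<in> rhom M N" "\<And>v x. v \<in> verts Q \<Longrightarrow> x \<in> space M v \<Longrightarrow> r v x (f v x)"
proof -
  have "\<exists>f\<in>lin s (space M v) (space N v). \<forall>x\<in>space M v. r v x (f x) \<and> (\<forall>y\<in>space N v. r v x y \<longrightarrow> y = f x)"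
    if v: "v \<in> verts Q" for v
    by (rule lin_of_relation[OF vs space_subspace[OF M v] space_subspace[OF N v]]) (fact ex[OF v] zero[OF v] add[OF v] scale[OF v])+
  then obtain f0 where f0: "\<And>v. v \<in> verts Q \<Longrightarrow> f0 v \<in> lin s (space M v) (space N v) \<and>
    (\<forall>x\<in>space M v. r v x (f0 v x) \<and> (\<forall>y\<in>space N v. r v x y \<longrightarrow> y = f0 v x))" by metis
  define f where "f v = (if v \<in> verts Q then f0 v else 0)" for v
  have l: "f v \<in> lin s (space M v) (space N v)" and r: "x \<in> space M v \<Longrightarrow> r v x (f v x)"
    and u: "x \<in> space M v \<Longrightarrow> y \<in> space N v \<Longrightarrow> r v x y \<Longrightarrow> y = f v x" if "v \<in> verts Q" for v x y
    using f0[OF that] that by (simp_all add: f_def)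
  have "f \<in> rhom M N"
  proof (rule rhomI[OF M N])
    fix a x assume a: "a \<in> arcs Q" and x: "x \<in> space M (tail Q a)"
    note e = ends_in_verts[OF a]
    note fx = linD(1)[OF l[OF e(1)] x]
    show "f (head Q a) (act M a x) = act N a (f (tail Q a) x)"
      by (rule u[OF e(2), symmetric]) (intro act_in[OF M a x] act_in[OF N a fx] act[OF a x fx r[OF e(1) x]])+
  next
    fix v x assume "\<not> (v \<in> verts Q \<and> x \<in> space M v)"
    then show "f v x = 0" using linD(3)[OF l, of v x] by (cases "v \<in> verts Q") (simp_all add: f_def)
  qed (use linD[OF l] in blast)+
  then show thesis using that r by blast
qed

lemma factor_through_mono:
  assumes P: "P \<in> reps" and R: "R \<in> reps" and N: "N \<in> reps" and \<iota>: "\<iota> \<in> rhom P R" "rep_mono Q P \<iota>" and f: "f \<in> rhom N R"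
    and im: "\<And>v x. v \<in> verts Q \<Longrightarrow> x \<in> space N v \<Longrightarrow> f v x \<in> \<iota> v ` space P v"
  obtains \<phi> where "\<phi> \<in> rhom N P" "\<iota> \<circ>\<circ> \<phi> = f"
proof -
  obtain \<phi> where \<phi>: "\<phi> \<in> rhom N P" "\<And>v x. v \<in> verts Q \<Longrightarrow> x \<in> space N v \<Longrightarrow> \<iota> v (\<phi> v x) = f v x"
  proof (rule rhom_of_relation[OF N P, of "\<lambda>v x y. \<iota> v y = f v x"])
    fix v assume v: "v \<in> verts Q"
    show "\<exists>y\<in>space P v. \<iota> v y = f v x" if "x \<in> space N v" for x using im[OF v that] by force
    show "y = 0" if "y \<in> space P v" "\<iota> v y = f v 0" for y
      using that \<iota>(2) v hom_zero[OF f v] unfolding mono_iff[OF P \<iota>(1)] by simp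
  qed (simp_all add: linear_on_add[OF hom_linear_on[OF \<iota>(1)]] linear_on_add[OF hom_linear_on[OF f]]
      linear_on_scale[OF hom_linear_on[OF \<iota>(1)]] linear_on_scale[OF hom_linear_on[OF f]]
      hom_natural[OF \<iota>(1)] hom_natural[OF f])
  have "\<iota> \<circ>\<circ> \<phi> = f" by (rule hom_eqI[OF hom_comp[OF N R \<phi>(1) \<iota>(1)] f]) (simp add: \<phi>(2))
  then show thesis using that \<phi>(1) by blast
qed

lemma factor_through_epi:
  assumes R: "R \<in> reps" and M: "M \<in> reps" and N: "N \<in> reps"
    and \<pi>: "\<pi> \<in> rhom R M" "rep_epi Q R M \<pi>" and f: "f \<in> rhom R N"
    and ker: "\<And>v x. v \<in> verts Q \<Longrightarrow> x \<in> space R v \<Longrightarrow> \<pi> v x = 0 \<Longrightarrow> f v x = 0"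
  obtains g where "g \<in> rhom M N" "g \<circ>\<circ> \<pi> = f"
proof -
  let ?r = "\<lambda>v y z. \<exists>x\<in>space R v. y = \<pi> v x \<and> z = f v x"
  obtain g where g: "g \<in> rhom M N" "\<And>v y. v \<in> verts Q \<Longrightarrow> y \<in> space M v \<Longrightarrow> ?r v y (g v y)"
  proof (rule rhom_of_relation[OF M N, of ?r])
    fix v assume v: "v \<in> verts Q"
    show "\<exists>z\<in>space N v. ?r v y z" if "y \<in> space M v" for y
    proof -
      have "y \<in> \<pi> v ` space R v" using \<pi>(2) v that unfolding rep_epi_def by simp
      then show ?thesis using hom_in[OF f v] by blast
    qed
    show "z = 0" if "?r v 0 z" for z using that ker[OF v] by auto
    show "?r v (s c y) (s c z)" if "?r v y z" for c y z
      using that space_scale[OF R v] linear_on_scale[OF hom_linear_on[OF \<pi>(1) v]] linear_on_scale[OF hom_linear_on[OF f v]] by metis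
    show "?r v (y + y') (z + z')" if "?r v y z" "?r v y' z'" for y z y' z'
      using that space_add[OF R v] linear_on_add[OF hom_linear_on[OF \<pi>(1) v]] linear_on_add[OF hom_linear_on[OF f v]] by metis
  next
    fix a y z assume a: "a \<in> arcs Q" and "?r (tail Q a) y z"
    then show "?r (head Q a) (act M a y) (act N a z)"
      using act_in[OF R a] hom_natural[OF \<pi>(1) a] hom_natural[OF f a] by metis
  qed blast
  have "g v (\<pi> v x) = f v x" if v: "v \<in> verts Q" and x: "x \<in> space R v" for v x
  proof -
    obtain x' where x': "x' \<in> space R v" "\<pi> v x = \<pi> v x'" "g v (\<pi> v x) = f v x'" using g(2)[OF v hom_in[OF \<pi>(1) v x]] by blast
    have "f v (x - x') = 0"
      using ker[OF v space_diff[OF R v x x'(1)]] linear_on_diff[OF vs space_subspace[OF R v] hom_linear_on[OF \<pi>(1) v] x x'(1)] x'(2)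
      by simp
    then show ?thesis using linear_on_diff[OF vs space_subspace[OF R v] hom_linear_on[OF f v] x x'(1)] x'(3) by simp
  qed
  then have "g \<circ>\<circ> \<pi> = f" by (intro hom_eqI[OF hom_comp[OF R N \<pi>(1) g(1)] f]) simp
  then show thesis using that g(1) by blast
qed

text \<open>Homomorphisms vanish outside their source.  Therefore a homomorphism with values in \<open>U\<close> is, as a
  function, also a homomorphism into the subrepresentation, and the inclusion is the identity of the
  family \<open>U\<close>.\<close>

definition subrep :: "('v, 'a, 'u) qrep \<Rightarrow> ('v \<Rightarrow> 'u set) \<Rightarrow> ('v, 'a, 'u) qrep" where
  "subrep M U = \<lparr> space = U, act = \<lambda>a x. if x \<in> U (tail Q a) then act M a x else 0 \<rparr>"

definition invariant :: "('v, 'a, 'u) qrep \<Rightarrow> ('v \<Rightarrow> 'u set) \<Rightarrow> bool" where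
  "invariant M U \<longleftrightarrow> (\<forall>v\<in>verts Q. module.subspace s (U v) \<and> U v \<subseteq> space M v) \<and>
     (\<forall>a\<in>arcs Q. act M a ` U (tail Q a) \<subseteq> U (head Q a))"

lemma space_subrep [simp]: "space (subrep M U) = U"
  by (simp add: subrep_def)

lemma act_subrep: "x \<in> U (tail Q a) \<Longrightarrow> act (subrep M U) a x = act M a x"
  by (simp add: subrep_def)

lemma subrep_reps:
  assumes M: "M \<in> reps" and U: "invariant M U"
  shows "subrep M U \<in> reps"
proof -
  have "fin_dim s (U v)" if "v \<in> verts Q" for v
    using fin_dim_subset[OF vs space_fin_dim[OF M that]] U that unfolding invariant_def by blast
  moreover have "act (subrep M U) a \<in> lin s (U (tail Q a)) (U (head Q a))" if a: "a \<in> arcs Q" for a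
  proof -
    note t = ends_in_verts(1)[OF a]
    have sub: "module.subspace s (U (tail Q a))" "U (tail Q a) \<subseteq> space M (tail Q a)" using U t unfolding invariant_def by blast+
    have "linear_on s s (U (tail Q a)) (act M a)" using linear_on_subset[OF linD(2)[OF act_lin[OF M a]] sub(2)] .
    then show ?thesis
      using U a subspace_addD[OF vs sub(1)] subspace_scaleD[OF vs sub(1)]
      unfolding lin_iff linear_on_def invariant_def by (auto simp: subrep_def)
  qed
  ultimately show ?thesis unfolding fd_reps_def by simp
qed

lemma subrep_incl:
  assumes M: "M \<in> reps" and U: "invariant M U"
  shows "id_fam (verts Q) U \<in> rhom (subrep M U) M" "rep_mono Q (subrep M U) (id_fam (verts Q) U)"
proof -
  have U': "U v \<subseteq> space M v" "module.subspace s (U v)" if "v \<in> verts Q" for v using U that unfolding invariant_def by blast+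
  show "id_fam (verts Q) U \<in> rhom (subrep M U) M"
  proof (rule rhomI[OF subrep_reps[OF assms] M])
    show "linear_on s s (space (subrep M U) v) (id_fam (verts Q) U v)" if "v \<in> verts Q" for v
      using that subspace_addD[OF vs U'(2)] subspace_scaleD[OF vs U'(2)] by (auto simp: linear_on_def id_fam_apply)
    show "id_fam (verts Q) U (head Q a) (act (subrep M U) a x) = act M a (id_fam (verts Q) U (tail Q a) x)"
      if "a \<in> arcs Q" "x \<in> space (subrep M U) (tail Q a)" for a x
    proof -
      have "x \<in> U (tail Q a)" using that(2) by simp
      moreover from this have "act M a x \<in> U (head Q a)" using U that(1) unfolding invariant_def by blast
      ultimately show ?thesis using ends_in_verts[OF that(1)] by (simp add: id_fam_apply act_subrep)
    qed
  qed (use U' in \<open>auto simp: id_fam_apply\<close>)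
  show "rep_mono Q (subrep M U) (id_fam (verts Q) U)"
    unfolding rep_mono_def by (auto simp: inj_on_def id_fam_apply)
qed

lemma corestrict:
  assumes M: "M \<in> reps" and U: "invariant M U" and N: "N \<in> reps" and f: "f \<in> rhom N M"
    and im: "\<And>v x. v \<in> verts Q \<Longrightarrow> x \<in> space N v \<Longrightarrow> f v x \<in> U v"
  shows "f \<in> rhom N (subrep M U)" "id_fam (verts Q) U \<circ>\<circ> f = f"
proof -
  show "f \<in> rhom N (subrep M U)"
    by (rule rhomI[OF N subrep_reps[OF M U]])
      (use im hom_linear_on[OF f] hom_outside'[OF f] hom_natural[OF f] ends_in_verts in \<open>auto simp: act_subrep\<close>)
  show "id_fam (verts Q) U \<circ>\<circ> f = f"
    using im hom_outside'[OF f] by (fastforce simp: fun_eq_iff id_fam_apply)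
qed

lemma kernel_invariant:
  assumes N: "N \<in> reps" and M: "M \<in> reps" and f: "f \<in> rhom N M"
  shows "invariant N (\<lambda>v. {x \<in> space N v. f v x = 0})"
  unfolding invariant_def
  using subspace_kernel[OF vs space_subspace[OF N] hom_linear_on[OF f] vs] act_in[OF N] hom_natural[OF f] act_zero[OF M]
  by auto

lemma image_invariant:
  assumes N: "N \<in> reps" and M: "M \<in> reps" and f: "f \<in> rhom N M"
  shows "invariant M (\<lambda>v. f v ` space N v)"
  unfolding invariant_def
proof (intro conjI ballI)
  fix a assume a: "a \<in> arcs Q"
  show "act M a ` f (tail Q a) ` space N (tail Q a) \<subseteq> f (head Q a) ` space N (head Q a)"
    using hom_natural[OF f a, symmetric] act_in[OF N a] by auto
qed (use subspace_linear_image[OF vs vs space_subspace[OF N] hom_linear_on[OF f]] hom_in[OF f] in auto)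

definition zrep :: "('v, 'a, 'u) qrep" where
  "zrep = \<lparr> space = \<lambda>v. {0}, act = \<lambda>a x. 0 \<rparr>"

lemma zrep_reps: "zrep \<in> reps"
proof -
  interpret vector_space s by (rule vs)
  have "{0} = span {}" by simp
  then have "fin_dim s {0}" unfolding fin_dim_def by (metis finite.emptyI)
  then show ?thesis unfolding fd_reps_def lin_iff by (auto simp: zrep_def linear_on_def)
qed

lemma zrep_simps [simp]: "space zrep v = {0}" "zero_rep Q zrep"
  by (simp_all add: zrep_def zero_rep_def)

lemma hom_zrep:
  assumes "f \<in> rhom zrep M \<or> f \<in> rhom M zrep"
  shows "f = 0"
proof (intro ext)
  show "f v x = 0 v x" for v x
    using assms hom_outside'[of f zrep M v x] hom_zero[of f zrep M v] hom_outside'[of f M zrep v x] hom_in[of f M zrep v x]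
    by (cases "v \<in> verts Q \<and> x = 0") auto
qed

lemma projD:
  assumes "P \<in> proj_reps s Q"
  shows "P \<in> reps"
    and "M \<in> reps \<Longrightarrow> N \<in> reps \<Longrightarrow> \<pi> \<in> rhom M N \<Longrightarrow> rep_epi Q M N \<pi> \<Longrightarrow> f \<in> rhom P N \<Longrightarrow> \<exists>g\<in>rhom P M. \<pi> \<circ>\<circ> g = f"
  using assms unfolding proj_reps_def by blast+

lemma zrep_proj: "zrep \<in> proj_reps s Q"
  unfolding proj_reps_def
proof (intro CollectI conjI ballI impI zrep_reps)
  fix M N \<pi> f assume M: "M \<in> reps" and N: "N \<in> reps" and \<pi>: "\<pi> \<in> rhom M N" and f: "f \<in> rhom zrep N"
  have "f = 0" using f hom_zrep by blast
  then have "\<pi> \<circ>\<circ> 0 = f" using comp_zero_right[OF \<pi>] by simp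
  then show "\<exists>g\<in>rhom zrep M. \<pi> \<circ>\<circ> g = f" using rhom_zero[OF zrep_reps M] by blast
qed

definition injective_rep :: "('v, 'a, 'u) qrep \<Rightarrow> bool" where
  "injective_rep I \<longleftrightarrow> I \<in> reps \<and> (\<forall>M\<in>reps. \<forall>N\<in>reps. \<forall>\<mu>\<in>rhom M N. \<forall>f\<in>rhom M I.
     rep_mono Q M \<mu> \<longrightarrow> (\<exists>g\<in>rhom N I. g \<circ>\<circ> \<mu> = f))"

lemma injective_repD:
  assumes "injective_rep I" "M \<in> reps" "N \<in> reps" "\<mu> \<in> rhom M N" "rep_mono Q M \<mu>" "f \<in> rhom M I"
  obtains g where "g \<in> rhom N I" "g \<circ>\<circ> \<mu> = f"
  using assms unfolding injective_rep_def by blast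

text \<open>The functional \<open>u\<close> induces \<open>Hom(N, I) = D Hom(R, N)\<close> for all \<open>N\<close>: in terms of the Nakayama functor
  \<open>\<nu>\<close>, it is a way to say \<open>I = \<nu> R\<close> without constructing \<open>\<nu>\<close>.\<close>

definition nakayama :: "('v, 'a, 'u) qrep \<Rightarrow> ('v, 'a, 'u) qrep \<Rightarrow> (('v \<Rightarrow> 'u \<Rightarrow> 'u) \<Rightarrow> 'k) \<Rightarrow> bool" where
  "nakayama R I u \<longleftrightarrow> R \<in> reps \<and> I \<in> reps \<and> functional_on (scale_fam s) (rhom R I) u \<and>
     (\<forall>N\<in>reps. \<forall>f\<in>rhom R N. (\<forall>g\<in>rhom N I. u (g \<circ>\<circ> f) = 0) \<longrightarrow> f = 0) \<and>
     (\<forall>N\<in>reps. \<forall>g\<in>rhom N I. (\<forall>f\<in>rhom R N. u (g \<circ>\<circ> f) = 0) \<longrightarrow> g = 0)"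

lemma nakayamaD:
  assumes "nakayama R I u"
  shows "R \<in> reps" "I \<in> reps" "functional_on (scale_fam s) (rhom R I) u"
    and "N \<in> reps \<Longrightarrow> f \<in> rhom R N \<Longrightarrow> (\<And>g. g \<in> rhom N I \<Longrightarrow> u (g \<circ>\<circ> f) = 0) \<Longrightarrow> f = 0"
    and "N \<in> reps \<Longrightarrow> g \<in> rhom N I \<Longrightarrow> (\<And>f. f \<in> rhom R N \<Longrightarrow> u (g \<circ>\<circ> f) = 0) \<Longrightarrow> g = 0"
  using assms unfolding nakayama_def by blast+

lemma
  assumes u: "functional_on (scale_fam s) (rhom A D) u" and A: "A \<in> reps" and B: "B \<in> reps" and D: "D \<in> reps"
  shows functional_comp_left: "f \<in> rhom A B \<Longrightarrow> functional_on (scale_fam s) (rhom B D) (\<lambda>g. u (g \<circ>\<circ> f))"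
    and functional_comp_right: "g \<in> rhom B D \<Longrightarrow> functional_on (scale_fam s) (rhom A B) (\<lambda>f. u (g \<circ>\<circ> f))"
proof -
  show "functional_on (scale_fam s) (rhom B D) (\<lambda>g. u (g \<circ>\<circ> f))" if "f \<in> rhom A B"
    by (rule linear_on_compose[OF linear_on_comp_left u]) (use hom_comp[OF A D that] in blast)
  show "functional_on (scale_fam s) (rhom A B) (\<lambda>f. u (g \<circ>\<circ> f))" if "g \<in> rhom B D"
    by (rule linear_on_compose[OF linear_on_comp_right[OF that B] u]) (use hom_comp[OF A D _ that] in blast)
qed

text \<open>\<open>Hom(-, I)\<close> sends an epimorphism \<open>\<pi>\<close> to an injection, so its dual \<open>Hom(R, -)\<close> sends \<open>\<pi>\<close> to a
  surjection.\<close>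

lemma nakayama_projective:
  assumes n: "nakayama R I u"
  shows "R \<in> proj_reps s Q"
  unfolding proj_reps_def
proof (intro CollectI conjI ballI impI)
  note R = nakayamaD(1)[OF n] and I = nakayamaD(2)[OF n] and u = nakayamaD(3)[OF n]
  show "R \<in> reps" by (rule R)
  fix M N \<pi> f
  assume M: "M \<in> reps" and N: "N \<in> reps" and \<pi>: "\<pi> \<in> rhom M N" and f: "f \<in> rhom R N" and epi: "rep_epi Q M N \<pi>"
  have "\<exists>g\<in>rhom R M. \<forall>h\<in>rhom N I. u (h \<circ>\<circ> f) = u (h \<circ>\<circ> (\<pi> \<circ>\<circ> g))"
  proof (rule double_annihilator[OF vs_fam vs_fam rhom_subspace[OF N I] rhom_fin_dim[OF R M]])
    show "functional_on (scale_fam s) (rhom N I) (\<lambda>h. u (h \<circ>\<circ> (\<pi> \<circ>\<circ> g)))" if "g \<in> rhom R M" for g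
      by (rule functional_comp_left[OF u R N I hom_comp[OF R N that \<pi>]])
    show "functional_on (scale_fam s) (rhom R M) (\<lambda>g. u (h \<circ>\<circ> (\<pi> \<circ>\<circ> g)))" if "h \<in> rhom N I" for h
      using functional_comp_right[OF u R M I hom_comp[OF M I \<pi> that]] by (simp add: comp_fam_assoc)
    show "functional_on (scale_fam s) (rhom N I) (\<lambda>h. u (h \<circ>\<circ> f))" by (rule functional_comp_left[OF u R N I f])
    fix h assume h: "h \<in> rhom N I" "\<forall>g\<in>rhom R M. u (h \<circ>\<circ> (\<pi> \<circ>\<circ> g)) = 0"
    have "h \<circ>\<circ> \<pi> = 0"
      by (rule nakayamaD(5)[OF n M hom_comp[OF M I \<pi> h(1)]]) (use h(2) in \<open>simp add: comp_fam_assoc\<close>)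
    then have "h = 0" using epi_cancel[OF \<pi> epi h(1)] by blast
    then show "u (h \<circ>\<circ> f) = 0" using linear_on_zero[OF u rhom_zero[OF R I]] by simp
  qed
  then obtain g where g: "g \<in> rhom R M" "\<And>h. h \<in> rhom N I \<Longrightarrow> u (h \<circ>\<circ> f) = u (h \<circ>\<circ> (\<pi> \<circ>\<circ> g))" by blast
  note pg = hom_comp[OF R N g(1) \<pi>]
  have "f - (\<pi> \<circ>\<circ> g) = 0"
  proof (rule nakayamaD(4)[OF n N rhom_diff[OF R N f pg]])
    fix h assume h: "h \<in> rhom N I"
    show "u (h \<circ>\<circ> (f - (\<pi> \<circ>\<circ> g))) = 0"
      using linear_on_diff[OF vs_fam rhom_subspace[OF R N] functional_comp_right[OF u R N I h] f pg] g(2)[OF h] by simp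
  qed
  then show "\<exists>g\<in>rhom R M. \<pi> \<circ>\<circ> g = f" using g(1) by (metis eq_iff_diff_eq_0)
qed

text \<open>Dually, \<open>Hom(R, -)\<close> sends a monomorphism to an injection, so \<open>Hom(-, I)\<close> sends it to a surjection.\<close>

lemma nakayama_injective:
  assumes n: "nakayama R I u"
  shows "injective_rep I"
  unfolding injective_rep_def
proof (intro conjI ballI impI)
  note R = nakayamaD(1)[OF n] and I = nakayamaD(2)[OF n] and u = nakayamaD(3)[OF n]
  show "I \<in> reps" by (rule I)
  fix M N \<mu> f
  assume M: "M \<in> reps" and N: "N \<in> reps" and \<mu>: "\<mu> \<in> rhom M N" and f: "f \<in> rhom M I" and mono: "rep_mono Q M \<mu>"
  have "\<exists>g\<in>rhom N I. \<forall>h\<in>rhom R M. u (f \<circ>\<circ> h) = u ((g \<circ>\<circ> \<mu>) \<circ>\<circ> h)"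
  proof (rule double_annihilator[OF vs_fam vs_fam rhom_subspace[OF R M] rhom_fin_dim[OF N I]])
    show "functional_on (scale_fam s) (rhom R M) (\<lambda>h. u ((g \<circ>\<circ> \<mu>) \<circ>\<circ> h))" if "g \<in> rhom N I" for g
      by (rule functional_comp_right[OF u R M I hom_comp[OF M I \<mu> that]])
    show "functional_on (scale_fam s) (rhom N I) (\<lambda>g. u ((g \<circ>\<circ> \<mu>) \<circ>\<circ> h))" if "h \<in> rhom R M" for h
      using functional_comp_left[OF u R N I hom_comp[OF R N that \<mu>]] by (simp add: comp_fam_assoc)
    show "functional_on (scale_fam s) (rhom R M) (\<lambda>h. u (f \<circ>\<circ> h))" by (rule functional_comp_right[OF u R M I f])
    fix h assume h: "h \<in> rhom R M" "\<forall>g\<in>rhom N I. u ((g \<circ>\<circ> \<mu>) \<circ>\<circ> h) = 0"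
    have "\<mu> \<circ>\<circ> h = 0"
      by (rule nakayamaD(4)[OF n N hom_comp[OF R N h(1) \<mu>]]) (use h(2) in \<open>simp add: comp_fam_assoc\<close>)
    then have "h = 0" using mono_cancel[OF M \<mu> mono h(1)] by blast
    then show "u (f \<circ>\<circ> h) = 0" using linear_on_zero[OF u rhom_zero[OF R I]] comp_zero_right[OF f] by simp
  qed
  then obtain g where g: "g \<in> rhom N I" "\<And>h. h \<in> rhom R M \<Longrightarrow> u (f \<circ>\<circ> h) = u ((g \<circ>\<circ> \<mu>) \<circ>\<circ> h)" by blast
  note gm = hom_comp[OF M I \<mu> g(1)]
  have "f - (g \<circ>\<circ> \<mu>) = 0"
  proof (rule nakayamaD(5)[OF n M rhom_diff[OF M I f gm]])
    fix h assume h: "h \<in> rhom R M"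
    show "u ((f - (g \<circ>\<circ> \<mu>)) \<circ>\<circ> h) = 0"
      using linear_on_diff[OF vs_fam rhom_subspace[OF M I] functional_comp_left[OF u R M I h] f gm] g(2)[OF h] by simp
  qed
  then show "\<exists>g\<in>rhom N I. g \<circ>\<circ> \<mu> = f" using g(1) by (metis eq_iff_diff_eq_0)
qed

end

section \<open>Directed walks in Dynkin quivers\<close>

text \<open>A tree with root \<open>0\<close> whose labels increase away from the root: every arc joins a vertex to its parent,
  and so it is determined by the one of its ends that has the larger label.\<close>

locale labelled_tree = pre_digraph Q for Q :: "('v, 'a) pre_digraph" +
  fixes lab :: "'v \<Rightarrow> nat"
  assumes lab_ends: "a \<in> arcs Q \<Longrightarrow> lab (tail Q a) \<noteq> lab (head Q a)"
    and lab_top: "a \<in> arcs Q \<Longrightarrow> b \<in> arcs Q \<Longrightarrow>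
      max (lab (tail Q a)) (lab (head Q a)) = max (lab (tail Q b)) (lab (head Q b)) \<Longrightarrow> a = b"
begin

definition up :: "'a \<Rightarrow> bool" where
  "up a \<longleftrightarrow> lab (tail Q a) < lab (head Q a)"

text \<open>Otherwise both arcs would have \<open>head Q a\<close> as their larger end, so they would coincide and form a loop.  Hence a directed walk
  first descends towards the root and then ascends.\<close>

lemma up_up:
  assumes "a \<in> arcs Q" "b \<in> arcs Q" "head Q a = tail Q b" "up a"
  shows "up b"
proof (rule ccontr)
  assume "\<not> up b"
  then have "max (lab (tail Q a)) (lab (head Q a)) = max (lab (tail Q b)) (lab (head Q b))"
    using assms(3,4) unfolding up_def by simp
  then have "a = b" using lab_top assms(1,2) by blast
  then show False using lab_ends[OF assms(2)] assms(3) by simp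
qed

lemma up_chain:
  "cas u (a # p) v \<Longrightarrow> set (a # p) \<subseteq> arcs Q \<Longrightarrow> up a \<Longrightarrow> lab u < lab v \<and> up (last (a # p))"
proof (induction p arbitrary: u a)
  case Nil
  then show ?case by (auto simp: up_def)
next
  case (Cons b p)
  then have "up b" using up_up[of a b] by auto
  then have "lab (head Q a) < lab v \<and> up (last (b # p))" using Cons.IH[of "head Q a" b] Cons.prems by auto
  then show ?case using Cons.prems unfolding up_def by auto
qed

lemma down_chain:
  "cas u p v \<Longrightarrow> set p \<subseteq> arcs Q \<Longrightarrow> p \<noteq> [] \<Longrightarrow> \<not> up (last p) \<Longrightarrow> lab v < lab u \<and> \<not> up (hd p)"
proof (induction p arbitrary: u)
  case (Cons a p)
  have a: "\<not> up a" using up_chain[OF Cons.prems(1,2)] Cons.prems(4) by blast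
  then have lt: "lab (head Q a) < lab u" using lab_ends[of a] Cons.prems unfolding up_def by auto
  show ?case
  proof (cases "p = []")
    case False
    then have "lab v < lab (head Q a)" using Cons by auto
    then show ?thesis using lt a by simp
  qed (use lt a Cons.prems in auto)
qed simp

lemma last_head: "cas u p v \<Longrightarrow> p \<noteq> [] \<Longrightarrow> head Q (last p) = v"
  by (induction p arbitrary: u) auto

lemma cas_butlast: "cas u p v \<Longrightarrow> p \<noteq> [] \<Longrightarrow> cas u (butlast p) (tail Q (last p))"
  by (induction p arbitrary: u) auto

lemma no_closed_walk:
  assumes "cas u p u" "set p \<subseteq> arcs Q"
  shows "p = []"
proof (rule ccontr)
  assume ne: "p \<noteq> []"
  then obtain a p' where p: "p = a # p'" by (cases p) auto
  have "up (last p)" using down_chain[OF assms ne] by blast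
  moreover have "\<not> up (hd p)" using up_chain[of u a p' u] assms p by auto
  moreover have "head Q (last p) = tail Q (hd p)" using last_head[OF assms(1) ne] assms(1) p by simp
  moreover have "last p \<in> arcs Q" "hd p \<in> arcs Q" using assms(2) ne by auto
  ultimately show False using up_up by blast
qed

text \<open>If both walks end with an ascent, then both last arcs have the common end point as their larger end and
  coincide.  Otherwise one of the walks descends all the way; its end has a smaller label than its start,
  so both walks begin with a descent, and the first arcs coincide.  In either case the common arc is
  removed.\<close>

lemma unique_cas:
  "cas u p v \<Longrightarrow> cas u q v \<Longrightarrow> set p \<subseteq> arcs Q \<Longrightarrow> set q \<subseteq> arcs Q \<Longrightarrow> p = q"
proof (induction "length p" arbitrary: u v p q)
  case 0
  then show ?case using no_closed_walk[of u q] by auto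
next
  case (Suc n)
  then have p: "p \<noteq> []" by auto
  have q: "q \<noteq> []" using Suc.prems no_closed_walk[of u p] p by auto
  have arcs: "last p \<in> arcs Q" "last q \<in> arcs Q" "hd p \<in> arcs Q" "hd q \<in> arcs Q" using Suc.prems(3,4) p q by auto
  show ?case
  proof (cases "up (last p) \<and> up (last q)")
    case True
    then have eq: "last p = last q"
      using lab_top[OF arcs(1,2)] last_head[OF Suc.prems(1) p] last_head[OF Suc.prems(2) q] unfolding up_def by simp
    have "butlast p = butlast q"
    proof (rule Suc.hyps(1))
      show "n = length (butlast p)" using Suc.hyps(2) by simp
      show "cas u (butlast p) (tail Q (last p))" "cas u (butlast q) (tail Q (last p))"
        using cas_butlast[OF Suc.prems(1) p] cas_butlast[OF Suc.prems(2) q] eq by simp_all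
    qed (use Suc.prems in \<open>auto dest: in_set_butlastD\<close>)
    then show ?thesis using eq p q by (metis append_butlast_last_id)
  next
    case False
    have "lab v < lab u" using False down_chain[OF Suc.prems(1,3) p] down_chain[OF Suc.prems(2,4) q] by blast
    then have down: "\<not> up (hd p)" "\<not> up (hd q)"
      using up_chain[of u "hd p" "tl p" v] up_chain[of u "hd q" "tl q" v] Suc.prems p q by auto
    have t: "tail Q (hd p) = u" "tail Q (hd q) = u"
      using Suc.prems(1,2) p q by (auto simp: cas_simp)
    have eq: "hd p = hd q" using lab_top[OF arcs(3,4)] down t unfolding up_def by simp
    have "tl p = tl q"
    proof (rule Suc.hyps(1))
      show "n = length (tl p)" using Suc.hyps(2) by simp
      show "cas (head Q (hd p)) (tl p) v" "cas (head Q (hd p)) (tl q) v"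
        using Suc.prems(1,2) p q eq by (auto simp: cas_simp)
    qed (use Suc.prems p q in \<open>auto dest: list.set_sel(2)\<close>)
    then show ?thesis using eq p q by (metis list.collapse)
  qed
qed

end

text \<open>The vertices are numbered along a path, and in types D and E the vertex off the path comes last.  So
  each vertex is attached to a single vertex among those numbered before it.\<close>

lemma dynkin_diagram_rooted:
  assumes "dynkin_diagram n E"
  shows "e \<in> E \<Longrightarrow> \<exists>j i. j < i \<and> e = {j, i}"
    and "{j, i} \<in> E \<Longrightarrow> {j', i} \<in> E \<Longrightarrow> j < i \<Longrightarrow> j' < i \<Longrightarrow> j = j'"
proof -
  have disj: "n \<ge> 1 \<and> E = A_edges n \<or> n \<ge> 4 \<and> E = D_edges n \<or> n \<ge> 6 \<and> E = E_edges n"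
    using assms unfolding dynkin_diagram_def by auto
  show "\<exists>j i. j < i \<and> e = {j, i}" if "e \<in> E"
  proof -
    have "(\<exists>i. e = {i, i + 1}) \<or> (n \<ge> 4 \<and> e = {n - 3, n - 1}) \<or> (n \<ge> 6 \<and> e = {2, n - 1})"
      using disj that unfolding A_edges_def D_edges_def E_edges_def by blast
    then show ?thesis
    proof (elim disjE exE conjE)
      fix i assume "e = {i, i + 1}"
      then show ?thesis by (intro exI[of _ i] exI[of _ "i + 1"]) simp
    next
      assume "4 \<le> n" "e = {n - 3, n - 1}"
      then show ?thesis by (intro exI[of _ "n - 3"] exI[of _ "n - 1"]) simp
    next
      assume "6 \<le> n" "e = {2, n - 1}"
      then show ?thesis by (intro exI[of _ 2] exI[of _ "n - 1"]) simp
    qed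
  qed
  show "j = j'" if "{j, i} \<in> E" "{j', i} \<in> E" "j < i" "j' < i"
    using disj
  proof (elim disjE conjE)
    assume "E = A_edges n"
    then show ?thesis using that unfolding A_edges_def by (auto simp: doubleton_eq_iff)
  next
    assume "4 \<le> n" "E = D_edges n"
    then show ?thesis using that unfolding D_edges_def by (auto simp: doubleton_eq_iff)
  next
    assume "6 \<le> n" "E = E_edges n"
    then show ?thesis using that unfolding E_edges_def by (auto simp: doubleton_eq_iff)
  qed
qed

lemma dynkin_quiver_finite: "dynkin_quiver Q \<Longrightarrow> finite (verts Q)"
  unfolding dynkin_quiver_def using bij_betw_finite by blast

lemma dynkin_quiver_finite_arcs:
  assumes "dynkin_quiver Q"
  shows "finite (arcs Q)"
proof -
  obtain n E \<beta> where E: "dynkin_diagram n E" and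
    b: "bij_betw (\<lambda>a. \<beta> ` {tail Q a, head Q a}) (arcs Q) E" and \<beta>: "bij_betw \<beta> (verts Q) {..<n}"
    using assms unfolding dynkin_quiver_def by blast
  have "E \<subseteq> Pow {..<n}"
  proof
    fix e assume "e \<in> E"
    then obtain a where "a \<in> arcs Q" "e = \<beta> ` {tail Q a, head Q a}" using b unfolding bij_betw_def by blast
    moreover have "wf_digraph Q" using assms unfolding dynkin_quiver_def by blast
    ultimately show "e \<in> Pow {..<n}" using \<beta> unfolding bij_betw_def wf_digraph_def by auto
  qed
  then have "finite E" by (rule finite_subset) simp
  then show ?thesis using bij_betw_finite[OF b] by blast
qed

lemma dynkin_quiver_unique_walk:
  assumes "dynkin_quiver Q" "pre_digraph.awalk Q u p v" "pre_digraph.awalk Q u q v"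
  shows "p = q"
proof -
  obtain n E \<beta> where E: "dynkin_diagram n E" and
    b: "bij_betw (\<lambda>a. \<beta> ` {tail Q a, head Q a}) (arcs Q) E"
    using assms(1) unfolding dynkin_quiver_def by blast
  have edge: "{\<beta> (tail Q a), \<beta> (head Q a)} \<in> E" if "a \<in> arcs Q" for a
    using bij_betwE[OF b] that by fastforce
  have inj: "a = c" if "a \<in> arcs Q" "c \<in> arcs Q" "{\<beta> (tail Q a), \<beta> (head Q a)} = {\<beta> (tail Q c), \<beta> (head Q c)}" for a c
    using bij_betw_imp_inj_on[OF b] that by (auto simp: inj_on_def)
  have ends: "\<beta> (tail Q a) \<noteq> \<beta> (head Q a)" if "a \<in> arcs Q" for a
    using dynkin_diagram_rooted(1)[OF E edge[OF that]] by (auto simp: doubleton_eq_iff)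
  have minmax: "{min x y, max x y} = {x, y}" for x y :: nat by (auto simp: min_def max_def)
  interpret labelled_tree Q \<beta>
  proof
    show "\<beta> (tail Q a) \<noteq> \<beta> (head Q a)" if "a \<in> arcs Q" for a by (rule ends[OF that])
    fix a c assume ac: "a \<in> arcs Q" "c \<in> arcs Q"
      and eq: "max (\<beta> (tail Q a)) (\<beta> (head Q a)) = max (\<beta> (tail Q c)) (\<beta> (head Q c))"
    let ?m = "\<lambda>a. min (\<beta> (tail Q a)) (\<beta> (head Q a))" and ?M = "\<lambda>a. max (\<beta> (tail Q a)) (\<beta> (head Q a))"
    have "?m a = ?m c"
    proof (rule dynkin_diagram_rooted(2)[OF E])
      show "{?m a, ?M a} \<in> E" "{?m c, ?M a} \<in> E" using edge ac unfolding eq minmax by (simp_all add: minmax eq[symmetric])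
      show "?m a < ?M a" "?m c < ?M a" using ends[OF ac(1)] ends[OF ac(2)] eq by auto
    qed
    then have "{?m a, ?M a} = {?m c, ?M c}" using eq by simp
    then show "a = c" using inj[OF ac] unfolding minmax by blast
  qed
  show ?thesis using unique_cas assms(2,3) unfolding awalk_def by blast
qed

section \<open>Standard projective and injective representations\<close>

locale tree_reps = quiver_reps s Q
  for s :: "'k::field \<Rightarrow> 'u::ab_group_add \<Rightarrow> 'u" and Q :: "('v, 'a) pre_digraph" +
  assumes finite_arcs: "finite (arcs Q)"
    and unique_walk: "pre_digraph.awalk Q u p v \<Longrightarrow> pre_digraph.awalk Q u q v \<Longrightarrow> p = q"
begin

abbreviation walk :: "'v \<Rightarrow> 'a list \<Rightarrow> 'v \<Rightarrow> bool" where "walk \<equiv> pre_digraph.awalk Q"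

lemma walk_Nil: "walk u [] v \<longleftrightarrow> u = v \<and> u \<in> verts Q"
  by (rule wf_digraph.awalk_Nil_iff[OF wf_digraph])

lemma walk_Cons: "walk u (a # p) v \<longleftrightarrow> a \<in> arcs Q \<and> tail Q a = u \<and> walk (head Q a) p v"
  using wf_digraph.awalk_Cons_iff[OF wf_digraph] by auto

lemma walk_snoc: "walk u (p @ [a]) v \<longleftrightarrow> walk u p (tail Q a) \<and> a \<in> arcs Q \<and> head Q a = v"
  by (induction p arbitrary: u) (auto simp: walk_Nil walk_Cons ends_in_verts)

lemma walk_append: "walk u p v \<Longrightarrow> walk v q w \<Longrightarrow> walk u (p @ q) w"
  by (induction p arbitrary: u) (auto simp: walk_Nil walk_Cons)

lemma walk_verts: "walk u p v \<Longrightarrow> u \<in> verts Q" "walk u p v \<Longrightarrow> v \<in> verts Q"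
  by (induction p arbitrary: u) (auto simp: walk_Nil walk_Cons ends_in_verts)

definition reach :: "'v \<Rightarrow> 'v \<Rightarrow> bool" where "reach u v \<longleftrightarrow> (\<exists>p. walk u p v)"

lemma reach_refl: "v \<in> verts Q \<Longrightarrow> reach v v"
  unfolding reach_def using walk_Nil by blast

lemma reach_trans: "reach u v \<Longrightarrow> reach v w \<Longrightarrow> reach u w"
  unfolding reach_def using walk_append by blast

lemma reach_arc: "a \<in> arcs Q \<Longrightarrow> reach (tail Q a) (head Q a)"
  unfolding reach_def by (rule exI[of _ "[a]"]) (simp add: walk_Cons walk_Nil ends_in_verts)

lemma reach_verts: "reach u v \<Longrightarrow> u \<in> verts Q" "reach u v \<Longrightarrow> v \<in> verts Q"
  unfolding reach_def using walk_verts by blast+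

primrec along :: "('v, 'a, 'u) qrep \<Rightarrow> 'a list \<Rightarrow> 'u \<Rightarrow> 'u" where
  "along N [] x = x" |
  "along N (a # p) x = along N p (act N a x)"

lemma along_snoc: "along N (p @ [a]) x = act N a (along N p x)"
  by (induction p arbitrary: x) auto

lemma along_in: "N \<in> reps \<Longrightarrow> walk u p v \<Longrightarrow> x \<in> space N u \<Longrightarrow> along N p x \<in> space N v"
  by (induction p arbitrary: u x) (auto simp: walk_Nil walk_Cons act_in)

lemma along_linear_on: "N \<in> reps \<Longrightarrow> walk u p v \<Longrightarrow> linear_on s s (space N u) (along N p)"
proof (induction p arbitrary: u)
  case (Cons a p)
  then have a: "a \<in> arcs Q" "tail Q a = u" "walk (head Q a) p v" by (auto simp: walk_Cons)
  have "linear_on s s (space N u) (\<lambda>x. along N p (act N a x))"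
    by (rule linear_on_compose[OF _ Cons.IH[OF Cons.prems(1) a(3)]])
      (use linD(2)[OF act_lin[OF Cons.prems(1) a(1)]] act_in[OF Cons.prems(1) a(1)] a(2) in auto)
  then show ?case by simp
qed (simp add: linear_on_def)

lemma along_hom: "f \<in> rhom M N \<Longrightarrow> walk u p v \<Longrightarrow> f v (along M p x) = along N p (f u x)"
  by (induction p arbitrary: u x) (auto simp: walk_Nil walk_Cons hom_natural)

text \<open>The map along the walk from \<open>u\<close> to \<open>v\<close>, which is unique if it exists.\<close>

definition tr :: "('v, 'a, 'u) qrep \<Rightarrow> 'v \<Rightarrow> 'v \<Rightarrow> 'u \<Rightarrow> 'u" where
  "tr N u v = along N (THE p. walk u p v)"

lemma tr_eq: "walk u p v \<Longrightarrow> tr N u v = along N p"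
  unfolding tr_def using unique_walk by (metis the_equality)

lemma tr_refl: "v \<in> verts Q \<Longrightarrow> tr N v v x = x"
  using tr_eq[of v "[]" v] walk_Nil by simp

lemma tr_first: "a \<in> arcs Q \<Longrightarrow> reach (head Q a) v \<Longrightarrow> tr N (tail Q a) v x = tr N (head Q a) v (act N a x)"
  unfolding reach_def using tr_eq[of "tail Q a" "a # _" v] tr_eq[of "head Q a" _ v] walk_Cons by (metis along.simps(2))

lemma tr_last: "a \<in> arcs Q \<Longrightarrow> reach v (tail Q a) \<Longrightarrow> tr N v (head Q a) x = act N a (tr N v (tail Q a) x)"
  unfolding reach_def using tr_eq[of v "_ @ [a]" "head Q a"] tr_eq[of v _ "tail Q a"] walk_snoc by (metis along_snoc)

lemma tr_in: "N \<in> reps \<Longrightarrow> reach u v \<Longrightarrow> x \<in> space N u \<Longrightarrow> tr N u v x \<in> space N v"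
  unfolding reach_def using tr_eq along_in by metis

lemma tr_linear_on: "N \<in> reps \<Longrightarrow> reach u v \<Longrightarrow> linear_on s s (space N u) (tr N u v)"
  unfolding reach_def using tr_eq along_linear_on by metis

lemma tr_hom: "f \<in> rhom M N \<Longrightarrow> reach u v \<Longrightarrow> f v (tr M u v x) = tr N u v (f u x)"
  unfolding reach_def using tr_eq along_hom by metis

interpretation V: vector_space s by (rule vs)

text \<open>A basis of an auxiliary space inside the ambient space; each basis vector \<open>b\<close> stands for one
  indecomposable summand, which belongs to the vertex \<open>l b\<close>.\<close>

definition frame :: "'u set \<Rightarrow> ('u \<Rightarrow> 'v) \<Rightarrow> bool" where
  "frame B l \<longleftrightarrow> finite B \<and> \<not> module.dependent s B \<and> l ` B \<subseteq> verts Q"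

text \<open>The direct sum of the representations \<open>P(l b)\<close>, each of which is one-dimensional at the vertices
  reachable from \<open>l b\<close>.  As walks are unique, all structure maps are inclusions.\<close>

definition projective_on :: "'u set \<Rightarrow> ('u \<Rightarrow> 'v) \<Rightarrow> ('v, 'a, 'u) qrep" where
  "projective_on B l = \<lparr> space = \<lambda>w. module.span s {b \<in> B. reach (l b) w},
     act = \<lambda>a y. if y \<in> module.span s {b \<in> B. reach (l b) (tail Q a)} then y else 0 \<rparr>"

text \<open>The direct sum of the representations \<open>I(l b)\<close>, each of which is one-dimensional at the vertices from
  which \<open>l b\<close> is reachable.  The structure maps are coordinate projections.\<close>

definition injective_on :: "'u set \<Rightarrow> ('u \<Rightarrow> 'v) \<Rightarrow> ('v, 'a, 'u) qrep" where
  "injective_on B l = \<lparr> space = \<lambda>w. module.span s {b \<in> B. reach w (l b)},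
     act = \<lambda>a y. if y \<in> module.span s {b \<in> B. reach (tail Q a) (l b)}
       then \<Sum>b\<in>{b \<in> B. reach (head Q a) (l b)}. s (module.representation s B y b) b else 0 \<rparr>"

abbreviation coord :: "'u set \<Rightarrow> 'u \<Rightarrow> 'u \<Rightarrow> 'k" where
  "coord B b y \<equiv> module.representation s B y b"

lemma lincomb_in_span: "(\<Sum>b\<in>A. s (c b) b) \<in> module.span s A"
  by (rule V.span_sum) (rule V.span_scale[OF V.span_base])

lemma coord_basis:
  assumes "\<not> module.dependent s B" "b \<in> B"
  shows "coord B b' b = (if b' = b then 1 else 0)"
  using V.representation_basis[OF assms] by auto

lemma coord_eqI:
  assumes B: "finite B" "\<not> module.dependent s B" and x: "x \<in> module.span s B" and y: "y \<in> module.span s B"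
    and eq: "\<And>b. b \<in> B \<Longrightarrow> coord B b x = coord B b y"
  shows "x = y"
proof -
  have "x - y = 0"
    by (rule representation_eq_0[OF vs B V.span_diff[OF x y]]) (use V.representation_diff[OF B(2) y x] eq in simp)
  then show ?thesis by simp
qed

lemma coord_lincomb:
  assumes B: "finite B" "\<not> module.dependent s B" and b: "b \<in> B" and A: "A \<subseteq> B"
  shows "coord B b (\<Sum>b'\<in>A. s (c b') b') = (if b \<in> A then c b else 0)"
proof -
  have A': "finite A" using A B(1) finite_subset by blast
  have "coord B b (\<Sum>b'\<in>A. s (c b') b') = (\<Sum>b'\<in>A. c b' * coord B b b')"
    using A V.representation_sum[OF B(2), of A "\<lambda>b'. s (c b') b'"] V.representation_scale[OF B(2)] V.span_base V.span_scale
    by (simp add: subset_iff)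
  also have "\<dots> = (\<Sum>b'\<in>A. if b = b' then c b' else 0)"
    using coord_basis[OF B(2)] A by (intro sum.cong) auto
  also have "\<dots> = (if b \<in> A then c b else 0)" using A' by simp
  finally show ?thesis .
qed

lemma span_part_iff:
  assumes B: "finite B" "\<not> module.dependent s B"
  shows "y \<in> module.span s {b \<in> B. P b} \<longleftrightarrow> y \<in> module.span s B \<and> (\<forall>b\<in>B. \<not> P b \<longrightarrow> coord B b y = 0)"
proof
  assume y: "y \<in> V.span {b \<in> B. P b}"
  have sub: "{b \<in> B. P b} \<subseteq> B" by blast
  have "coord B b y = 0" if "b \<in> B" "\<not> P b" for b
  proof -
    have "V.representation B y = V.representation {b \<in> B. P b} y" by (rule V.representation_extend[OF B(2) y sub])
    then show ?thesis using V.representation_ne_zero that by fastforce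
  qed
  then show "y \<in> V.span B \<and> (\<forall>b\<in>B. \<not> P b \<longrightarrow> coord B b y = 0)" using y V.span_mono[OF sub] by blast
next
  assume y: "y \<in> V.span B \<and> (\<forall>b\<in>B. \<not> P b \<longrightarrow> coord B b y = 0)"
  have "y = (\<Sum>b\<in>B. s (coord B b y) b)"
    using V.sum_representation_eq[OF B(2) conjunct1[OF y] B(1) order_refl] by simp
  also have "\<dots> = (\<Sum>b\<in>{b \<in> B. P b}. s (coord B b y) b)"
    using y B(1) by (intro sum.mono_neutral_right) auto
  also have "\<dots> \<in> V.span {b \<in> B. P b}" by (intro V.span_sum V.span_scale V.span_base)
  finally show "y \<in> V.span {b \<in> B. P b}" .
qed

context
  fixes B :: "'u set" and l :: "'u \<Rightarrow> 'v"
  assumes fr: "frame B l"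
begin

lemma fr_fin: "finite B" and fr_ind: "\<not> module.dependent s B" and fr_verts: "b \<in> B \<Longrightarrow> l b \<in> verts Q"
  using fr unfolding frame_def by auto

lemmas coordI = coord_eqI[OF fr_fin fr_ind]

lemma space_P: "y \<in> space (projective_on B l) w \<longleftrightarrow> y \<in> module.span s B \<and> (\<forall>b\<in>B. \<not> reach (l b) w \<longrightarrow> coord B b y = 0)"
  unfolding projective_on_def using span_part_iff[OF fr_fin fr_ind] by simp

lemma space_I: "y \<in> space (injective_on B l) w \<longleftrightarrow> y \<in> module.span s B \<and> (\<forall>b\<in>B. \<not> reach w (l b) \<longrightarrow> coord B b y = 0)"
  unfolding injective_on_def using span_part_iff[OF fr_fin fr_ind] by simp

lemma basis_space_P: "b \<in> B \<Longrightarrow> reach (l b) w \<Longrightarrow> b \<in> space (projective_on B l) w"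
  by (simp add: projective_on_def V.span_base)

lemma act_P: "y \<in> space (projective_on B l) (tail Q a) \<Longrightarrow> act (projective_on B l) a y = y"
  by (simp add: projective_on_def)

lemma act_I:
  assumes "y \<in> space (injective_on B l) (tail Q a)"
  shows "act (injective_on B l) a y = (\<Sum>b\<in>{b \<in> B. reach (head Q a) (l b)}. s (coord B b y) b)"
    and "b \<in> B \<Longrightarrow> coord B b (act (injective_on B l) a y) = (if reach (head Q a) (l b) then coord B b y else 0)"
proof -
  show 1: "act (injective_on B l) a y = (\<Sum>b\<in>{b \<in> B. reach (head Q a) (l b)}. s (coord B b y) b)"
    using assms by (simp add: injective_on_def)
  show "coord B b (act (injective_on B l) a y) = (if reach (head Q a) (l b) then coord B b y else 0)" if "b \<in> B"
    unfolding 1 using coord_lincomb[OF fr_fin fr_ind that, of "{b \<in> B. reach (head Q a) (l b)}"] that by auto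
qed

lemma projective_on_reps: "projective_on B l \<in> reps"
  unfolding fd_reps_def mem_Collect_eq
proof (intro conjI ballI)
  show "fin_dim s (space (projective_on B l) w)" for w
    unfolding fin_dim_def projective_on_def using fr_fin by (intro exI[of _ "{b \<in> B. reach (l b) w}"]) simp
  fix a assume a: "a \<in> arcs Q"
  show "act (projective_on B l) a \<in> lin s (space (projective_on B l) (tail Q a)) (space (projective_on B l) (head Q a))"
    unfolding lin_iff
  proof (intro conjI allI impI)
    show "act (projective_on B l) a ` space (projective_on B l) (tail Q a) \<subseteq> space (projective_on B l) (head Q a)"
    proof (rule image_subsetI)
      fix y assume y: "y \<in> space (projective_on B l) (tail Q a)"
      then have "y \<in> space (projective_on B l) (head Q a)" using reach_trans[OF _ reach_arc[OF a]] unfolding space_P by blast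
      then show "act (projective_on B l) a y \<in> space (projective_on B l) (head Q a)" using act_P[OF y] by simp
    qed
    show "linear_on s s (space (projective_on B l) (tail Q a)) (act (projective_on B l) a)"
      by (simp add: linear_on_def projective_on_def V.span_add V.span_scale)
  qed (simp add: projective_on_def)
qed

lemma injective_on_reps: "injective_on B l \<in> reps"
  unfolding fd_reps_def mem_Collect_eq
proof (intro conjI ballI)
  show "fin_dim s (space (injective_on B l) w)" for w
    unfolding fin_dim_def injective_on_def using fr_fin by (intro exI[of _ "{b \<in> B. reach w (l b)}"]) simp
  fix a assume a: "a \<in> arcs Q"
  show "act (injective_on B l) a \<in> lin s (space (injective_on B l) (tail Q a)) (space (injective_on B l) (head Q a))"
    unfolding lin_iff
  proof (intro conjI allI impI)
    show "act (injective_on B l) a ` space (injective_on B l) (tail Q a) \<subseteq> space (injective_on B l) (head Q a)"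
    proof (rule image_subsetI)
      fix y assume y: "y \<in> space (injective_on B l) (tail Q a)"
      show "act (injective_on B l) a y \<in> space (injective_on B l) (head Q a)"
        unfolding act_I(1)[OF y] by (simp add: injective_on_def lincomb_in_span)
    qed
    show "linear_on s s (space (injective_on B l) (tail Q a)) (act (injective_on B l) a)"
    proof (rule linear_onI)
      have sub: "module.subspace s (space (injective_on B l) (tail Q a))" by (simp add: injective_on_def)
      fix y assume y: "y \<in> space (injective_on B l) (tail Q a)"
      show "act (injective_on B l) a (s c y) = s c (act (injective_on B l) a y)" for c
        using act_I(1)[OF y] act_I(1)[OF V.subspace_scale[OF sub y]] y
        by (simp add: space_I V.representation_scale[OF fr_ind] V.scale_sum_right)
      fix z assume z: "z \<in> space (injective_on B l) (tail Q a)"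
      show "act (injective_on B l) a (y + z) = act (injective_on B l) a y + act (injective_on B l) a z"
        using act_I(1)[OF y] act_I(1)[OF z] act_I(1)[OF V.subspace_add[OF sub y z]] y z
        by (simp add: space_I V.representation_add[OF fr_ind] V.scale_left_distrib sum.distrib)
    qed
  qed (simp add: injective_on_def)
qed

text \<open>With the next lemma this says \<open>Hom(P(v), N) = N\<^sub>v\<close>.\<close>

lemma hom_from_projective_on:
  assumes N: "N \<in> reps" and x: "\<And>b. b \<in> B \<Longrightarrow> x b \<in> space N (l b)"
  obtains f where "f \<in> rhom (projective_on B l) N" "\<And>b. b \<in> B \<Longrightarrow> f (l b) b = x b"
proof -
  let ?S = "\<lambda>w. {b \<in> B. reach (l b) w}"
  let ?P = "projective_on B l"
  define f where "f w y = (if w \<in> verts Q \<and> y \<in> space ?P w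
    then \<Sum>b\<in>?S w. s (coord B b y) (tr N (l b) w (x b)) else 0)" for w y
  have f: "f w y = (\<Sum>b\<in>?S w. s (coord B b y) (tr N (l b) w (x b)))" if "w \<in> verts Q" "y \<in> space ?P w" for w y
    using that by (simp add: f_def)
  have tin: "tr N (l b) w (x b) \<in> space N w" if "b \<in> ?S w" for b w
    using tr_in[OF N _ x] that by auto
  have "f \<in> rhom ?P N"
  proof (rule rhomI[OF projective_on_reps N])
    fix w assume w: "w \<in> verts Q"
    show "f w y \<in> space N w" if "y \<in> space ?P w" for y
      unfolding f[OF w that] by (intro subspace_sumD[OF vs space_subspace[OF N w]] space_scale[OF N w] tin)
    show "linear_on s s (space ?P w) (f w)"
    proof (rule linear_onI)
      fix y assume y: "y \<in> space ?P w"
      show "f w (s c y) = s c (f w y)" for c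
        using f[OF w y] f[OF w space_scale[OF projective_on_reps w y]] y
        by (simp add: space_P V.representation_scale[OF fr_ind] V.scale_sum_right)
      fix z assume z: "z \<in> space ?P w"
      show "f w (y + z) = f w y + f w z"
        using f[OF w y] f[OF w z] f[OF w space_add[OF projective_on_reps w y z]] y z
        by (simp add: space_P V.representation_add[OF fr_ind] V.scale_left_distrib sum.distrib)
    qed
  next
    fix a y assume a: "a \<in> arcs Q" and y: "y \<in> space ?P (tail Q a)"
    note e = ends_in_verts[OF a]
    have yh: "y \<in> space ?P (head Q a)" using act_in[OF projective_on_reps a y] act_P[OF y] by simp
    have sub: "?S (tail Q a) \<subseteq> ?S (head Q a)" using reach_trans[OF _ reach_arc[OF a]] by auto
    have "f (head Q a) (act ?P a y) = (\<Sum>b\<in>?S (head Q a). s (coord B b y) (tr N (l b) (head Q a) (x b)))"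
      using act_P[OF y] f[OF e(2) yh] by simp
    also have "\<dots> = (\<Sum>b\<in>?S (tail Q a). s (coord B b y) (tr N (l b) (head Q a) (x b)))"
      using y fr_fin by (intro sum.mono_neutral_right sub) (auto simp: space_P)
    also have "\<dots> = (\<Sum>b\<in>?S (tail Q a). act N a (s (coord B b y) (tr N (l b) (tail Q a) (x b))))"
      using tr_last[OF a] linear_on_scale[OF linD(2)[OF act_lin[OF N a]] tin] by (intro sum.cong) auto
    also have "\<dots> = act N a (f (tail Q a) y)"
      unfolding f[OF e(1) y]
      by (rule linear_on_sum[OF vs space_subspace[OF N e(1)] linD(2)[OF act_lin[OF N a]], symmetric])
        (intro space_scale[OF N e(1)] tin)
    finally show "f (head Q a) (act ?P a y) = act N a (f (tail Q a) y)" .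
  qed (auto simp: f_def)
  moreover have "f (l b) b = x b" if b: "b \<in> B" for b
  proof -
    have r: "reach (l b) (l b)" using reach_refl[OF fr_verts[OF b]] .
    have "f (l b) b = (\<Sum>b'\<in>?S (l b). if b' = b then x b else 0)"
      unfolding f[OF fr_verts[OF b] basis_space_P[OF b r]]
      using tr_refl[OF fr_verts[OF b]] by (intro sum.cong) (auto simp: coord_basis[OF fr_ind b])
    also have "\<dots> = x b" using b r fr_fin by simp
    finally show ?thesis .
  qed
  ultimately show thesis by (rule that)
qed

lemma hom_from_projective_on_eq_0:
  assumes N: "N \<in> reps" and f: "f \<in> rhom (projective_on B l) N" and 0: "\<And>b. b \<in> B \<Longrightarrow> f (l b) b = 0"
  shows "f = 0"
proof (intro ext)
  have along: "along (projective_on B l) p y = y" if "walk u p v" "y \<in> space (projective_on B l) u" for u v p y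
    using that
  proof (induction p arbitrary: u)
    case (Cons a p)
    then show ?case
      using act_in[OF projective_on_reps, of a y] by (auto simp: walk_Cons act_P)
  qed simp
  fix w y
  show "f w y = 0 w y"
  proof (cases "w \<in> verts Q \<and> y \<in> space (projective_on B l) w")
    case True
    then have w: "w \<in> verts Q" ..
    have "b \<in> {y \<in> space (projective_on B l) w. f w y = 0}" if b: "b \<in> B" "reach (l b) w" for b
    proof -
      obtain p where p: "walk (l b) p w" using b(2) unfolding reach_def by blast
      have "f w b = along N p (f (l b) b)"
        using along_hom[OF f p, of b] along[OF p basis_space_P[OF b(1) reach_refl[OF fr_verts[OF b(1)]]]] by simp
      also have "\<dots> = 0"
        using 0[OF b(1)] linear_on_zero[OF along_linear_on[OF N p] space_zero[OF N fr_verts[OF b(1)]]] by simp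
      finally show ?thesis using basis_space_P[OF b] by simp
    qed
    then have "V.span {b \<in> B. reach (l b) w} \<subseteq> {y \<in> space (projective_on B l) w. f w y = 0}"
      by (intro V.span_minimal subspace_kernel[OF vs space_subspace[OF projective_on_reps w] hom_linear_on[OF f w] vs]) blast
    then show ?thesis using True by (auto simp: projective_on_def)
  qed (use hom_outside'[OF f] in simp)
qed

text \<open>This is \<open>Hom(N, I(v)) = D N\<^sub>v\<close>: the \<open>b\<close>-th coordinate of the homomorphism is the given functional, pulled
  back along the walk to \<open>l b\<close>.\<close>

lemma hom_to_injective_on:
  assumes N: "N \<in> reps" and \<xi>: "\<And>b. b \<in> B \<Longrightarrow> functional_on s (space N (l b)) (\<xi> b)"
  obtains g where "g \<in> rhom N (injective_on B l)"
    "\<And>w x b. w \<in> verts Q \<Longrightarrow> x \<in> space N w \<Longrightarrow> b \<in> B \<Longrightarrow>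
      coord B b (g w x) = (if reach w (l b) then \<xi> b (tr N w (l b) x) else 0)"
proof -
  let ?S = "\<lambda>w. {b \<in> B. reach w (l b)}"
  let ?I = "injective_on B l"
  define g where "g w x = (if w \<in> verts Q \<and> x \<in> space N w then \<Sum>b\<in>?S w. s (\<xi> b (tr N w (l b) x)) b else 0)" for w x
  have g: "g w x = (\<Sum>b\<in>?S w. s (\<xi> b (tr N w (l b) x)) b)" if "w \<in> verts Q" "x \<in> space N w" for w x
    using that by (simp add: g_def)
  have gc: "coord B b (g w x) = (if reach w (l b) then \<xi> b (tr N w (l b) x) else 0)"
    if "w \<in> verts Q" "x \<in> space N w" "b \<in> B" for w x b
    unfolding g[OF that(1,2)] using coord_lincomb[OF fr_fin fr_ind that(3), of "?S w"] that(3) by auto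
  have gin: "g w x \<in> space ?I w" if "w \<in> verts Q" "x \<in> space N w" for w x
    unfolding g[OF that] by (simp add: injective_on_def lincomb_in_span)
  have lin: "functional_on s (space N w) (\<lambda>x. \<xi> b (tr N w (l b) x))" if "b \<in> ?S w" for b w
    by (rule linear_on_compose[OF tr_linear_on[OF N] \<xi>]) (use that tr_in[OF N] in auto)
  have "g \<in> rhom N ?I"
  proof (rule rhomI[OF N injective_on_reps gin])
    fix w assume w: "w \<in> verts Q"
    show "linear_on s s (space N w) (g w)"
    proof (rule linear_onI)
      fix x assume x: "x \<in> space N w"
      show "g w (s c x) = s c (g w x)" for c
        unfolding g[OF w x] g[OF w space_scale[OF N w x]] V.scale_sum_right
        using linear_on_scale[OF lin x] by (intro sum.cong) auto
      fix y assume y: "y \<in> space N w"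
      show "g w (x + y) = g w x + g w y"
        unfolding g[OF w x] g[OF w y] g[OF w space_add[OF N w x y]] sum.distrib[symmetric]
        using linear_on_add[OF lin x y] by (intro sum.cong) (auto simp: V.scale_left_distrib)
    qed
  next
    fix a x assume a: "a \<in> arcs Q" and x: "x \<in> space N (tail Q a)"
    note e = ends_in_verts[OF a]
    note ax = act_in[OF N a x]
    show "g (head Q a) (act N a x) = act ?I a (g (tail Q a) x)"
    proof (rule coordI)
      show "g (head Q a) (act N a x) \<in> V.span B" using gin[OF e(2) ax] by (simp add: space_I)
      show "act ?I a (g (tail Q a) x) \<in> V.span B"
        using act_in[OF injective_on_reps a gin[OF e(1) x]] by (simp add: space_I)
      fix b assume b: "b \<in> B"
      show "coord B b (g (head Q a) (act N a x)) = coord B b (act ?I a (g (tail Q a) x))"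
        unfolding gc[OF e(2) ax b] act_I(2)[OF gin[OF e(1) x] b] gc[OF e(1) x b]
        using tr_first[OF a] reach_trans[OF reach_arc[OF a]] by auto
    qed
  qed (auto simp: g_def)
  then show thesis using that gc by blast
qed

lemma coord_along_injective_on:
  assumes "walk u p v" "y \<in> space (injective_on B l) u" "b \<in> B" "reach v (l b)"
  shows "coord B b (along (injective_on B l) p y) = coord B b y"
  using assms(1,2)
proof (induction p arbitrary: u y)
  case (Cons a p)
  then have a: "a \<in> arcs Q" "tail Q a = u" "walk (head Q a) p v" by (auto simp: walk_Cons)
  have y: "y \<in> space (injective_on B l) (tail Q a)" using Cons.prems(2) a(2) by simp
  have "reach (head Q a) (l b)" using a(3) reach_trans[OF _ assms(4)] unfolding reach_def by blast
  then show ?case using Cons.IH[OF a(3) act_in[OF injective_on_reps a(1) y]] act_I(2)[OF y assms(3)] by simp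
qed simp

lemma coord_tr_injective_on:
  "reach u v \<Longrightarrow> y \<in> space (injective_on B l) u \<Longrightarrow> b \<in> B \<Longrightarrow> reach v (l b) \<Longrightarrow>
    coord B b (tr (injective_on B l) u v y) = coord B b y"
  using coord_along_injective_on tr_eq unfolding reach_def[of u] by metis

text \<open>Under the identifications of \<open>Hom(P(v), -)\<close> and \<open>Hom(-, I(v))\<close> with values and functionals at \<open>v\<close>,
  \<open>frame_trace (g \<circ>\<circ> f)\<close> becomes the sum of the values of the functionals that belong to \<open>g\<close> at the vectors
  that belong to \<open>f\<close>.  This pairing is visibly perfect.\<close>

definition frame_trace :: "('v \<Rightarrow> 'u \<Rightarrow> 'u) \<Rightarrow> 'k" where
  "frame_trace h = (\<Sum>b\<in>B. coord B b (h (l b) b))"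

lemma frame_nakayama: "nakayama (projective_on B l) (injective_on B l) frame_trace"
  unfolding nakayama_def
proof (intro conjI ballI impI projective_on_reps injective_on_reps)
  let ?P = "projective_on B l" and ?I = "injective_on B l"
  have b: "b \<in> space ?P (l b)" if "b \<in> B" for b using basis_space_P[OF that reach_refl[OF fr_verts[OF that]]] .
  have spanI: "y \<in> V.span B" if "y \<in> space ?I w" for y w using that by (simp add: space_I)
  show "functional_on (scale_fam s) (rhom ?P ?I) frame_trace"
  proof (rule linear_onI)
    fix h assume h: "h \<in> rhom ?P ?I"
    note hb = spanI[OF hom_in[OF h fr_verts b]]
    show "frame_trace (scale_fam s c h) = c * frame_trace h" for c
      using hb by (simp add: frame_trace_def scale_fam_def V.representation_scale[OF fr_ind] sum_distrib_left)
    fix h' assume h': "h' \<in> rhom ?P ?I"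
    note hb' = spanI[OF hom_in[OF h' fr_verts b]]
    show "frame_trace (h + h') = frame_trace h + frame_trace h'"
      using hb hb' by (simp add: frame_trace_def V.representation_add[OF fr_ind] sum.distrib)
  qed
  fix N assume N: "N \<in> reps"
  show "f = 0" if f: "f \<in> rhom ?P N" "\<forall>g\<in>rhom N ?I. frame_trace (g \<circ>\<circ> f) = 0" for f
  proof (rule hom_from_projective_on_eq_0[OF N f(1)], rule ccontr)
    fix b0 assume b0: "b0 \<in> B" and ne: "f (l b0) b0 \<noteq> 0"
    obtain \<zeta> where \<zeta>: "functional_on s UNIV \<zeta>" "\<zeta> (f (l b0) b0) = 1" using functional_nonzero_at[OF vs ne] .
    define \<xi> where "\<xi> b = (if b = b0 then \<zeta> else (\<lambda>_. 0))" for b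
    have "functional_on s (space N (l b)) (\<xi> b)" for b
      using linear_on_subset[OF \<zeta>(1), of "space N (l b)"] by (auto simp: \<xi>_def linear_on_def)
    then obtain g where g: "g \<in> rhom N ?I" "\<And>w x b. w \<in> verts Q \<Longrightarrow> x \<in> space N w \<Longrightarrow> b \<in> B \<Longrightarrow>
      coord B b (g w x) = (if reach w (l b) then \<xi> b (tr N w (l b) x) else 0)"
      using hom_to_injective_on[OF N] by blast
    have "frame_trace (g \<circ>\<circ> f) = (\<Sum>b\<in>B. if b = b0 then 1 else 0)"
      unfolding frame_trace_def
    proof (rule sum.cong[OF refl])
      fix b' assume b': "b' \<in> B"
      show "coord B b' ((g \<circ>\<circ> f) (l b') b') = (if b' = b0 then 1 else 0)"
        using g(2)[OF fr_verts[OF b'] hom_in[OF f(1) fr_verts[OF b'] b[OF b']] b'] reach_refl[OF fr_verts[OF b']]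
          tr_refl[OF fr_verts[OF b']] \<zeta>(2) by (simp add: \<xi>_def)
    qed
    then have "frame_trace (g \<circ>\<circ> f) = 1" using b0 fr_fin by simp
    then show False using f(2) g(1) by simp
  qed
  show "g = 0" if g: "g \<in> rhom N ?I" "\<forall>f\<in>rhom ?P N. frame_trace (g \<circ>\<circ> f) = 0" for g
  proof (intro ext)
    have key: "coord B b0 (g (l b0) x) = 0" if b0: "b0 \<in> B" and x: "x \<in> space N (l b0)" for b0 x
    proof -
      have "(if b = b0 then x else 0) \<in> space N (l b)" if "b \<in> B" for b
        using x space_zero[OF N fr_verts[OF that]] by simp
      then obtain f where f: "f \<in> rhom ?P N" "\<And>b. b \<in> B \<Longrightarrow> f (l b) b = (if b = b0 then x else 0)"
        using hom_from_projective_on[OF N, of "\<lambda>b. if b = b0 then x else 0"] by blast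
      have "frame_trace (g \<circ>\<circ> f) = (\<Sum>b\<in>B. if b = b0 then coord B b0 (g (l b0) x) else 0)"
        unfolding frame_trace_def
        using f(2) hom_zero[OF g(1) fr_verts] by (intro sum.cong) (auto simp: V.representation_zero)
      also have "\<dots> = coord B b0 (g (l b0) x)" using b0 fr_fin by simp
      finally show ?thesis using g(2) f(1) by simp
    qed
    fix w x
    show "g w x = 0 w x"
    proof (cases "w \<in> verts Q \<and> x \<in> space N w")
      case True
      note gx = hom_in[OF g(1) conjunct1[OF True] conjunct2[OF True]]
      have "coord B b (g w x) = 0" if b': "b \<in> B" for b
      proof (cases "reach w (l b)")
        case r: True
        have "coord B b (g w x) = coord B b (tr ?I w (l b) (g w x))"
          using coord_tr_injective_on[OF r gx b' reach_refl[OF fr_verts[OF b']]] by simp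
        also have "\<dots> = coord B b (g (l b) (tr N w (l b) x))" using tr_hom[OF g(1) r] by simp
        also have "\<dots> = 0" using key[OF b' tr_in[OF N r]] True by simp
        finally show ?thesis .
      next
        case False
        then show ?thesis using gx b' by (simp add: space_I)
      qed
      then show ?thesis using representation_eq_0[OF vs fr_fin fr_ind spanI[OF gx]] by simp
    qed (use hom_outside'[OF g(1)] in simp)
  qed
qed

end

end

section \<open>Enough projectives and injective coresolutions\<close>

context tree_reps
begin

interpretation V: vector_space s by (rule vs)

lemma bases_exist:
  assumes "M \<in> reps"
  obtains D where "\<And>v. v \<in> verts Q \<Longrightarrow> finite (D v)" "\<And>v. v \<in> verts Q \<Longrightarrow> \<not> module.dependent s (D v)"
    "\<And>v. v \<in> verts Q \<Longrightarrow> module.span s (D v) = space M v"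
proof -
  have "\<exists>B. finite B \<and> \<not> module.dependent s B \<and> V.span B = space M v" if "v \<in> verts Q" for v
    using fin_dim_basis[OF vs space_fin_dim[OF assms that]] by metis
  then obtain D where "\<And>v. v \<in> verts Q \<Longrightarrow> finite (D v) \<and> \<not> module.dependent s (D v) \<and> V.span (D v) = space M v"
    by metis
  then show thesis using that[of D] by blast
qed

lemma frame_exists:
  fixes T :: "'t set"
  assumes "finite T" "l ` T \<subseteq> verts Q"
  obtains B m e where "frame B m" "bij_betw e T B" "\<And>t. t \<in> T \<Longrightarrow> m (e t) = l t"
proof -
  obtain e where e: "inj_on e T" "\<not> module.dependent s (e ` T)"
    using independent_copy[OF vs infinite_ambient assms(1)] by blast
  let ?m = "\<lambda>b. l (the_inv_into T e b)"
  have m: "?m (e t) = l t" if "t \<in> T" for t using the_inv_into_f_f[OF e(1) that] by simp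
  have "frame (e ` T) ?m" unfolding frame_def using assms e(2) m by auto
  then show thesis using that[of "e ` T" ?m e] e(1) m by (simp add: bij_betw_def)
qed

text \<open>One basis vector for every element \<open>d\<close> of a basis \<open>D v\<close> of \<open>M\<^sub>v\<close>.  The map \<open>j\<close> embeds \<open>M\<close> into the sum of
  the \<open>I(v) \<otimes> M\<^sub>v\<close>: it sends \<open>x\<close> to the family of its images under the maps along all walks.\<close>

lemma standard_frame:
  assumes M: "M \<in> reps"
  obtains D B l e j where "\<And>v. v \<in> verts Q \<Longrightarrow> finite (D v)" "\<And>v. v \<in> verts Q \<Longrightarrow> \<not> module.dependent s (D v)"
    "\<And>v. v \<in> verts Q \<Longrightarrow> module.span s (D v) = space M v"
    "frame B l" "bij_betw e (Sigma (verts Q) D) B" "\<And>v d. v \<in> verts Q \<Longrightarrow> d \<in> D v \<Longrightarrow> l (e (v, d)) = v"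
    "j \<in> rhom M (injective_on B l)"
    "\<And>w x v d. w \<in> verts Q \<Longrightarrow> x \<in> space M w \<Longrightarrow> v \<in> verts Q \<Longrightarrow> d \<in> D v \<Longrightarrow>
       coord B (e (v, d)) (j w x) = (if reach w v then coord (D v) d (tr M w v x) else 0)"
proof -
  obtain D where D: "\<And>v. v \<in> verts Q \<Longrightarrow> finite (D v)" "\<And>v. v \<in> verts Q \<Longrightarrow> \<not> module.dependent s (D v)"
    "\<And>v. v \<in> verts Q \<Longrightarrow> V.span (D v) = space M v" using bases_exist[OF M] by blast
  let ?T = "Sigma (verts Q) D"
  have "finite ?T" using D(1) finite_verts by simp
  then obtain B l e where B: "frame B l" "bij_betw e ?T B" "\<And>t. t \<in> ?T \<Longrightarrow> l (e t) = fst t"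
    using frame_exists[of ?T fst] by (metis (no_types, lifting) SigmaE fst_conv image_subsetI)
  have le: "l (e (v, d)) = v" and eB: "e (v, d) \<in> B" if "v \<in> verts Q" "d \<in> D v" for v d
    using B(3)[of "(v, d)"] bij_betwE[OF B(2)] that by auto
  define i where "i = the_inv_into ?T e"
  have i: "i (e (v, d)) = (v, d)" if "v \<in> verts Q" "d \<in> D v" for v d
    using the_inv_into_f_f[OF bij_betw_imp_inj_on[OF B(2)], of "(v, d)"] that by (simp add: i_def)
  have Be: "\<exists>v\<in>verts Q. \<exists>d\<in>D v. b = e (v, d)" if "b \<in> B" for b
    using bij_betw_imp_surj_on[OF B(2)] that by auto
  have "functional_on s (space M (l b)) (coord (D (fst (i b))) (snd (i b)))" if b: "b \<in> B" for b
  proof -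
    obtain v d where v: "v \<in> verts Q" "d \<in> D v" "b = e (v, d)" using Be[OF b] by blast
    show ?thesis using representation_linear_on[OF vs D(2)[OF v(1)], of d] D(3)[OF v(1)] i[OF v(1,2)] le[OF v(1,2)] v(3) by simp
  qed
  then obtain j where j: "j \<in> rhom M (injective_on B l)"
    "\<And>w x b. w \<in> verts Q \<Longrightarrow> x \<in> space M w \<Longrightarrow> b \<in> B \<Longrightarrow>
      coord B b (j w x) = (if reach w (l b) then coord (D (fst (i b))) (snd (i b)) (tr M w (l b) x) else 0)"
    using hom_to_injective_on[OF B(1) M, of "\<lambda>b. coord (D (fst (i b))) (snd (i b))"] by blast
  have "coord B (e (v, d)) (j w x) = (if reach w v then coord (D v) d (tr M w v x) else 0)"
    if "w \<in> verts Q" "x \<in> space M w" "v \<in> verts Q" "d \<in> D v" for w x v d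
    using j(2)[OF that(1,2) eB[OF that(3,4)]] i[OF that(3,4)] le[OF that(3,4)] by simp
  then show thesis using that[OF D B(1,2) le j(1)] by blast
qed

lemma enough_projectives:
  assumes M: "M \<in> reps"
  obtains R I u \<pi> where "nakayama R I u" "\<pi> \<in> rhom R M" "rep_epi Q R M \<pi>"
proof -
  obtain D B l e j where fin: "\<And>v. v \<in> verts Q \<Longrightarrow> finite (D v)" and ind: "\<And>v. v \<in> verts Q \<Longrightarrow> \<not> module.dependent s (D v)"
    and D: "\<And>v. v \<in> verts Q \<Longrightarrow> module.span s (D v) = space M v"
    and B: "frame B l" and e: "bij_betw e (Sigma (verts Q) D) B"
    and le: "\<And>v d. v \<in> verts Q \<Longrightarrow> d \<in> D v \<Longrightarrow> l (e (v, d)) = v"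
    and j: "j \<in> rhom M (injective_on B l)"
    and jc: "\<And>w x v d. w \<in> verts Q \<Longrightarrow> x \<in> space M w \<Longrightarrow> v \<in> verts Q \<Longrightarrow> d \<in> D v \<Longrightarrow>
       coord B (e (v, d)) (j w x) = (if reach w v then coord (D v) d (tr M w v x) else 0)"
    by (rule standard_frame[OF M]) blast
  define x where "x b = snd (the_inv_into (Sigma (verts Q) D) e b)" for b
  have x: "x (e (v, d)) = d" if "v \<in> verts Q" "d \<in> D v" for v d
    using the_inv_into_f_f[OF bij_betw_imp_inj_on[OF e], of "(v, d)"] that by (simp add: x_def)
  have eB: "e (v, d) \<in> B" if "v \<in> verts Q" "d \<in> D v" for v d using bij_betwE[OF e] that by auto
  have "x b \<in> space M (l b)" if b: "b \<in> B" for b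
  proof -
    obtain v d where "v \<in> verts Q" "d \<in> D v" "b = e (v, d)" using bij_betw_imp_surj_on[OF e] b by auto
    then show ?thesis using x le D[of v] V.span_base[of d "D v"] by simp
  qed
  then obtain \<pi> where \<pi>: "\<pi> \<in> rhom (projective_on B l) M" "\<And>b. b \<in> B \<Longrightarrow> \<pi> (l b) b = x b"
    using hom_from_projective_on[OF B M, of x] by blast
  have "\<pi> v ` space (projective_on B l) v = space M v" if v: "v \<in> verts Q" for v
  proof
    show "\<pi> v ` space (projective_on B l) v \<subseteq> space M v" using hom_in[OF \<pi>(1) v] by blast
    have "D v \<subseteq> \<pi> v ` space (projective_on B l) v"
    proof
      fix d assume d: "d \<in> D v"
      have "e (v, d) \<in> space (projective_on B l) v"
        using basis_space_P[OF B eB[OF v d]] le[OF v d] reach_refl[OF v] by simp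
      moreover have "d = \<pi> v (e (v, d))" using \<pi>(2)[OF eB[OF v d]] le[OF v d] x[OF v d] by simp
      ultimately show "d \<in> \<pi> v ` space (projective_on B l) v" by (rule rev_image_eqI)
    qed
    then have "V.span (D v) \<subseteq> \<pi> v ` space (projective_on B l) v"
      by (rule V.span_minimal)
        (rule subspace_linear_image[OF vs vs space_subspace[OF projective_on_reps[OF B] v] hom_linear_on[OF \<pi>(1) v]])
    then show "space M v \<subseteq> \<pi> v ` space (projective_on B l) v" using D[OF v] by simp
  qed
  then have "rep_epi Q (projective_on B l) M \<pi>" unfolding rep_epi_def by blast
  then show thesis using that frame_nakayama[OF B] \<pi>(1) by blast
qed

text \<open>The standard coresolution \<open>0 \<rightarrow> M \<rightarrow> \<Oplus>\<^sub>v I(v) \<otimes> M\<^sub>v \<rightarrow> \<Oplus>\<^sub>a I(tail a) \<otimes> M\<^bsub>head a\<^esub> \<rightarrow> 0\<close>.  At a vertex \<open>w\<close>, an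
  element of the middle term is a family of \<open>y\<^sub>v \<in> M\<^sub>v\<close> for the vertices \<open>v\<close> reachable from \<open>w\<close>, and \<open>c\<close>
  measures for every arc \<open>a\<close> the defect \<open>y\<^bsub>head a\<^esub> - M\<^sub>a y\<^bsub>tail a\<^esub>\<close>.  The defects vanish if and only if the
  family consists of the images of \<open>y\<^sub>w\<close>, which is exactness in the middle.  To see that \<open>c\<close> is onto, take
  a basis element \<open>d\<close> of \<open>M\<^bsub>head a\<^esub>\<close>: as walks are unique, the family of the images of \<open>d\<close>, extended by zero to
  the vertices not reachable from \<open>head a\<close>, has the single defect \<open>d\<close> at the arc \<open>a\<close>.\<close>

lemma injective_coresolution_exists:
  assumes M: "M \<in> reps"
  obtains R0 I0 u0 R1 I1 u1 j c where "nakayama R0 I0 u0" "nakayama R1 I1 u1"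
    "j \<in> rhom M I0" "rep_mono Q M j" "c \<in> rhom I0 I1" "rep_epi Q I0 I1 c"
    "\<And>v. v \<in> verts Q \<Longrightarrow> j v ` space M v = {y \<in> space I0 v. c v y = 0}"
proof -
  obtain D B l e j where fin: "\<And>v. v \<in> verts Q \<Longrightarrow> finite (D v)" and ind: "\<And>v. v \<in> verts Q \<Longrightarrow> \<not> module.dependent s (D v)"
    and D: "\<And>v. v \<in> verts Q \<Longrightarrow> module.span s (D v) = space M v"
    and B: "frame B l" and e: "bij_betw e (Sigma (verts Q) D) B"
    and le: "\<And>v d. v \<in> verts Q \<Longrightarrow> d \<in> D v \<Longrightarrow> l (e (v, d)) = v"
    and j: "j \<in> rhom M (injective_on B l)"
    and jc: "\<And>w x v d. w \<in> verts Q \<Longrightarrow> x \<in> space M w \<Longrightarrow> v \<in> verts Q \<Longrightarrow> d \<in> D v \<Longrightarrow>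
       coord B (e (v, d)) (j w x) = (if reach w v then coord (D v) d (tr M w v x) else 0)"
    by (rule standard_frame[OF M]) blast
  let ?I = "injective_on B l"
  note I = injective_on_reps[OF B]
  have Bfin: "finite B" and Bind: "\<not> module.dependent s B" using B unfolding frame_def by auto
  have eB: "e (v, d) \<in> B" if "v \<in> verts Q" "d \<in> D v" for v d using bij_betwE[OF e] that by auto
  have Be: "\<exists>v\<in>verts Q. \<exists>d\<in>D v. b = e (v, d)" if "b \<in> B" for b
    using bij_betw_imp_surj_on[OF e] that by auto
  have spanI: "y \<in> V.span B" if "y \<in> space ?I w" for y w using that by (simp add: space_I[OF B])
  \<comment> \<open>\<open>comp v y\<close> is the entry \<open>y\<^sub>v\<close> of the family that \<open>y\<close> describes\<close>
  define comp where "comp v y = (\<Sum>d\<in>D v. s (coord B (e (v, d)) y) d)" for v y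
  have comp_in: "comp v y \<in> space M v" if "v \<in> verts Q" for v y
    unfolding comp_def D[OF that, symmetric] by (rule lincomb_in_span)
  have comp_coord: "coord (D v) d (comp v y) = coord B (e (v, d)) y" if "v \<in> verts Q" "d \<in> D v" for v d y
    unfolding comp_def using coord_lincomb[OF fin[OF that(1)] ind[OF that(1)] that(2) order_refl] that(2) by simp
  have comp_eqI: "comp v y = z" if v: "v \<in> verts Q" and z: "z \<in> space M v"
    and eq: "\<And>d. d \<in> D v \<Longrightarrow> coord B (e (v, d)) y = coord (D v) d z" for v y z
    by (rule coord_eqI[OF fin[OF v] ind[OF v]]) (use comp_in[OF v] z D[OF v] eq comp_coord[OF v] in auto)
  have comp_lin: "linear_on s s (V.span B) (comp v)" if v: "v \<in> verts Q" for v
  proof (rule linear_onI)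
    fix y assume y: "y \<in> V.span B"
    show "comp v (s c y) = s c (comp v y)" for c
      by (simp add: comp_def V.representation_scale[OF Bind y] V.scale_sum_right)
    fix z assume z: "z \<in> V.span B"
    show "comp v (y + z) = comp v y + comp v z"
      by (simp add: comp_def V.representation_add[OF Bind z y] V.representation_add[OF Bind y z]
          V.scale_left_distrib sum.distrib)
  qed
  have comp_j: "comp v (j w x) = (if reach w v then tr M w v x else 0)"
    if "w \<in> verts Q" "x \<in> space M w" "v \<in> verts Q" for v w x
    by (rule comp_eqI[OF that(3)]) (use tr_in[OF M _ that(2), of v] space_zero[OF M that(3)] jc[OF that(1,2,3)] in
        \<open>auto simp: V.representation_zero\<close>)
  \<comment> \<open>the second injective sits at the tails of the arcs\<close>
  let ?T = "Sigma (arcs Q) (\<lambda>a. D (head Q a))"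
  have "finite ?T" using fin finite_arcs ends_in_verts by simp
  moreover have "(\<lambda>(a, d). tail Q a) ` ?T \<subseteq> verts Q" using ends_in_verts by auto
  ultimately obtain B' l' e' where B': "frame B' l'" "bij_betw e' ?T B'" "\<And>t. t \<in> ?T \<Longrightarrow> l' (e' t) = (\<lambda>(a, d). tail Q a) t"
    using frame_exists by blast
  let ?I' = "injective_on B' l'"
  note I' = injective_on_reps[OF B'(1)]
  have B'fin: "finite B'" and B'ind: "\<not> module.dependent s B'" using B'(1) unfolding frame_def by auto
  have le': "l' (e' (a, d)) = tail Q a" and eB': "e' (a, d) \<in> B'" if "a \<in> arcs Q" "d \<in> D (head Q a)" for a d
    using B'(3)[of "(a, d)"] bij_betwE[OF B'(2)] that by auto
  have Be': "\<exists>a\<in>arcs Q. \<exists>d\<in>D (head Q a). b = e' (a, d)" if "b \<in> B'" for b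
    using bij_betw_imp_surj_on[OF B'(2)] that by auto
  define i' where "i' = the_inv_into ?T e'"
  have i': "i' (e' (a, d)) = (a, d)" if "a \<in> arcs Q" "d \<in> D (head Q a)" for a d
    using the_inv_into_f_f[OF bij_betw_imp_inj_on[OF B'(2)], of "(a, d)"] that by (simp add: i'_def)
  \<comment> \<open>the defect of the family \<open>y\<close> at the arc \<open>a\<close>\<close>
  define \<delta> where "\<delta> a y = comp (head Q a) y - act M a (comp (tail Q a) y)" for a y
  have \<delta>_in: "\<delta> a y \<in> space M (head Q a)" if "a \<in> arcs Q" for a y
    unfolding \<delta>_def using space_diff[OF M ends_in_verts(2)[OF that] comp_in[OF ends_in_verts(2)[OF that]]
      act_in[OF M that comp_in[OF ends_in_verts(1)[OF that]]]] .
  have \<delta>_lin: "linear_on s s (V.span B) (\<delta> a)" if a: "a \<in> arcs Q" for a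
  proof -
    note ea = ends_in_verts[OF a]
    have "linear_on s s (V.span B) (\<lambda>y. act M a (comp (tail Q a) y))"
      by (rule linear_on_compose[OF comp_lin[OF ea(1)] linD(2)[OF act_lin[OF M a]]]) (use comp_in[OF ea(1)] in blast)
    then show ?thesis
      using comp_lin[OF ea(2)] unfolding \<delta>_def linear_on_def by (auto simp: V.scale_right_diff_distrib)
  qed
  have "functional_on s (space ?I (l' b)) (\<lambda>y. coord (D (head Q (fst (i' b)))) (snd (i' b)) (\<delta> (fst (i' b)) y))" if b: "b \<in> B'" for b
  proof -
    obtain a d where a: "a \<in> arcs Q" "d \<in> D (head Q a)" "b = e' (a, d)" using Be'[OF b] by blast
    have "functional_on s (V.span B) (\<lambda>y. coord (D (head Q a)) d (\<delta> a y))"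
      by (rule linear_on_compose[OF \<delta>_lin[OF a(1)] representation_linear_on[OF vs ind[OF ends_in_verts(2)[OF a(1)]]]])
        (use \<delta>_in[OF a(1)] D[OF ends_in_verts(2)[OF a(1)]] in blast)
    then have "functional_on s (space ?I (l' b)) (\<lambda>y. coord (D (head Q a)) d (\<delta> a y))"
      by (rule linear_on_subset) (use spanI in blast)
    then show ?thesis using i'[OF a(1,2)] a(3) by simp
  qed
  then obtain c where c: "c \<in> rhom ?I ?I'"
    "\<And>w y b. w \<in> verts Q \<Longrightarrow> y \<in> space ?I w \<Longrightarrow> b \<in> B' \<Longrightarrow> coord B' b (c w y) =
      (if reach w (l' b) then coord (D (head Q (fst (i' b)))) (snd (i' b)) (\<delta> (fst (i' b)) (tr ?I w (l' b) y)) else 0)"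
    using hom_to_injective_on[OF B'(1) I, of "\<lambda>b y. coord (D (head Q (fst (i' b)))) (snd (i' b)) (\<delta> (fst (i' b)) y)"] by blast
  have comp_tr: "comp v (tr ?I w w' y) = comp v y"
    if "reach w w'" "reach w' v" "y \<in> space ?I w" for v w w' y
  proof -
    have v: "v \<in> verts Q" using reach_verts(2)[OF that(2)] .
    show ?thesis unfolding comp_def
      by (rule sum.cong[OF refl]) (use coord_tr_injective_on[OF B that(1,3) eB[OF v]] le[OF v] that(2) in simp)
  qed
  have cc: "coord B' (e' (a, d)) (c w y) = (if reach w (tail Q a) then coord (D (head Q a)) d (\<delta> a y) else 0)"
    if "w \<in> verts Q" "y \<in> space ?I w" "a \<in> arcs Q" "d \<in> D (head Q a)" for w y a d
  proof -
    have "\<delta> a (tr ?I w (tail Q a) y) = \<delta> a y" if "reach w (tail Q a)"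
      unfolding \<delta>_def
      using comp_tr[OF that reach_arc[OF \<open>a \<in> arcs Q\<close>] \<open>y \<in> space ?I w\<close>]
        comp_tr[OF that reach_refl[OF ends_in_verts(1)[OF \<open>a \<in> arcs Q\<close>]] \<open>y \<in> space ?I w\<close>] by simp
    then show ?thesis using c(2)[OF that(1,2) eB'[OF that(3,4)]] i'[OF that(3,4)] le'[OF that(3,4)] by simp
  qed
  have mono: "rep_mono Q M j"
    unfolding mono_iff[OF M j]
  proof (intro ballI impI)
    fix v x assume v: "v \<in> verts Q" and x: "x \<in> space M v" "j v x = 0"
    have "comp v (j v x) = x" using comp_j[OF v x(1) v] reach_refl[OF v] tr_refl[OF v] by simp
    then show "x = 0" using x(2) linear_on_zero[OF comp_lin[OF v] V.span_zero] by simp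
  qed
  have exact: "j w ` space M w = {y \<in> space ?I w. c w y = 0}" if w: "w \<in> verts Q" for w
  proof (intro set_eqI iffI)
    fix y assume "y \<in> j w ` space M w"
    then obtain x where x: "x \<in> space M w" "y = j w x" by blast
    have y: "y \<in> space ?I w" using hom_in[OF j w x(1)] x(2) by simp
    have "c w y = 0"
    proof (rule representation_eq_0[OF vs B'fin B'ind])
      show "c w y \<in> V.span B'" using hom_in[OF c(1) w y] by (simp add: space_I[OF B'(1)])
      fix b assume "b \<in> B'"
      then obtain a d where a: "a \<in> arcs Q" "d \<in> D (head Q a)" "b = e' (a, d)" using Be' by blast
      have "\<delta> a y = 0" if r: "reach w (tail Q a)"
        unfolding \<delta>_def x(2)
        using comp_j[OF w x(1)] ends_in_verts[OF a(1)] r reach_trans[OF r reach_arc[OF a(1)]] tr_last[OF a(1) r] by simp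
      then show "coord B' b (c w y) = 0" using cc[OF w y a(1,2)] a(3) by (simp add: V.representation_zero)
    qed
    then show "y \<in> {y \<in> space ?I w. c w y = 0}" using y by simp
  next
    fix y assume "y \<in> {y \<in> space ?I w. c w y = 0}"
    then have y: "y \<in> space ?I w" "c w y = 0" by auto
    have \<delta>0: "\<delta> a y = 0" if a: "a \<in> arcs Q" "reach w (tail Q a)" for a
    proof (rule representation_eq_0[OF vs fin ind])
      show "head Q a \<in> verts Q" "head Q a \<in> verts Q" using ends_in_verts[OF a(1)] by auto
      show "\<delta> a y \<in> V.span (D (head Q a))" using \<delta>_in[OF a(1)] D[OF ends_in_verts(2)[OF a(1)]] by simp
      show "coord (D (head Q a)) d (\<delta> a y) = 0" if "d \<in> D (head Q a)" for d
        using cc[OF w y(1) a(1) that] a(2) y(2) by (simp add: V.representation_zero)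
    qed
    have along: "comp v y = along M p (comp w y)" if "walk w p v" for p v
      using that
    proof (induction p arbitrary: v rule: rev_induct)
      case Nil
      then show ?case by (simp add: walk_Nil)
    next
      case (snoc a p)
      then have a: "walk w p (tail Q a)" "a \<in> arcs Q" "head Q a = v" by (auto simp: walk_snoc)
      then have "\<delta> a y = 0" using \<delta>0 unfolding reach_def by blast
      then show ?case using snoc.IH[OF a(1)] a(3) by (simp add: \<delta>_def along_snoc)
    qed
    have "y = j w (comp w y)"
    proof (rule coord_eqI[OF Bfin Bind spanI[OF y(1)] spanI[OF hom_in[OF j w comp_in[OF w]]]])
      fix b assume "b \<in> B"
      then obtain v d where v: "v \<in> verts Q" "d \<in> D v" "b = e (v, d)" using Be by blast
      have "coord B b y = (if reach w v then coord (D v) d (tr M w v (comp w y)) else 0)"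
      proof (cases "reach w v")
        case True
        then obtain p where p: "walk w p v" unfolding reach_def by blast
        show ?thesis using True along[OF p] tr_eq[OF p] comp_coord[OF v(1,2), of y] v(3) by simp
      next
        case False
        then show ?thesis using y(1) eB[OF v(1,2)] le[OF v(1,2)] v(3) by (simp add: space_I[OF B])
      qed
      then show "coord B b y = coord B b (j w (comp w y))" using jc[OF w comp_in[OF w] v(1,2)] v(3) by simp
    qed
    then show "y \<in> j w ` space M w" using comp_in[OF w] by blast
  qed
  have no_cycle: "\<not> reach (head Q a) (tail Q a)" if a: "a \<in> arcs Q" for a
  proof
    assume "reach (head Q a) (tail Q a)"
    then obtain p where "walk (head Q a) p (tail Q a)" unfolding reach_def by blast
    then have "walk (tail Q a) (a # p) (tail Q a)" using a by (simp add: walk_Cons)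
    moreover have "walk (tail Q a) [] (tail Q a)" using ends_in_verts(1)[OF a] by (simp add: walk_Nil)
    ultimately show False using unique_walk by blast
  qed
  have same_arc: "a' = a" if a: "a \<in> arcs Q" and a': "a' \<in> arcs Q" and w: "reach w (tail Q a)" "reach w (tail Q a')"
    and r: "reach (head Q a) (head Q a')" "\<not> reach (head Q a) (tail Q a')" for a a' w
  proof -
    obtain p p' q where p: "walk w p (tail Q a)" "walk w p' (tail Q a')" "walk (head Q a) q (head Q a')"
      using w r(1) unfolding reach_def by blast
    have "walk (tail Q a) (a # q) (head Q a')" using a p(3) by (simp add: walk_Cons)
    then have 1: "walk w (p @ a # q) (head Q a')" using walk_append[OF p(1)] by blast
    have 2: "walk w (p' @ [a']) (head Q a')" using p(2) a' by (simp add: walk_snoc)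
    have eq: "p @ a # q = p' @ [a']" using unique_walk[OF 1 2] .
    show ?thesis
    proof (cases q rule: rev_cases)
      case Nil
      then show ?thesis using eq by simp
    next
      case (snoc q' a'')
      then have "a'' = a'" using eq by simp
      then have "walk (head Q a) q' (tail Q a')" using p(3) snoc by (simp add: walk_snoc)
      then show ?thesis using r(2) unfolding reach_def by blast
    qed
  qed
  have epi: "rep_epi Q ?I ?I' c"
    unfolding rep_epi_def
  proof (intro ballI)
    fix w assume w: "w \<in> verts Q"
    have "{b \<in> B'. reach w (l' b)} \<subseteq> c w ` space ?I w"
    proof
      fix b assume b: "b \<in> {b \<in> B'. reach w (l' b)}"
      then obtain a d where a: "a \<in> arcs Q" "d \<in> D (head Q a)" "b = e' (a, d)" using Be' by blast
      then have wa: "reach w (tail Q a)" using b le' by simp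
      note h = ends_in_verts(2)[OF a(1)]
      have d: "d \<in> space M (head Q a)" using a(2) D[OF h] V.span_base by blast
      let ?y = "j (head Q a) d"
      have "?y \<in> space ?I (head Q a)" using hom_in[OF j h d] .
      then have y: "?y \<in> space ?I w"
        using reach_trans[OF reach_trans[OF wa reach_arc[OF a(1)]]] unfolding space_I[OF B] by blast
      have comp_y: "comp v ?y = (if reach (head Q a) v then tr M (head Q a) v d else 0)" if "v \<in> verts Q" for v
        using comp_j[OF h d that] .
      have "c w ?y = b"
      proof (rule coord_eqI[OF B'fin B'ind])
        show "c w ?y \<in> V.span B'" using hom_in[OF c(1) w y] by (simp add: space_I[OF B'(1)])
        show "b \<in> V.span B'" using b V.span_base by blast
        fix b' assume "b' \<in> B'"
        then obtain a' d' where a': "a' \<in> arcs Q" "d' \<in> D (head Q a')" "b' = e' (a', d')" using Be' by blast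
        note ea' = ends_in_verts[OF a'(1)]
        have rhs: "coord B' b' b = (if a' = a \<and> d' = d then 1 else 0)"
        proof -
          have "(b' = b) = (a' = a \<and> d' = d)"
          proof
            assume "b' = b"
            then have "i' (e' (a', d')) = i' (e' (a, d))" using a(3) a'(3) by simp
            then show "a' = a \<and> d' = d" unfolding i'[OF a(1,2)] i'[OF a'(1,2)] by simp
          next
            assume "a' = a \<and> d' = d"
            then show "b' = b" using a(3) a'(3) by simp
          qed
          moreover have "b \<in> B'" using b by simp
          ultimately show ?thesis using coord_basis[OF B'ind, of b b'] by simp
        qed
        show "coord B' b' (c w ?y) = coord B' b' b"
        proof (cases "reach w (tail Q a')")
          case False
          then have "a' \<noteq> a" using wa by blast
          then show ?thesis using cc[OF w y a'(1,2)] False rhs a'(3) by simp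
        next
          case wa': True
          have val: "coord B' b' (c w ?y) = coord (D (head Q a')) d' (\<delta> a' ?y)"
            using cc[OF w y a'(1,2)] wa' a'(3) by simp
          show ?thesis
          proof (cases "reach (head Q a) (tail Q a')")
            case True
            then have "\<delta> a' ?y = 0"
              unfolding \<delta>_def using comp_y[OF ea'(1)] comp_y[OF ea'(2)] reach_trans[OF True reach_arc[OF a'(1)]]
                tr_last[OF a'(1) True] by simp
            moreover have "a' \<noteq> a" using True no_cycle[OF a(1)] by blast
            ultimately show ?thesis using val rhs by (simp add: V.representation_zero)
          next
            case False
            then have \<delta>: "\<delta> a' ?y = comp (head Q a') ?y"
              unfolding \<delta>_def using comp_y[OF ea'(1)] act_zero[OF M a'(1)] by simp
            show ?thesis
            proof (cases "reach (head Q a) (head Q a')")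
              case True
              have aa: "a' = a" using same_arc[OF a(1) a'(1) wa wa' True False] .
              then have "\<delta> a' ?y = d" using \<delta> comp_y[OF h] reach_refl[OF h] tr_refl[OF h] by simp
              then show ?thesis using val rhs aa coord_basis[OF ind[OF h] a(2), of d'] by simp
            next
              case no: False
              then have "a' \<noteq> a" using reach_refl[OF h] by blast
              then show ?thesis using val rhs \<delta> comp_y[OF ea'(2)] no by (simp add: V.representation_zero)
            qed
          qed
        qed
      qed
      then show "b \<in> c w ` space ?I w" using y by blast
    qed
    then have "space ?I' w \<subseteq> c w ` space ?I w"
      unfolding injective_on_def[of B' l'] select_convs
      by (rule V.span_minimal) (rule subspace_linear_image[OF vs vs space_subspace[OF I w] hom_linear_on[OF c(1) w]])
    then show "c w ` space ?I w = space ?I' w" using hom_in[OF c(1) w] by blast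
  qed
  show thesis by (rule that[OF frame_nakayama[OF B] frame_nakayama[OF B'(1)] j mono c(1) epi exact])
qed

end

section \<open>Submodules of projectives and the category of monomorphisms\<close>

context tree_reps
begin

text \<open>Let \<open>\<pi> : E \<rightarrow> N\<close> be an epimorphism with kernel \<open>K\<close>, let \<open>f : P' \<rightarrow> N\<close>, and let \<open>0 \<rightarrow> K \<rightarrow> I0 \<rightarrow> I1 \<rightarrow> 0\<close> be an
  injective coresolution with second map \<open>c\<close>.  The map \<open>K \<rightarrow> I0\<close> extends to \<open>a : E \<rightarrow> I0\<close>, which induces
  \<open>b : N \<rightarrow> I1\<close> and makes \<open>E\<close> the pullback of \<open>b\<close> and \<open>c\<close>.  So a lift of \<open>f\<close> is the same as a map
  \<open>d : P' \<rightarrow> I0\<close> with \<open>c d = b f\<close>.  To find \<open>d\<close>, extend \<open>b f\<close> to \<open>P\<close> by injectivity of \<open>I1\<close>, lift to \<open>I0\<close> by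
  projectivity of \<open>P\<close>, and restrict to \<open>P'\<close>.\<close>

lemma hereditary:
  assumes P: "P \<in> proj_reps s Q" and P': "P' \<in> reps" and i: "i \<in> rhom P' P" "rep_mono Q P' i"
  shows "P' \<in> proj_reps s Q"
  unfolding proj_reps_def
proof (intro CollectI conjI ballI impI P')
  fix E N \<pi> f
  assume E: "E \<in> reps" and N: "N \<in> reps" and \<pi>: "\<pi> \<in> rhom E N" and f: "f \<in> rhom P' N" and epi: "rep_epi Q E N \<pi>"
  let ?U = "\<lambda>v. {x \<in> space E v. \<pi> v x = 0}"
  note U = kernel_invariant[OF E N \<pi>]
  note K = subrep_reps[OF E U] and k = subrep_incl[OF E U]
  obtain R0 I0 u0 R1 I1 u1 j c where n: "nakayama R0 I0 u0" "nakayama R1 I1 u1"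
    and j: "j \<in> rhom (subrep E ?U) I0" "rep_mono Q (subrep E ?U) j" and c: "c \<in> rhom I0 I1" "rep_epi Q I0 I1 c"
    and ex: "\<And>v. v \<in> verts Q \<Longrightarrow> j v ` space (subrep E ?U) v = {y \<in> space I0 v. c v y = 0}"
    by (rule injective_coresolution_exists[OF K]) blast
  note I0 = nakayamaD(2)[OF n(1)] and I1 = nakayamaD(2)[OF n(2)]
  obtain a where a: "a \<in> rhom E I0" "a \<circ>\<circ> id_fam (verts Q) ?U = j"
    using injective_repD[OF nakayama_injective[OF n(1)] K E k j(1)] by blast
  have aj: "a v x = j v x" if "v \<in> verts Q" "x \<in> ?U v" for v x
    using fun_cong[OF fun_cong[OF a(2)], of v x] that by (simp add: id_fam_apply)
  have cj: "c v (j v x) = 0" if "v \<in> verts Q" "x \<in> ?U v" for v x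
    using ex[OF that(1)] that(2) by auto
  obtain b where b: "b \<in> rhom N I1" "b \<circ>\<circ> \<pi> = c \<circ>\<circ> a"
  proof (rule factor_through_epi[OF E N I1 \<pi> epi hom_comp[OF E I1 a(1) c(1)]])
    show "(c \<circ>\<circ> a) v x = 0" if "v \<in> verts Q" "x \<in> space E v" "\<pi> v x = 0" for v x
      using aj[of v x] cj[of v x] that by simp
  qed blast
  have b\<pi>: "b v (\<pi> v x) = c v (a v x)" for v x using fun_cong[OF fun_cong[OF b(2)], of v x] by simp
  obtain h where h: "h \<in> rhom P I1" "h \<circ>\<circ> i = b \<circ>\<circ> f"
    using injective_repD[OF nakayama_injective[OF n(2)] P' projD(1)[OF P] i hom_comp[OF P' I1 f b(1)]] by blast
  obtain t where t: "t \<in> rhom P I0" "c \<circ>\<circ> t = h" using projD(2)[OF P I0 I1 c h(1)] by blast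
  define d where "d = t \<circ>\<circ> i"
  have d: "d \<in> rhom P' I0" unfolding d_def by (rule hom_comp[OF P' I0 i(1) t(1)])
  have "c \<circ>\<circ> d = b \<circ>\<circ> f" unfolding d_def comp_fam_assoc[symmetric] t(2) h(2) ..
  then have cd: "c v (d v x) = b v (f v x)" for v x by (metis comp_fam_apply)
  \<comment> \<open>\<open>E\<close> is the pullback of \<open>b\<close> and \<open>c\<close>, so \<open>f\<close> and \<open>d\<close> define a map into it\<close>
  have zero: "e = 0" if v: "v \<in> verts Q" and e: "e \<in> space E v" "\<pi> v e = 0" "a v e = 0" for v e
  proof -
    have "j v e = 0" using aj[OF v, of e] e by simp
    then show ?thesis using j(2) v e(1,2) unfolding mono_iff[OF K j(1)] space_subrep by blast
  qed
  have exist: "\<exists>e. e \<in> space E v \<and> \<pi> v e = f v x \<and> a v e = d v x" if v: "v \<in> verts Q" and x: "x \<in> space P' v" for v x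
  proof -
    have "f v x \<in> \<pi> v ` space E v" using epi v hom_in[OF f v x] unfolding rep_epi_def by simp
    then obtain e where e: "e \<in> space E v" "\<pi> v e = f v x" by auto
    note ae = hom_in[OF a(1) v e(1)] and dx = hom_in[OF d v x]
    have "c v (a v e - d v x) = 0"
      using linear_on_diff[OF vs space_subspace[OF I0 v] hom_linear_on[OF c(1) v] ae dx] b\<pi>[of v e] cd[of v x] e(2) by simp
    then have "a v e - d v x \<in> j v ` space (subrep E ?U) v" using ex[OF v] space_diff[OF I0 v ae dx] by simp
    then obtain y where y: "y \<in> ?U v" "a v e - d v x = j v y" by auto
    have yE: "y \<in> space E v" using y(1) by simp
    have "\<pi> v (e - y) = f v x" "a v (e - y) = d v x"
      using linear_on_diff[OF vs space_subspace[OF E v] hom_linear_on[OF \<pi> v] e(1) yE]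
        linear_on_diff[OF vs space_subspace[OF E v] hom_linear_on[OF a(1) v] e(1) yE] y aj[OF v y(1)] e(2) by (simp_all add: algebra_simps)
    then show ?thesis using space_diff[OF E v e(1) yE] by blast
  qed
  obtain g where g: "g \<in> rhom P' E" "\<And>v x. v \<in> verts Q \<Longrightarrow> x \<in> space P' v \<Longrightarrow> \<pi> v (g v x) = f v x \<and> a v (g v x) = d v x"
  proof (rule rhom_of_relation[OF P' E, of "\<lambda>v x e. \<pi> v e = f v x \<and> a v e = d v x"])
    fix v assume v: "v \<in> verts Q"
    show "\<exists>e\<in>space E v. \<pi> v e = f v x \<and> a v e = d v x" if "x \<in> space P' v" for x using exist[OF v that] by blast
    show "e = 0" if "e \<in> space E v" "\<pi> v e = f v 0 \<and> a v e = d v 0" for e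
      using zero[OF v that(1)] that(2) hom_zero[OF f v] hom_zero[OF d v] by simp
  qed (simp_all add: linear_on_add[OF hom_linear_on[OF \<pi>]] linear_on_add[OF hom_linear_on[OF a(1)]]
      linear_on_add[OF hom_linear_on[OF f]] linear_on_add[OF hom_linear_on[OF d]]
      linear_on_scale[OF hom_linear_on[OF \<pi>]] linear_on_scale[OF hom_linear_on[OF a(1)]]
      linear_on_scale[OF hom_linear_on[OF f]] linear_on_scale[OF hom_linear_on[OF d]]
      hom_natural[OF \<pi>] hom_natural[OF a(1)] hom_natural[OF f] hom_natural[OF d])
  have "\<pi> \<circ>\<circ> g = f" by (rule hom_eqI[OF hom_comp[OF P' N g(1) \<pi>] f]) (simp add: g(2))
  then show "\<exists>g\<in>rhom P' E. \<pi> \<circ>\<circ> g = f" using g(1) by blast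
qed

lemma subrep_proj:
  "P \<in> proj_reps s Q \<Longrightarrow> invariant P U \<Longrightarrow> subrep P U \<in> proj_reps s Q"
  using hereditary subrep_reps subrep_incl projD(1) by blast

lemma Obj_mono_proj: "(A, B, \<iota>) \<in> Obj (mono_proj s Q) \<longleftrightarrow>
    A \<in> proj_reps s Q \<and> B \<in> proj_reps s Q \<and> \<iota> \<in> rhom A B \<and> rep_mono Q A \<iota>"
  by (simp add: mono_proj_def)

lemma Hom_mono_proj: "(\<phi>, \<psi>) \<in> Hom (mono_proj s Q) (A, B, \<iota>) (A', B', \<iota>') \<longleftrightarrow>
    \<phi> \<in> rhom A A' \<and> \<psi> \<in> rhom B B' \<and> \<psi> \<circ>\<circ> \<iota> = \<iota>' \<circ>\<circ> \<phi>"
  by (simp add: mono_proj_def)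

text \<open>The image of a map from \<open>B\<close> to a projective is projective, so it splits off from \<open>B\<close>.  If the map vanishes
  on \<open>A\<close>, then \<open>\<iota>\<close> has values in the complement, and \<open>0 \<rightarrow> im g\<close> is a direct summand of \<open>\<iota> : A \<rightarrow> B\<close>.\<close>

lemma split_off_projective:
  assumes X: "(A, B, \<iota>) \<in> Obj (mono_proj s Q)" and P: "P \<in> proj_reps s Q" and g: "g \<in> rhom B P" "g \<circ>\<circ> \<iota> = 0"
  defines "N \<equiv> subrep P (\<lambda>v. g v ` space B v)" and "U \<equiv> \<lambda>v. {x \<in> space B v. g v x = 0}"
  obtains \<sigma> \<rho> where "N \<in> proj_reps s Q" "subrep B U \<in> proj_reps s Q" "g \<in> rhom B N" "\<sigma> \<in> rhom N B" "g \<circ>\<circ> \<sigma> = rid N"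
    "id_fam (verts Q) U \<in> rhom (subrep B U) B" "\<rho> \<in> rhom B (subrep B U)"
    "\<rho> \<circ>\<circ> id_fam (verts Q) U = rid (subrep B U)" "id_fam (verts Q) U \<circ>\<circ> \<rho> = rid B - (\<sigma> \<circ>\<circ> g)"
    "\<rho> = rid B - (\<sigma> \<circ>\<circ> g)" "g \<circ>\<circ> id_fam (verts Q) U = 0" "\<rho> \<circ>\<circ> \<sigma> = 0"
    "(A, subrep B U, \<iota>) \<in> Obj (mono_proj s Q)" "id_fam (verts Q) U \<circ>\<circ> \<iota> = \<iota>" "\<rho> \<circ>\<circ> \<iota> = \<iota>"
proof -
  have A: "A \<in> proj_reps s Q" and B: "B \<in> proj_reps s Q" and \<iota>: "\<iota> \<in> rhom A B" "rep_mono Q A \<iota>"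
    using X unfolding Obj_mono_proj by auto
  note A' = projD(1)[OF A] and B' = projD(1)[OF B] and P' = projD(1)[OF P]
  note inv = image_invariant[OF B' P' g(1)] kernel_invariant[OF B' P' g(1)]
  have N: "N \<in> proj_reps s Q" unfolding N_def by (rule subrep_proj[OF P inv(1)])
  have S: "subrep B U \<in> proj_reps s Q" unfolding U_def by (rule subrep_proj[OF B inv(2)])
  note N' = projD(1)[OF N] and S' = projD(1)[OF S]
  have g': "g \<in> rhom B N" unfolding N_def by (rule corestrict(1)[OF P' inv(1) B' g(1)]) simp
  have "rep_epi Q B N g" unfolding rep_epi_def N_def by simp
  then obtain \<sigma> where \<sigma>: "\<sigma> \<in> rhom N B" "g \<circ>\<circ> \<sigma> = rid N" using projD(2)[OF N B' N' g' _ rid_hom[OF N']] by blast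
  have e: "id_fam (verts Q) U \<in> rhom (subrep B U) B" unfolding U_def by (rule subrep_incl(1)[OF B' inv(2)])
  define \<rho> where "\<rho> = rid B - (\<sigma> \<circ>\<circ> g)"
  note sg = hom_comp[OF B' B' g' \<sigma>(1)]
  have \<rho>: "\<rho> \<in> rhom B B" unfolding \<rho>_def by (rule rhom_diff[OF B' B' rid_hom[OF B'] sg])
  have "g \<circ>\<circ> \<rho> = 0"
    unfolding \<rho>_def comp_diff_right[OF B' B' g' rid_hom[OF B'] sg] comp_fam_assoc[symmetric] \<sigma>(2) comp_rid[OF g'] rid_comp[OF g'] by simp
  then have "g v (\<rho> v x) = 0" for v x by (metis comp_fam_apply zero_fun_apply)
  then have U\<rho>: "\<rho> v x \<in> U v" if "v \<in> verts Q" "x \<in> space B v" for v x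
    using hom_in[OF \<rho> that] by (simp add: U_def)
  note cr = corestrict[OF B' inv(2)[folded U_def] B' \<rho> U\<rho>]
  have ge: "g \<circ>\<circ> id_fam (verts Q) U = 0"
    using hom_zero[OF g(1)] hom_outside_verts[OF g(1)] by (fastforce simp: fun_eq_iff id_fam_apply U_def)
  have re: "\<rho> \<circ>\<circ> id_fam (verts Q) U = rid (subrep B U)"
  proof -
    have "\<rho> \<circ>\<circ> id_fam (verts Q) U = id_fam (verts Q) U - (\<sigma> \<circ>\<circ> (g \<circ>\<circ> id_fam (verts Q) U))"
      unfolding \<rho>_def comp_diff_left comp_fam_assoc rid_comp[OF e] ..
    then show ?thesis unfolding ge comp_zero_right[OF \<sigma>(1)] by simp
  qed
  have rs: "\<rho> \<circ>\<circ> \<sigma> = 0"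
    unfolding \<rho>_def comp_diff_left comp_fam_assoc \<sigma>(2) rid_comp[OF \<sigma>(1)] comp_rid[OF \<sigma>(1)] by simp
  have "g v (\<iota> v x) = 0" for v x using g(2) by (metis comp_fam_apply zero_fun_apply)
  then have \<iota>S: "\<iota> \<in> rhom A (subrep B U)" "id_fam (verts Q) U \<circ>\<circ> \<iota> = \<iota>"
    using corestrict[OF B' inv(2)[folded U_def] A' \<iota>(1)] hom_in[OF \<iota>(1)] by (auto simp: U_def)
  have obj: "(A, subrep B U, \<iota>) \<in> Obj (mono_proj s Q)" unfolding Obj_mono_proj using A S \<iota>S(1) \<iota>(2) by blast
  have r\<iota>: "\<rho> \<circ>\<circ> \<iota> = \<iota>"
    unfolding \<rho>_def comp_diff_left comp_fam_assoc g(2) rid_comp[OF \<iota>(1)] comp_zero_right[OF \<sigma>(1)] by simp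
  show thesis by (rule that[OF N S g' \<sigma> e cr(1) re trans[OF cr(2) \<rho>_def] \<rho>_def ge rs obj \<iota>S(2) r\<iota>])
qed

lemma Obj_H: "X \<in> Obj (H_cat s Q) \<Longrightarrow> X \<in> Obj (mono_proj s Q)"
  by (simp add: H_cat_def)

lemma H_ObjD:
  assumes "(A, B, \<iota>) \<in> Obj (H_cat s Q)"
  shows "A \<in> proj_reps s Q" "B \<in> proj_reps s Q" "\<iota> \<in> rhom A B" "rep_mono Q A \<iota>"
  using Obj_H[OF assms] unfolding Obj_mono_proj by blast+

text \<open>If \<open>g\<close> were nonzero, then \<open>0 \<rightarrow> im g\<close> would be a direct summand.  Together with \<open>H_intro\<close> this turns the
  condition on summands into one on maps: the cokernel of \<open>\<iota>\<close> has no nonzero map to a projective.\<close>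

lemma H_elim:
  assumes X: "(A, B, \<iota>) \<in> Obj (H_cat s Q)" and P: "P \<in> proj_reps s Q" and g: "g \<in> rhom B P" "g \<circ>\<circ> \<iota> = 0"
  shows "g = 0"
proof (rule ccontr)
  assume ne: "g \<noteq> 0"
  have A: "A \<in> proj_reps s Q" and B: "B \<in> proj_reps s Q" and \<iota>: "\<iota> \<in> rhom A B" "rep_mono Q A \<iota>"
    using H_ObjD[OF X] by auto
  let ?N = "subrep P (\<lambda>v. g v ` space B v)" and ?U = "\<lambda>v. {x \<in> space B v. g v x = 0}"
  let ?S = "subrep B ?U" and ?e = "id_fam (verts Q) ?U"
  obtain \<sigma> \<rho> where N: "?N \<in> proj_reps s Q" and S: "?S \<in> proj_reps s Q" and gN: "g \<in> rhom B ?N"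
    and \<sigma>: "\<sigma> \<in> rhom ?N B" "g \<circ>\<circ> \<sigma> = rid ?N"
    and e: "?e \<in> rhom ?S B" and \<rho>: "\<rho> \<in> rhom B ?S" "\<rho> \<circ>\<circ> ?e = rid ?S" "?e \<circ>\<circ> \<rho> = rid B - (\<sigma> \<circ>\<circ> g)"
      "\<rho> = rid B - (\<sigma> \<circ>\<circ> g)" and ge: "g \<circ>\<circ> ?e = 0" and rs: "\<rho> \<circ>\<circ> \<sigma> = 0"
    and obj: "(A, ?S, \<iota>) \<in> Obj (mono_proj s Q)" and e\<iota>: "?e \<circ>\<circ> \<iota> = \<iota>" and r\<iota>: "\<rho> \<circ>\<circ> \<iota> = \<iota>"
    by (rule split_off_projective[OF Obj_H[OF X] P g]) blast
  note A' = projD(1)[OF A] and B' = projD(1)[OF B] and N' = projD(1)[OF N]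
  have z: "0 \<in> rhom zrep M" "0 \<in> rhom M zrep" if "M \<in> reps" for M
    using rhom_zero[OF zrep_reps that] rhom_zero[OF that zrep_reps] by auto
  let ?C = "mono_proj s Q"
  have "direct_summand ?C (zrep, ?N, 0) (A, B, \<iota>)"
    unfolding direct_summand_def
  proof (intro conjI bexI)
    show "(A, B, \<iota>) \<in> Obj ?C" by (rule Obj_H[OF X])
    have "rep_mono Q zrep 0" unfolding rep_mono_def by simp
    then show "(zrep, ?N, 0) \<in> Obj ?C" unfolding Obj_mono_proj using zrep_proj N z(1)[OF N'] by blast
    show "(A, ?S, \<iota>) \<in> Obj ?C" by (rule obj)
    show "(0, \<sigma>) \<in> Hom ?C (zrep, ?N, 0) (A, B, \<iota>)"
      unfolding Hom_mono_proj using z(1)[OF A'] \<sigma>(1) comp_zero_right[OF \<sigma>(1)] comp_zero_right[OF \<iota>(1)] by simp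
    show "(0, g) \<in> Hom ?C (A, B, \<iota>) (zrep, ?N, 0)"
      unfolding Hom_mono_proj using z(2)[OF A'] gN g(2) by simp
    show "(rid A, ?e) \<in> Hom ?C (A, ?S, \<iota>) (A, B, \<iota>)"
      unfolding Hom_mono_proj using rid_hom[OF A'] e e\<iota> comp_rid[OF \<iota>(1)] by simp
    show "(rid A, \<rho>) \<in> Hom ?C (A, B, \<iota>) (A, ?S, \<iota>)"
      unfolding Hom_mono_proj using rid_hom[OF A'] \<rho>(1) r\<iota> comp_rid[OF \<iota>(1)] by simp
    have z0: "rid zrep = 0" by (simp add: fun_eq_iff id_fam_apply)
    show "Comp ?C (0, g) (0, \<sigma>) = Id ?C (zrep, ?N, 0)" using \<sigma>(2) z0 by (simp add: mono_proj_def)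
    show "Comp ?C (rid A, \<rho>) (rid A, ?e) = Id ?C (A, ?S, \<iota>)"
      using \<rho>(2) comp_rid[OF rid_hom[OF A']] by (simp add: mono_proj_def)
    show "Comp ?C (0, g) (rid A, ?e) = 0" using ge by (simp add: mono_proj_def zero_prod_def)
    show "Comp ?C (rid A, \<rho>) (0, \<sigma>) = 0" using rs comp_zero_right[OF rid_hom[OF A']] by (simp add: mono_proj_def zero_prod_def)
    show "Comp ?C (0, \<sigma>) (0, g) + Comp ?C (rid A, ?e) (rid A, \<rho>) = Id ?C (A, B, \<iota>)"
      using \<rho>(3) comp_rid[OF rid_hom[OF A']] by (simp add: mono_proj_def)
  qed
  moreover have "\<not> zero_rep Q ?N"
  proof
    assume "zero_rep Q ?N"
    then have "g v x = 0" if "v \<in> verts Q" "x \<in> space B v" for v x using that unfolding zero_rep_def by auto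
    then have "g = 0" using hom_eqI[OF g(1) rhom_zero[OF B' projD(1)[OF P]]] by simp
    then show False using ne by blast
  qed
  ultimately show False using X zrep_simps(2) unfolding H_cat_def by (simp, blast)
qed

lemma H_intro:
  assumes X: "(A, B, \<iota>) \<in> Obj (mono_proj s Q)"
    and tors: "\<And>P g. P \<in> proj_reps s Q \<Longrightarrow> g \<in> rhom B P \<Longrightarrow> g \<circ>\<circ> \<iota> = 0 \<Longrightarrow> g = 0"
  shows "(A, B, \<iota>) \<in> Obj (H_cat s Q)"
proof -
  have False if Z: "zero_rep Q Z" and P: "\<not> zero_rep Q P" and sm: "direct_summand (mono_proj s Q) (Z, P, \<kappa>) (A, B, \<iota>)" for Z P \<kappa>
  proof -
    obtain i p where ip: "(Z, P, \<kappa>) \<in> Obj (mono_proj s Q)" "i \<in> Hom (mono_proj s Q) (Z, P, \<kappa>) (A, B, \<iota>)"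
      "p \<in> Hom (mono_proj s Q) (A, B, \<iota>) (Z, P, \<kappa>)" "Comp (mono_proj s Q) p i = Id (mono_proj s Q) (Z, P, \<kappa>)"
      using sm unfolding direct_summand_def by blast
    obtain p1 p2 i1 i2 where pi: "p = (p1, p2)" "i = (i1, i2)" by (cases p, cases i) auto
    have p: "p1 \<in> rhom A Z" "p2 \<in> rhom B P" "p2 \<circ>\<circ> \<iota> = \<kappa> \<circ>\<circ> p1" using ip(3) unfolding pi Hom_mono_proj by auto
    have pr: "P \<in> proj_reps s Q" "\<kappa> \<in> rhom Z P" using ip(1) unfolding Obj_mono_proj by auto
    have "p1 v x = 0" for v x using hom_in[OF p(1), of v x] hom_outside'[OF p(1), of v x] Z unfolding zero_rep_def by auto
    then have "p1 = 0" by (simp add: fun_eq_iff)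
    then have "p2 \<circ>\<circ> \<iota> = 0" using p(3) comp_zero_right[OF pr(2)] by simp
    then have "p2 = 0" using tors[OF pr(1) p(2)] by blast
    moreover have "p2 \<circ>\<circ> i2 = rid P" using ip(4) unfolding pi by (simp add: mono_proj_def)
    ultimately have "rid P = 0" by simp
    then have *: "rid P v x = 0" for v x by simp
    have "x = 0" if "v \<in> verts Q" "x \<in> space P v" for v x using *[of v x] that by (simp add: id_fam_apply)
    then have "zero_rep Q P" using space_zero[OF projD(1)[OF pr(1)]] unfolding zero_rep_def by blast
    then show False using P by blast
  qed
  then show ?thesis using X unfolding H_cat_def by auto
qed

lemma dim_mono_fin_dim:
  assumes "module.subspace s U" "U \<subseteq> W" "fin_dim s W"
  shows "vector_space.dim s U \<le> vector_space.dim s W" "U \<noteq> W \<Longrightarrow> vector_space.dim s U < vector_space.dim s W"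
proof -
  interpret V: vector_space s by (rule vs)
  obtain D where D: "finite D" "V.independent D" "V.span D = U" using fin_dim_basis[OF vs fin_dim_subset[OF vs assms(3,1,2)]] .
  obtain E where E: "finite E" "V.independent E" "V.span E = W" using fin_dim_basis[OF vs assms(3)] .
  have dims: "V.dim U = card D" "V.dim W = card E"
    using V.dim_span_eq_card_independent[OF D(2)] V.dim_span_eq_card_independent[OF E(2)] D(3) E(3) by simp_all
  have sub: "D \<subseteq> V.span E" using V.span_superset[of D] D(3) E(3) assms(2) by blast
  show "V.dim U \<le> V.dim W" using V.independent_span_bound[OF E(1) D(2) sub] dims by simp
  assume "U \<noteq> W"
  then obtain x where x: "x \<in> W" "x \<notin> U" using assms(2) by blast
  have "V.independent (insert x D)" using V.independent_insertI[OF _ D(2), of x] D(3) x(2) by blast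
  moreover have "insert x D \<subseteq> V.span E" using sub x(1) E(3) by blast
  ultimately have "card (insert x D) \<le> card E" using V.independent_span_bound[OF E(1)] by blast
  moreover have "x \<notin> D" using x(2) D(3) V.span_base by blast
  ultimately show "V.dim U < V.dim W" using dims D(1) by simp
qed

text \<open>Summands \<open>0 \<rightarrow> P\<close> are split off until none is left.  They leave \<open>A\<close> and the function \<open>\<iota>\<close> unchanged, and by
  \<open>H_elim\<close> morphisms from objects of \<open>H_cat s Q\<close> do not see them, so such morphisms factor through the
  summand that remains.\<close>

lemma H_decomposition:
  assumes "(A, B, \<iota>) \<in> Obj (mono_proj s Q)"
  obtains B' e \<rho> where "(A, B', \<iota>) \<in> Obj (H_cat s Q)" "e \<in> rhom B' B" "\<rho> \<in> rhom B B'" "\<rho> \<circ>\<circ> e = rid B'"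
    "e \<circ>\<circ> \<iota> = \<iota>" "\<rho> \<circ>\<circ> \<iota> = \<iota>"
    "\<And>A1 B1 \<iota>1 \<phi> \<psi>. (A1, B1, \<iota>1) \<in> Obj (H_cat s Q) \<Longrightarrow> \<phi> \<in> rhom A1 A \<Longrightarrow> \<psi> \<in> rhom B1 B \<Longrightarrow>
      \<psi> \<circ>\<circ> \<iota>1 = \<iota> \<circ>\<circ> \<phi> \<Longrightarrow> e \<circ>\<circ> (\<rho> \<circ>\<circ> \<psi>) = \<psi>"
proof -
  let ?P = "\<lambda>B B' e \<rho>. (A, B', \<iota>) \<in> Obj (H_cat s Q) \<and> e \<in> rhom B' B \<and> \<rho> \<in> rhom B B' \<and> \<rho> \<circ>\<circ> e = rid B' \<and>
    e \<circ>\<circ> \<iota> = \<iota> \<and> \<rho> \<circ>\<circ> \<iota> = \<iota> \<and> (\<forall>A1 B1 \<iota>1 \<phi> \<psi>. (A1, B1, \<iota>1) \<in> Obj (H_cat s Q) \<longrightarrow> \<phi> \<in> rhom A1 A \<longrightarrow> \<psi> \<in> rhom B1 B \<longrightarrow>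
      \<psi> \<circ>\<circ> \<iota>1 = \<iota> \<circ>\<circ> \<phi> \<longrightarrow> e \<circ>\<circ> (\<rho> \<circ>\<circ> \<psi>) = \<psi>)"
  have "\<exists>B' e \<rho>. ?P B B' e \<rho>"
    using assms
  proof (induction "\<Sum>v\<in>verts Q. vector_space.dim s (space B v)" arbitrary: B rule: less_induct)
    case less
    have A: "A \<in> proj_reps s Q" and B: "B \<in> proj_reps s Q" and \<iota>: "\<iota> \<in> rhom A B" "rep_mono Q A \<iota>"
      using less.prems unfolding Obj_mono_proj by auto
    note A' = projD(1)[OF A] and B' = projD(1)[OF B]
    show ?case
    proof (cases "(A, B, \<iota>) \<in> Obj (H_cat s Q)")
      case True
      have "?P B B (rid B) (rid B)"
        using True rid_hom[OF B'] comp_rid[OF rid_hom[OF B']] rid_comp[OF \<iota>(1)] rid_comp by simp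
      then show ?thesis by blast
    next
      case False
      then obtain P g where P: "P \<in> proj_reps s Q" and g: "g \<in> rhom B P" "g \<circ>\<circ> \<iota> = 0" "g \<noteq> 0"
        using H_intro[OF less.prems] by blast
      let ?N = "subrep P (\<lambda>v. g v ` space B v)" and ?U = "\<lambda>v. {x \<in> space B v. g v x = 0}"
      let ?S = "subrep B ?U" and ?e = "id_fam (verts Q) ?U"
      obtain \<sigma> \<rho> where N: "?N \<in> proj_reps s Q" and S: "?S \<in> proj_reps s Q" and gN: "g \<in> rhom B ?N"
        and \<sigma>: "\<sigma> \<in> rhom ?N B" "g \<circ>\<circ> \<sigma> = rid ?N"
        and e: "?e \<in> rhom ?S B" and \<rho>: "\<rho> \<in> rhom B ?S" "\<rho> \<circ>\<circ> ?e = rid ?S" "?e \<circ>\<circ> \<rho> = rid B - (\<sigma> \<circ>\<circ> g)"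
          "\<rho> = rid B - (\<sigma> \<circ>\<circ> g)" and S_obj: "(A, ?S, \<iota>) \<in> Obj (mono_proj s Q)" and e\<iota>: "?e \<circ>\<circ> \<iota> = \<iota>" and r\<iota>: "\<rho> \<circ>\<circ> \<iota> = \<iota>"
        by (rule split_off_projective[OF less.prems P g(1,2)]) blast
      note S' = projD(1)[OF S]
      note inv = kernel_invariant[OF B' projD(1)[OF P] g(1)]
      have ex: "\<exists>v\<in>verts Q. ?U v \<noteq> space B v"
      proof (rule ccontr)
        assume "\<not> ?thesis"
        then have "g v x = 0" if "v \<in> verts Q" "x \<in> space B v" for v x using that by blast
        then have "g = 0" using hom_eqI[OF g(1) rhom_zero[OF B' projD(1)[OF P]]] by simp
        then show False using g(3) by blast
      qed
      have U: "module.subspace s (?U v)" "?U v \<subseteq> space B v" if "v \<in> verts Q" for v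
        using inv that unfolding invariant_def by blast+
      note dims = dim_mono_fin_dim[OF U space_fin_dim[OF B']]
      have lt: "(\<Sum>v\<in>verts Q. vector_space.dim s (space ?S v)) < (\<Sum>v\<in>verts Q. vector_space.dim s (space B v))"
      proof (rule sum_strict_mono_ex1[OF finite_verts])
        show "\<forall>v\<in>verts Q. vector_space.dim s (space ?S v) \<le> vector_space.dim s (space B v)"
          using dims(1) by simp
        obtain v where "v \<in> verts Q" "?U v \<noteq> space B v" using ex by blast
        then show "\<exists>v\<in>verts Q. vector_space.dim s (space ?S v) < vector_space.dim s (space B v)"
          using dims(2)[of v] unfolding space_subrep by blast
      qed
      obtain B' e' \<rho>' where IH: "?P ?S B' e' \<rho>'" using less.hyps[OF lt S_obj] by (elim exE) (rule that)
      then have e': "e' \<in> rhom B' ?S" and \<rho>': "\<rho>' \<in> rhom ?S B'" "\<rho>' \<circ>\<circ> e' = rid B'" by blast+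
      have B'r: "B' \<in> reps" using projD(1)[OF H_ObjD(2)[OF conjunct1[OF IH]]] .
      have "?P B B' (?e \<circ>\<circ> e') (\<rho>' \<circ>\<circ> \<rho>)"
      proof (intro conjI allI impI)
        show "(A, B', \<iota>) \<in> Obj (H_cat s Q)" using IH by blast
        show "?e \<circ>\<circ> e' \<in> rhom B' B" by (rule hom_comp[OF B'r \<open>B \<in> reps\<close> e' e])
        show "\<rho>' \<circ>\<circ> \<rho> \<in> rhom B B'" by (rule hom_comp[OF \<open>B \<in> reps\<close> B'r \<rho>(1) \<rho>'(1)])
        have "(\<rho>' \<circ>\<circ> \<rho>) \<circ>\<circ> (?e \<circ>\<circ> e') = \<rho>' \<circ>\<circ> ((\<rho> \<circ>\<circ> ?e) \<circ>\<circ> e')" unfolding comp_fam_assoc ..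
        then show "(\<rho>' \<circ>\<circ> \<rho>) \<circ>\<circ> (?e \<circ>\<circ> e') = rid B'" unfolding \<rho>(2) rid_comp[OF e'] \<rho>'(2) .
        show "(?e \<circ>\<circ> e') \<circ>\<circ> \<iota> = \<iota>" unfolding comp_fam_assoc using IH e\<iota> by simp
        show "(\<rho>' \<circ>\<circ> \<rho>) \<circ>\<circ> \<iota> = \<iota>" unfolding comp_fam_assoc using IH r\<iota> by simp
        fix A1 B1 \<iota>1 \<phi> \<psi>
        assume X1: "(A1, B1, \<iota>1) \<in> Obj (H_cat s Q)" and \<phi>: "\<phi> \<in> rhom A1 A" and \<psi>: "\<psi> \<in> rhom B1 B" and eq: "\<psi> \<circ>\<circ> \<iota>1 = \<iota> \<circ>\<circ> \<phi>"
        have B1: "B1 \<in> reps" using projD(1)[OF H_ObjD(2)[OF X1]] .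
        have "(g \<circ>\<circ> \<psi>) \<circ>\<circ> \<iota>1 = 0" unfolding comp_fam_assoc eq unfolding comp_fam_assoc[symmetric] g(2) by simp
        then have "g \<circ>\<circ> \<psi> = 0" using H_elim[OF X1 P hom_comp[OF B1 projD(1)[OF P] \<psi> g(1)]] by blast
        then have "\<rho> \<circ>\<circ> \<psi> = \<psi>"
          unfolding \<rho>(4) comp_diff_left comp_fam_assoc rid_comp[OF \<psi>] by (simp add: comp_zero_right[OF \<sigma>(1)])
        have \<rho>\<psi>: "\<rho> \<circ>\<circ> \<psi> \<in> rhom B1 ?S" by (rule hom_comp[OF B1 S' \<psi> \<rho>(1)])
        have "(\<rho> \<circ>\<circ> \<psi>) \<circ>\<circ> \<iota>1 = \<iota> \<circ>\<circ> \<phi>" unfolding \<open>\<rho> \<circ>\<circ> \<psi> = \<psi>\<close> by (rule eq)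
        then have "e' \<circ>\<circ> (\<rho>' \<circ>\<circ> (\<rho> \<circ>\<circ> \<psi>)) = \<rho> \<circ>\<circ> \<psi>" using IH X1 \<phi> \<rho>\<psi> by blast
        then have "(?e \<circ>\<circ> e') \<circ>\<circ> ((\<rho>' \<circ>\<circ> \<rho>) \<circ>\<circ> \<psi>) = (?e \<circ>\<circ> \<rho>) \<circ>\<circ> \<psi>" unfolding comp_fam_assoc by simp
        also have "\<dots> = \<psi>" using \<open>\<rho> \<circ>\<circ> \<psi> = \<psi>\<close> \<rho>(3,4) by simp
        finally show "(?e \<circ>\<circ> e') \<circ>\<circ> ((\<rho>' \<circ>\<circ> \<rho>) \<circ>\<circ> \<psi>) = \<psi>" .
      qed
      then show ?thesis by blast
    qed
  qed
  then obtain B' e \<rho> where "?P B B' e \<rho>" by blast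
  then show thesis using that[of B' e \<rho>] by blast
qed

end

section \<open>The functor of a representation\<close>

context tree_reps
begin

abbreviation H where "H \<equiv> H_cat s Q"
abbreviation fam_scale :: "'k \<Rightarrow> ('v \<Rightarrow> 'u \<Rightarrow> 'u) \<Rightarrow> 'v \<Rightarrow> 'u \<Rightarrow> 'u" where "fam_scale \<equiv> scale_fam s"

lemma Hom_H: "(\<phi>, \<psi>) \<in> Hom H (A, B, \<iota>) (A', B', \<iota>') \<longleftrightarrow>
    \<phi> \<in> rhom A A' \<and> \<psi> \<in> rhom B B' \<and> \<psi> \<circ>\<circ> \<iota> = \<iota>' \<circ>\<circ> \<phi>"
  by (simp add: H_cat_def mono_proj_def)

lemma H_simps [simp]:
  "Id H (A, B, \<iota>) = (rid A, rid B)"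
  "Comp H (\<phi>', \<psi>') (\<phi>, \<psi>) = (\<phi>' \<circ>\<circ> \<phi>, \<psi>' \<circ>\<circ> \<psi>)"
  "Scal H c (\<phi>, \<psi>) = (scale_fam s c \<phi>, scale_fam s c \<psi>)"
  by (simp_all add: H_cat_def mono_proj_def)

lemma Scal_H: "Scal H = (\<lambda>c p. (scale_fam s c (fst p), scale_fam s c (snd p)))"
  by (auto simp: H_cat_def mono_proj_def fun_eq_iff)

lemma H_reps: "(A, B, \<iota>) \<in> Obj H \<Longrightarrow> A \<in> reps" "(A, B, \<iota>) \<in> Obj H \<Longrightarrow> B \<in> reps"
  using projD(1)[OF H_ObjD(1)] projD(1)[OF H_ObjD(2)] by blast+

lemma H_fd_category: "fd_category H fam_scale"
proof (rule fd_category.intro)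
  show "vector_space (Scal H)" unfolding Scal_H by (rule vector_space_prod[OF vs_fam vs_fam])
  show "vector_space fam_scale" by (rule vs_fam)
  show "\<not> fin_dim (scale_fam s) (UNIV :: ('v \<Rightarrow> 'u \<Rightarrow> 'u) set)"
  proof
    assume fd: "fin_dim (scale_fam s) (UNIV :: ('v \<Rightarrow> 'u \<Rightarrow> 'u) set)"
    interpret V: vector_space s by (rule vs)
    have lin: "linear_on s (scale_fam s) UNIV (\<lambda>x (v :: 'v) (y :: 'u). x)" by (simp add: linear_on_def scale_fam_def fun_eq_iff)
    have inj: "inj_on (\<lambda>(x :: 'u) (v :: 'v) (y :: 'u). x) UNIV" by (rule inj_onI) (simp add: fun_eq_iff)
    have "fin_dim s UNIV" by (rule fin_dim_if_injective[OF vs vs_fam V.subspace_UNIV fd lin _ inj]) simp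
    then show False using infinite_ambient by blast
  qed
  show "fin_dim (Scal H) (Hom H X Y)" if X: "X \<in> Obj H" and Y: "Y \<in> Obj H" for X Y
  proof -
    obtain A B \<iota> A' B' \<iota>' where XY: "X = (A, B, \<iota>)" "Y = (A', B', \<iota>')" by (cases X, cases Y) auto
    note r = H_reps[OF X[unfolded XY]] H_reps[OF Y[unfolded XY]]
    have \<iota>: "\<iota> \<in> rhom A B" "\<iota>' \<in> rhom A' B'" using H_ObjD(3) X Y unfolding XY by blast+
    have fd: "fin_dim (Scal H) (rhom A A' \<times> rhom B B')"
      unfolding Scal_H by (rule fin_dim_times[OF vs_fam vs_fam rhom_fin_dim[OF r(1,3)] rhom_fin_dim[OF r(2,4)]])
    have v: "vector_space (Scal H)" unfolding Scal_H by (rule vector_space_prod[OF vs_fam vs_fam])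
    note s1 = rhom_subspace[OF r(1,3)] and s2 = rhom_subspace[OF r(2,4)]
    have "module.subspace (Scal H) (Hom H X Y)"
    proof (rule module.subspaceI[OF module_if_vector_space[OF v]])
      show "0 \<in> Hom H X Y"
        unfolding XY zero_prod_def Hom_H using rhom_zero[OF r(1,3)] rhom_zero[OF r(2,4)] comp_zero_right[OF \<iota>(2)] by simp
      fix f assume "f \<in> Hom H X Y"
      then obtain \<phi> \<psi> where f: "f = (\<phi>, \<psi>)" "\<phi> \<in> rhom A A'" "\<psi> \<in> rhom B B'" "\<psi> \<circ>\<circ> \<iota> = \<iota>' \<circ>\<circ> \<phi>"
        using Hom_H unfolding XY by (cases f) auto
      show "Scal H c f \<in> Hom H X Y" for c
        unfolding XY f(1) H_simps Hom_H
        using subspace_scaleD[OF vs_fam s1 f(2)] subspace_scaleD[OF vs_fam s2 f(3)] f(4)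
          linear_on_scale[OF linear_on_comp_right[OF \<iota>(2) r(3)] f(2), of c]
          linear_on_scale[OF linear_on_comp_left[of UNIV \<iota>], of \<psi> c] by simp
      fix g assume "g \<in> Hom H X Y"
      then obtain \<phi>' \<psi>' where g: "g = (\<phi>', \<psi>')" "\<phi>' \<in> rhom A A'" "\<psi>' \<in> rhom B B'" "\<psi>' \<circ>\<circ> \<iota> = \<iota>' \<circ>\<circ> \<phi>'"
        using Hom_H unfolding XY by (cases g) auto
      show "f + g \<in> Hom H X Y"
        unfolding XY f(1) g(1) add_Pair Hom_H
        using subspace_addD[OF vs_fam s1 f(2) g(2)] subspace_addD[OF vs_fam s2 f(3) g(3)] f(4) g(4)
          linear_on_add[OF linear_on_comp_right[OF \<iota>(2) r(3)] f(2) g(2)]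
          linear_on_add[OF linear_on_comp_left[of UNIV \<iota>], of \<psi> \<psi>'] by simp
    qed
    moreover have "Hom H X Y \<subseteq> rhom A A' \<times> rhom B B'" using Hom_H unfolding XY by auto
    ultimately show ?thesis using fin_dim_subset[OF v fd] by blast
  qed
  show "Id H X \<in> Hom H X X" if X: "X \<in> Obj H" for X
  proof -
    obtain A B \<iota> where X': "X = (A, B, \<iota>)" by (cases X) auto
    note r = H_reps[OF X[unfolded X']] and \<iota> = H_ObjD(3)[OF X[unfolded X']]
    show ?thesis unfolding X' H_simps Hom_H using rid_hom[OF r(1)] rid_hom[OF r(2)] comp_rid[OF \<iota>] rid_comp[OF \<iota>] by simp
  qed
  show "Comp H (Comp H h g) f = Comp H h (Comp H g f)" for f g h
    by (cases f, cases g, cases h) (simp add: comp_fam_assoc)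
  fix X Y f assume X: "X \<in> Obj H" and Y: "Y \<in> Obj H" and fm: "f \<in> Hom H X Y"
  obtain A B \<iota> A' B' \<iota>' \<phi> \<psi> where XY: "X = (A, B, \<iota>)" "Y = (A', B', \<iota>')" "f = (\<phi>, \<psi>)" by (cases X, cases Y, cases f) auto
  note r = H_reps[OF X[unfolded XY]] H_reps[OF Y[unfolded XY]]
  have f: "\<phi> \<in> rhom A A'" "\<psi> \<in> rhom B B'" "\<psi> \<circ>\<circ> \<iota> = \<iota>' \<circ>\<circ> \<phi>" using fm unfolding XY Hom_H by auto
  show "Comp H f (Id H X) = f" "Comp H (Id H Y) f = f"
    unfolding XY H_simps comp_rid[OF f(1)] comp_rid[OF f(2)] rid_comp[OF f(1)] rid_comp[OF f(2)] by simp_all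
  fix Z g assume Z: "Z \<in> Obj H" and gm: "g \<in> Hom H Y Z"
  obtain A'' B'' \<iota>'' \<phi>' \<psi>' where Z': "Z = (A'', B'', \<iota>'')" "g = (\<phi>', \<psi>')" by (cases Z, cases g) auto
  note r'' = H_reps[OF Z[unfolded Z']]
  have g: "\<phi>' \<in> rhom A' A''" "\<psi>' \<in> rhom B' B''" "\<psi>' \<circ>\<circ> \<iota>' = \<iota>'' \<circ>\<circ> \<phi>'" using gm unfolding XY Z' Hom_H by auto
  have "(\<psi>' \<circ>\<circ> \<psi>) \<circ>\<circ> \<iota> = \<iota>'' \<circ>\<circ> (\<phi>' \<circ>\<circ> \<phi>)"
    unfolding comp_fam_assoc f(3) unfolding comp_fam_assoc[symmetric] g(3) ..
  then show "Comp H g f \<in> Hom H X Z"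
    unfolding XY Z' H_simps Hom_H using hom_comp[OF r(1) r''(1) f(1) g(1)] hom_comp[OF r(2) r''(2) f(2) g(2)] by simp
  show "Comp H g (Scal H c f) = Scal H c (Comp H g f)" for c
    unfolding XY Z' H_simps
    using linear_on_scale[OF linear_on_comp_right[OF g(1) r(3)] f(1)] linear_on_scale[OF linear_on_comp_right[OF g(2) r(4)] f(2)] by simp
  show "Comp H (Scal H c g) f = Scal H c (Comp H g f)" for c
    unfolding XY Z' H_simps by (simp add: scale_fam_def fun_eq_iff)
  show "Comp H g (f + f') = Comp H g f + Comp H g f'" if "f' \<in> Hom H X Y" for f'
  proof -
    obtain \<phi>2 \<psi>2 where f': "f' = (\<phi>2, \<psi>2)" "\<phi>2 \<in> rhom A A'" "\<psi>2 \<in> rhom B B'"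
      using \<open>f' \<in> Hom H X Y\<close> unfolding XY by (cases f') (auto simp: Hom_H)
    show ?thesis
      unfolding XY Z' f'(1) add_Pair H_simps
      using linear_on_add[OF linear_on_comp_right[OF g(1) r(3)] f(1) f'(2)] linear_on_add[OF linear_on_comp_right[OF g(2) r(4)] f(2) f'(3)]
      by simp
  qed
  show "Comp H (g + g') f = Comp H g f + Comp H g' f" if "g' \<in> Hom H Y Z" for g'
    unfolding XY Z' by (cases g') (simp add: fun_eq_iff)
qed

context
  fixes M :: "('v, 'a, 'u) qrep"
  assumes M: "M \<in> reps"
begin

abbreviation F where "F \<equiv> hat s Q M"

lemma fobj_hat: "fobj F (A, B, \<iota>) = (\<lambda>g. g \<circ>\<circ> \<iota>) ` rhom B M"
  by (simp add: hat_def Let_def)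

lemma fmap_hat: "h \<in> fobj F Y \<Longrightarrow> fmap F X Y (\<phi>, \<psi>) h = h \<circ>\<circ> \<phi>"
  by (cases Y) (simp add: hat_def Let_def)

lemma fmap_hat_outside: "h \<notin> fobj F Y \<Longrightarrow> fmap F X Y f h = 0"
  by (cases Y, cases f) (simp add: hat_def Let_def)

lemma fobj_hat_hom: "(A, B, \<iota>) \<in> Obj H \<Longrightarrow> h \<in> fobj F (A, B, \<iota>) \<Longrightarrow> h \<in> rhom A M"
  unfolding fobj_hat using hom_comp[OF H_reps(1) M H_ObjD(3)] by blast

lemma hat_mod_op: "F \<in> mod_op H (scale_fam s)"
proof -
  interpret fd_category H fam_scale by (rule H_fd_category)
  show ?thesis
  proof (rule mod_opI[OF vs_fam])
    fix X assume X: "X \<in> Obj H"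
    obtain A B \<iota> where X': "X = (A, B, \<iota>)" by (cases X) auto
    note XX = X[unfolded X']
    show "fin_dim (scale_fam s) (fobj F X)"
      unfolding X' fobj_hat by (rule fin_dim_image[OF vs_fam vs_fam rhom_fin_dim[OF H_reps(2)[OF XX] M] linear_on_comp_left])
    show "fmap F X X (Id H X) h = h" if "h \<in> fobj F X" for h
      using fmap_hat[OF that, of X "rid A" "rid B"] comp_rid[OF fobj_hat_hom[OF XX that[unfolded X']]] unfolding X' H_simps by simp
    fix Y f assume Y: "Y \<in> Obj H" and f: "f \<in> Hom H X Y"
    obtain A' B' \<iota>' \<phi> \<psi> where Y': "Y = (A', B', \<iota>')" "f = (\<phi>, \<psi>)" by (cases Y, cases f) auto
    have f': "\<phi> \<in> rhom A A'" "\<psi> \<in> rhom B B'" "\<psi> \<circ>\<circ> \<iota> = \<iota>' \<circ>\<circ> \<phi>" using f unfolding X' Y' Hom_H by auto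
    note YY = Y[unfolded Y'(1)]
    have subY: "module.subspace (scale_fam s) (fobj F Y)"
      unfolding Y' fobj_hat by (rule subspace_linear_image[OF vs_fam vs_fam rhom_subspace[OF H_reps(2)[OF YY] M] linear_on_comp_left])
    show "linear_on (scale_fam s) (scale_fam s) (fobj F Y) (fmap F X Y f)"
      using subspace_addD[OF vs_fam subY] subspace_scaleD[OF vs_fam subY] linear_on_comp_left[of "fobj F Y" \<phi>] fmap_hat
      unfolding Y'(2) by (auto simp: linear_on_def)
    show "fmap F X Y f h = 0" if "h \<notin> fobj F Y" for h using fmap_hat_outside[OF that] .
    fix h assume h: "h \<in> fobj F Y"
    obtain g where g: "g \<in> rhom B' M" "h = g \<circ>\<circ> \<iota>'" using h unfolding Y' fobj_hat by blast
    have hM: "h \<in> rhom A' M" using fobj_hat_hom[OF YY h[unfolded Y'(1)]] .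
    have "h \<circ>\<circ> \<phi> = (g \<circ>\<circ> \<psi>) \<circ>\<circ> \<iota>" unfolding g(2) comp_fam_assoc f'(3) ..
    then show "fmap F X Y f h \<in> fobj F X"
      unfolding Y'(2) fmap_hat[OF h] unfolding X' fobj_hat using hom_comp[OF H_reps(2)[OF XX] M f'(2) g(1)] by blast
    show "fmap F X Y (Scal H c f) h = scale_fam s c (fmap F X Y f h)" for c
      unfolding Y'(2) H_simps fmap_hat[OF h] using linear_on_scale[OF linear_on_comp_right[OF hM H_reps(1)[OF YY]] f'(1)] .
    show "fmap F X Y (f + f2) h = fmap F X Y f h + fmap F X Y f2 h" if f2: "f2 \<in> Hom H X Y" for f2
    proof -
      obtain \<phi>2 \<psi>2 where f2': "f2 = (\<phi>2, \<psi>2)" "\<phi>2 \<in> rhom A A'" using f2 unfolding X' Y' by (cases f2) (auto simp: Hom_H)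
      show ?thesis
        unfolding Y'(2) f2'(1) add_Pair fmap_hat[OF h]
        using linear_on_add[OF linear_on_comp_right[OF hM H_reps(1)[OF YY]] f'(1) f2'(2)] .
    qed
  next
    fix X Y Z f g h assume X: "X \<in> Obj H" and Y: "Y \<in> Obj H" and Z: "Z \<in> Obj H" and f: "f \<in> Hom H X Y"
      and g: "g \<in> Hom H Y Z" and h: "h \<in> fobj F Z"
    obtain A' B' \<iota>' A'' B'' \<iota>'' where YZ: "Y = (A', B', \<iota>')" "Z = (A'', B'', \<iota>'')" by (cases Y, cases Z) auto
    obtain \<phi> \<psi> \<phi>' \<psi>' where fg: "f = (\<phi>, \<psi>)" "g = (\<phi>', \<psi>')" by (cases f, cases g) auto
    have g': "\<phi>' \<in> rhom A' A''" "\<psi>' \<in> rhom B' B''" "\<psi>' \<circ>\<circ> \<iota>' = \<iota>'' \<circ>\<circ> \<phi>'" using g unfolding YZ fg Hom_H by auto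
    obtain k where k: "k \<in> rhom B'' M" "h = k \<circ>\<circ> \<iota>''" using h unfolding YZ fobj_hat by blast
    have "h \<circ>\<circ> \<phi>' = (k \<circ>\<circ> \<psi>') \<circ>\<circ> \<iota>'" unfolding k(2) comp_fam_assoc g'(3) ..
    then have "h \<circ>\<circ> \<phi>' \<in> fobj F Y"
      unfolding YZ fobj_hat using hom_comp[OF H_reps(2)[OF Y[unfolded YZ]] M g'(2) k(1)] by blast
    then show "fmap F X Z (Comp H g f) h = fmap F X Y f (fmap F Y Z g h)"
      unfolding fg H_simps using fmap_hat[OF h] fmap_hat by (simp add: comp_fam_assoc)
  qed
qed

lemma identity_in_H:
  assumes "R \<in> proj_reps s Q"
  shows "(R, R, rid R) \<in> Obj H"
proof (rule H_intro)
  note R = projD(1)[OF assms]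
  have "rep_mono Q R (rid R)" unfolding rep_mono_def by (auto simp: inj_on_def id_fam_apply)
  then show "(R, R, rid R) \<in> Obj (mono_proj s Q)" unfolding Obj_mono_proj using assms rid_hom[OF R] by blast
qed (use comp_rid in auto)

lemma fobj_hat_identity: "R \<in> reps \<Longrightarrow> fobj F (R, R, rid R) = rhom R M"
  unfolding fobj_hat using comp_rid by (auto simp: image_iff)

text \<open>Here \<open>Y0\<close> is \<open>R = R\<close> for a projective \<open>R\<close> with an epimorphism \<open>\<pi>\<close> to \<open>M\<close>, and \<open>Y1\<close> is what remains of the
  inclusion of the kernel of \<open>\<pi>\<close> after its summands \<open>0 \<rightarrow> P\<close> are removed.  The generator is \<open>\<pi>\<close>.\<close>

lemma hat_presentation:
  obtains Y0 Y1 m z where "fd_category.presents H F Y0 Y1 m z" "fmap F Y1 Y0 m ` fobj F Y0 = fobj F Y1"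
proof -
  interpret fd_category H fam_scale by (rule H_fd_category)
  obtain R I u \<pi> where n: "nakayama R I u" and \<pi>: "\<pi> \<in> rhom R M" "rep_epi Q R M \<pi>"
    by (rule enough_projectives[OF M]) blast
  note Rp = nakayama_projective[OF n]
  note R = projD(1)[OF Rp]
  let ?U = "\<lambda>v. {x \<in> space R v. \<pi> v x = 0}"
  let ?A = "subrep R ?U" and ?\<iota> = "id_fam (verts Q) ?U"
  note inv = kernel_invariant[OF R M \<pi>(1)]
  note Ap = subrep_proj[OF Rp inv] and \<iota> = subrep_incl[OF R inv]
  note A = projD(1)[OF Ap]
  have "(?A, R, ?\<iota>) \<in> Obj (mono_proj s Q)" unfolding Obj_mono_proj using Ap Rp \<iota> by blast
  then obtain B e \<rho> where Y1: "(?A, B, ?\<iota>) \<in> Obj H" and e: "e \<in> rhom B R" and \<rho>: "\<rho> \<in> rhom R B" "\<rho> \<circ>\<circ> e = rid B"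
    and e\<iota>: "e \<circ>\<circ> ?\<iota> = ?\<iota>" and \<rho>\<iota>: "\<rho> \<circ>\<circ> ?\<iota> = ?\<iota>"
    and dec: "\<And>A1 B1 \<iota>1 \<phi> \<psi>. (A1, B1, \<iota>1) \<in> Obj H \<Longrightarrow> \<phi> \<in> rhom A1 ?A \<Longrightarrow> \<psi> \<in> rhom B1 R \<Longrightarrow>
      \<psi> \<circ>\<circ> \<iota>1 = ?\<iota> \<circ>\<circ> \<phi> \<Longrightarrow> e \<circ>\<circ> (\<rho> \<circ>\<circ> \<psi>) = \<psi>"
    by (rule H_decomposition) blast
  note B = H_reps(2)[OF Y1]
  let ?Y0 = "(R, R, rid R)" and ?Y1 = "(?A, B, ?\<iota>)"
  note Y0 = identity_in_H[OF Rp]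
  have m: "(?\<iota>, e) \<in> Hom H ?Y1 ?Y0" unfolding Hom_H using \<iota>(1) e e\<iota> rid_comp[OF \<iota>(1)] by simp
  have z: "\<pi> \<in> fobj F ?Y0" unfolding fobj_hat_identity[OF R] by (rule \<pi>(1))
  have "presents F ?Y0 ?Y1 (?\<iota>, e) \<pi>"
    unfolding presents_def
  proof (intro conjI ballI impI Y0 Y1 m z)
    have "\<pi> \<circ>\<circ> ?\<iota> = 0" using hom_zero[OF \<pi>(1)] hom_outside_verts[OF \<pi>(1)] by (fastforce simp: fun_eq_iff id_fam_apply)
    then show "fmap F ?Y1 ?Y0 (?\<iota>, e) \<pi> = 0" unfolding fmap_hat[OF z] .
    fix X assume X: "X \<in> Obj H"
    obtain P S \<kappa> where X': "X = (P, S, \<kappa>)" by (cases X) auto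
    note XX = X[unfolded X']
    note \<kappa> = H_ObjD(3)[OF XX] and S = H_reps(2)[OF XX] and P = H_reps(1)[OF XX]
    show "\<exists>f\<in>Hom H X ?Y0. h = fmap F X ?Y0 f \<pi>" if "h \<in> fobj F X" for h
    proof -
      obtain g where g: "g \<in> rhom S M" "h = g \<circ>\<circ> \<kappa>" using \<open>h \<in> fobj F X\<close> unfolding X' fobj_hat by blast
      obtain \<psi> where \<psi>: "\<psi> \<in> rhom S R" "\<pi> \<circ>\<circ> \<psi> = g" using projD(2)[OF H_ObjD(2)[OF XX] R M \<pi> g(1)] by blast
      note \<psi>\<kappa> = hom_comp[OF P R \<kappa> \<psi>(1)]
      have "(\<psi> \<circ>\<circ> \<kappa>, \<psi>) \<in> Hom H X ?Y0" unfolding X' Hom_H using \<psi>\<kappa> \<psi>(1) rid_comp[OF \<psi>\<kappa>] by simp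
      moreover have "h = fmap F X ?Y0 (\<psi> \<circ>\<circ> \<kappa>, \<psi>) \<pi>" unfolding fmap_hat[OF z] g(2) \<psi>(2)[symmetric] comp_fam_assoc ..
      ultimately show ?thesis by blast
    qed
    show "\<exists>g\<in>Hom H X ?Y1. f = Comp H (?\<iota>, e) g" if f: "f \<in> Hom H X ?Y0" "fmap F X ?Y0 f \<pi> = 0" for f
    proof -
      obtain \<phi> \<psi> where f': "f = (\<phi>, \<psi>)" "\<phi> \<in> rhom P R" "\<psi> \<in> rhom S R" "\<psi> \<circ>\<circ> \<kappa> = \<phi>"
        using f(1) unfolding X' by (cases f) (auto simp: Hom_H rid_comp)
      have "\<pi> \<circ>\<circ> \<phi> = 0" using f(2) unfolding f'(1) fmap_hat[OF z] .
      then have "\<pi> v (\<phi> v x) = 0" for v x by (metis comp_fam_apply zero_fun_apply)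
      then have \<phi>: "\<phi> \<in> rhom P ?A" "?\<iota> \<circ>\<circ> \<phi> = \<phi>" using corestrict[OF R inv P f'(2)] hom_in[OF f'(2)] by auto
      have \<psi>: "e \<circ>\<circ> (\<rho> \<circ>\<circ> \<psi>) = \<psi>" by (rule dec[OF XX \<phi>(1) f'(3)]) (simp add: f'(4) \<phi>(2))
      have "(\<rho> \<circ>\<circ> \<psi>) \<circ>\<circ> \<kappa> = ?\<iota> \<circ>\<circ> \<phi>"
      proof -
        have "(\<rho> \<circ>\<circ> \<psi>) \<circ>\<circ> \<kappa> = \<rho> \<circ>\<circ> (?\<iota> \<circ>\<circ> \<phi>)" unfolding comp_fam_assoc f'(4) \<phi>(2) ..
        then show ?thesis unfolding comp_fam_assoc[symmetric] \<rho>\<iota> by (simp add: comp_fam_assoc)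
      qed
      then have "(\<phi>, \<rho> \<circ>\<circ> \<psi>) \<in> Hom H X ?Y1" unfolding X' Hom_H using \<phi>(1) hom_comp[OF S B f'(3) \<rho>(1)] by simp
      moreover have "f = Comp H (?\<iota>, e) (\<phi>, \<rho> \<circ>\<circ> \<psi>)" unfolding f'(1) H_simps \<phi>(2) \<psi> ..
      ultimately show ?thesis by blast
    qed
    show "g = 0" if g: "g \<in> Hom H X ?Y1" "Comp H (?\<iota>, e) g = 0" for g
    proof -
      obtain \<phi> \<psi> where g': "g = (\<phi>, \<psi>)" "\<phi> \<in> rhom P ?A" "\<psi> \<in> rhom S B" using g(1) unfolding X' by (cases g) (auto simp: Hom_H)
      have "?\<iota> \<circ>\<circ> \<phi> = 0" "e \<circ>\<circ> \<psi> = 0" using g(2) unfolding g'(1) H_simps zero_prod_def by auto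
      moreover have "\<rho> \<circ>\<circ> (e \<circ>\<circ> \<psi>) = \<psi>" unfolding comp_fam_assoc[symmetric] \<rho>(2) by (rule rid_comp[OF g'(3)])
      ultimately have "\<phi> = 0" "\<psi> = 0" using mono_cancel[OF A \<iota> g'(2)] comp_zero_right[OF \<rho>(1)] by auto
      then show ?thesis unfolding g'(1) zero_prod_def by simp
    qed
  qed
  moreover have "fmap F ?Y1 ?Y0 (?\<iota>, e) ` fobj F ?Y0 = fobj F ?Y1"
  proof
    show "fmap F ?Y1 ?Y0 (?\<iota>, e) ` fobj F ?Y0 \<subseteq> fobj F ?Y1" using fmap_in[OF hat_mod_op Y1 Y0 m] by blast
    show "fobj F ?Y1 \<subseteq> fmap F ?Y1 ?Y0 (?\<iota>, e) ` fobj F ?Y0"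
    proof
      fix h assume "h \<in> fobj F ?Y1"
      then obtain g where g: "g \<in> rhom B M" "h = g \<circ>\<circ> ?\<iota>" unfolding fobj_hat by blast
      have g\<rho>: "g \<circ>\<circ> \<rho> \<in> fobj F ?Y0" unfolding fobj_hat_identity[OF R] by (rule hom_comp[OF R M \<rho>(1) g(1)])
      have "h = fmap F ?Y1 ?Y0 (?\<iota>, e) (g \<circ>\<circ> \<rho>)" unfolding fmap_hat[OF g\<rho>] comp_fam_assoc \<rho>\<iota> g(2) ..
      then show "h \<in> fmap F ?Y1 ?Y0 (?\<iota>, e) ` fobj F ?Y0" using g\<rho> by blast
    qed
  qed
  ultimately show thesis by (rule that)
qed

text \<open>The Nakayama functor is an equivalence from projectives to injectives; this is its inverse on morphisms.\<close>

lemma nakayama_transpose: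
  assumes n0: "nakayama R0 I0 u0" and n1: "nakayama R1 I1 u1" and c: "c \<in> rhom I0 I1"
  obtains r where "r \<in> rhom R0 R1" "\<And>h. h \<in> rhom R1 I0 \<Longrightarrow> u1 (c \<circ>\<circ> h) = u0 (h \<circ>\<circ> r)"
proof -
  note R0 = nakayamaD(1)[OF n0] and I0 = nakayamaD(2)[OF n0] and u0 = nakayamaD(3)[OF n0]
    and R1 = nakayamaD(1)[OF n1] and I1 = nakayamaD(2)[OF n1] and u1 = nakayamaD(3)[OF n1]
  have "\<exists>r\<in>rhom R0 R1. \<forall>h\<in>rhom R1 I0. u1 (c \<circ>\<circ> h) = u0 (h \<circ>\<circ> r)"
  proof (rule double_annihilator[OF vs_fam vs_fam rhom_subspace[OF R1 I0] rhom_fin_dim[OF R0 R1]])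
    fix h assume h: "h \<in> rhom R1 I0"
    show "functional_on (scale_fam s) (rhom R0 R1) (\<lambda>r. u0 (h \<circ>\<circ> r))" by (rule functional_comp_right[OF u0 R0 R1 I0 h])
    assume "\<forall>r\<in>rhom R0 R1. u0 (h \<circ>\<circ> r) = 0"
    then have "h = 0" using nakayamaD(5)[OF n0 R1 h] by blast
    then show "u1 (c \<circ>\<circ> h) = 0" using comp_zero_right[OF c] linear_on_zero[OF u1 rhom_zero[OF R1 I1]] by simp
  qed (use functional_comp_left[OF u0 R0 R1 I0] functional_comp_right[OF u1 R1 I0 I1 c] in blast)+
  then show thesis using that by blast
qed

text \<open>Here \<open>Y0\<close> is \<open>R0 = R0\<close>, and \<open>Y1\<close> is the inclusion of the image of \<open>r : R0 \<rightarrow> R1\<close>, the transpose of \<open>c\<close>.  The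
  functional \<open>z\<close> is \<open>u0\<close> after \<open>j : M \<rightarrow> I0\<close>.  No nonzero map from \<open>R1\<close> to a projective vanishes on the image
  of \<open>r\<close>, because \<open>c\<close> is an epimorphism; so \<open>Y1\<close> is an object of \<open>H_cat s Q\<close>.\<close>

lemma hat_copresentation:
  obtains Y0 Y1 m z where "fd_category.copresents H fam_scale F Y0 Y1 m z"
proof -
  interpret fd_category H fam_scale by (rule H_fd_category)
  obtain R0 I0 u0 R1 I1 u1 j c where n0: "nakayama R0 I0 u0" and n1: "nakayama R1 I1 u1"
    and j: "j \<in> rhom M I0" "rep_mono Q M j" and c: "c \<in> rhom I0 I1" "rep_epi Q I0 I1 c"
    and ex: "\<And>v. v \<in> verts Q \<Longrightarrow> j v ` space M v = {y \<in> space I0 v. c v y = 0}"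
    by (rule injective_coresolution_exists[OF M]) blast
  obtain r where r: "r \<in> rhom R0 R1" and adj: "\<And>h. h \<in> rhom R1 I0 \<Longrightarrow> u1 (c \<circ>\<circ> h) = u0 (h \<circ>\<circ> r)"
    using nakayama_transpose[OF n0 n1 c(1)] by blast
  note I0 = nakayamaD(2)[OF n0] and u0 = nakayamaD(3)[OF n0] and I1 = nakayamaD(2)[OF n1] and u1 = nakayamaD(3)[OF n1]
  note R0p = nakayama_projective[OF n0] and R1p = nakayama_projective[OF n1]
  note R0 = projD(1)[OF R0p] and R1 = projD(1)[OF R1p]
  let ?U = "\<lambda>v. r v ` space R0 v"
  let ?K = "subrep R1 ?U" and ?\<kappa> = "id_fam (verts Q) ?U"
  note inv = image_invariant[OF R0 R1 r]
  note Kp = subrep_proj[OF R1p inv] and \<kappa> = subrep_incl[OF R1 inv]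
  note K = projD(1)[OF Kp]
  have rK: "r \<in> rhom R0 ?K" "?\<kappa> \<circ>\<circ> r = r" using corestrict[OF R1 inv R0 r] by auto
  have r_epi: "rep_epi Q R0 ?K r" unfolding rep_epi_def by simp
  have cj: "c \<circ>\<circ> j = 0"
  proof -
    have "(c \<circ>\<circ> j) v x = 0" if "v \<in> verts Q" "x \<in> space M v" for v x using ex[OF that(1)] that(2) by auto
    then show ?thesis using hom_eqI[OF hom_comp[OF M I1 j(1) c(1)] rhom_zero[OF M I1]] by simp
  qed
  have u00: "u0 0 = 0" by (rule linear_on_zero[OF u0 rhom_zero[OF R0 I0]])
  have u10: "u1 0 = 0" by (rule linear_on_zero[OF u1 rhom_zero[OF R1 I1]])
  let ?Y0 = "(R0, R0, rid R0)" and ?Y1 = "(?K, R1, ?\<kappa>)"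
  note Y0 = identity_in_H[OF R0p]
  have Y1: "?Y1 \<in> Obj H"
  proof (rule H_intro)
    show "?Y1 \<in> Obj (mono_proj s Q)" unfolding Obj_mono_proj using Kp R1p \<kappa> by blast
    fix P g assume P: "P \<in> proj_reps s Q" and g: "g \<in> rhom R1 P" "g \<circ>\<circ> ?\<kappa> = 0"
    have gr: "g \<circ>\<circ> r = 0"
    proof -
      have "g \<circ>\<circ> r = (g \<circ>\<circ> ?\<kappa>) \<circ>\<circ> r" unfolding comp_fam_assoc rK(2) ..
      then show ?thesis unfolding g(2) by simp
    qed
    show "g = 0"
    proof (rule nakayamaD(4)[OF n1 projD(1)[OF P] g(1)])
      fix h assume "h \<in> rhom P I1"
      then obtain h' where h': "h' \<in> rhom P I0" "c \<circ>\<circ> h' = h" using projD(2)[OF P I0 I1 c] by blast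
      have "u1 (h \<circ>\<circ> g) = u0 ((h' \<circ>\<circ> g) \<circ>\<circ> r)"
        unfolding h'(2)[symmetric] comp_fam_assoc[of c] by (rule adj[OF hom_comp[OF R1 I0 g(1) h'(1)]])
      then show "u1 (h \<circ>\<circ> g) = 0" unfolding comp_fam_assoc gr comp_zero_right[OF h'(1)] u00 .
    qed
  qed
  have m: "(r, r) \<in> Hom H ?Y0 ?Y1" unfolding Hom_H using rK r comp_rid[OF r] by simp
  define z where "z h = u0 (j \<circ>\<circ> h)" for h
  have lift: "\<exists>g\<in>rhom S M. h = j \<circ>\<circ> g" if S: "S \<in> reps" and h: "h \<in> rhom S I0" "c \<circ>\<circ> h = 0" for S h
  proof -
    have "c v (h v x) = 0" for v x using h(2) by (metis comp_fam_apply zero_fun_apply)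
    then have "h v x \<in> j v ` space M v" if "v \<in> verts Q" "x \<in> space S v" for v x
      unfolding ex[OF that(1)] using hom_in[OF h(1) that] by simp
    then show ?thesis using factor_through_mono[OF M I0 S j h(1)] by metis
  qed
  have "copresents F ?Y0 ?Y1 (r, r) z"
    unfolding copresents_def
  proof (intro conjI ballI impI Y0 Y1 m)
    show "functional_on (scale_fam s) (fobj F ?Y0) z"
      unfolding fobj_hat_identity[OF R0] z_def by (rule functional_comp_right[OF u0 R0 M I0 j(1)])
    show "z (fmap F ?Y0 ?Y1 (r, r) h) = 0" if h: "h \<in> fobj F ?Y1" for h
    proof -
      obtain g where g: "g \<in> rhom R1 M" "h = g \<circ>\<circ> ?\<kappa>" using h unfolding fobj_hat by blast
      have "z (fmap F ?Y0 ?Y1 (r, r) h) = u0 ((j \<circ>\<circ> g) \<circ>\<circ> r)"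
        unfolding z_def fmap_hat[OF h] unfolding g(2) comp_fam_assoc rK(2) ..
      also have "\<dots> = u1 (c \<circ>\<circ> (j \<circ>\<circ> g))" by (rule adj[OF hom_comp[OF R1 I0 g(1) j(1)], symmetric])
      also have "\<dots> = 0" unfolding comp_fam_assoc[symmetric] cj comp_zero_left by (rule u10)
      finally show ?thesis .
    qed
    fix X assume X: "X \<in> Obj H"
    obtain P S \<iota> where X': "X = (P, S, \<iota>)" by (cases X) auto
    note XX = X[unfolded X']
    note \<iota> = H_ObjD(3,4)[OF XX] and S = H_reps(2)[OF XX] and P = H_reps(1)[OF XX]
    have \<phi>Hom: "(\<phi>, \<iota> \<circ>\<circ> \<phi>) \<in> Hom H ?Y0 X" if "\<phi> \<in> rhom R0 P" for \<phi>
      unfolding X' Hom_H using that hom_comp[OF R0 S that \<iota>(1)] comp_rid by blast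
    show "h = 0" if h: "h \<in> fobj F X" "\<forall>f\<in>Hom H ?Y0 X. z (fmap F ?Y0 X f h) = 0" for h
    proof -
      have hM: "h \<in> rhom P M" using fobj_hat_hom[OF XX] h(1) unfolding X' by blast
      have "j \<circ>\<circ> h = 0"
      proof (rule nakayamaD(5)[OF n0 P hom_comp[OF P I0 hM j(1)]])
        fix \<phi> assume "\<phi> \<in> rhom R0 P"
        then have "z (fmap F ?Y0 X (\<phi>, \<iota> \<circ>\<circ> \<phi>) h) = 0" using h(2) \<phi>Hom by blast
        then show "u0 ((j \<circ>\<circ> h) \<circ>\<circ> \<phi>) = 0" unfolding z_def fmap_hat[OF h(1)] comp_fam_assoc .
      qed
      then show ?thesis using mono_cancel[OF M j hM] by blast
    qed
    show "\<exists>g\<in>Hom H ?Y1 X. f = Comp H g (r, r)"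
      if f: "f \<in> Hom H ?Y0 X" "\<forall>h\<in>fobj F X. z (fmap F ?Y0 X f h) = 0" for f
    proof -
      obtain \<phi> \<psi>0 where f': "f = (\<phi>, \<psi>0)" "\<phi> \<in> rhom R0 P" "\<psi>0 \<in> rhom R0 S" "\<psi>0 = \<iota> \<circ>\<circ> \<phi>"
        using f(1) unfolding X' by (cases f) (auto simp: Hom_H comp_rid)
      note \<iota>\<phi> = hom_comp[OF R0 S f'(2) \<iota>(1)]
      have kill: "u0 ((j \<circ>\<circ> g) \<circ>\<circ> (\<iota> \<circ>\<circ> \<phi>)) = 0" if g: "g \<in> rhom S M" for g
      proof -
        have h: "g \<circ>\<circ> \<iota> \<in> fobj F X" unfolding X' fobj_hat using g by blast
        have "z (fmap F ?Y0 X f (g \<circ>\<circ> \<iota>)) = 0" using f(2) h by blast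
        then show ?thesis unfolding f'(1) z_def fmap_hat[OF h] comp_fam_assoc .
      qed
      \<comment> \<open>a map \<open>h : S \<rightarrow> I0\<close> is orthogonal to all \<open>\<psi> r\<close> if and only if \<open>c h = 0\<close>, that is, if \<open>h\<close> factors through \<open>j\<close>\<close>
      have "\<exists>\<psi>\<in>rhom R1 S. \<forall>h\<in>rhom S I0. u0 (h \<circ>\<circ> (\<iota> \<circ>\<circ> \<phi>)) = u0 (h \<circ>\<circ> (\<psi> \<circ>\<circ> r))"
      proof (rule double_annihilator[OF vs_fam vs_fam rhom_subspace[OF S I0] rhom_fin_dim[OF R1 S]])
        show "functional_on (scale_fam s) (rhom S I0) (\<lambda>h. u0 (h \<circ>\<circ> (\<psi> \<circ>\<circ> r)))" if "\<psi> \<in> rhom R1 S" for \<psi>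
          by (rule functional_comp_left[OF u0 R0 S I0 hom_comp[OF R0 S r that]])
        show "functional_on (scale_fam s) (rhom S I0) (\<lambda>h. u0 (h \<circ>\<circ> (\<iota> \<circ>\<circ> \<phi>)))"
          by (rule functional_comp_left[OF u0 R0 S I0 \<iota>\<phi>])
        fix h assume h: "h \<in> rhom S I0"
        have eq: "u0 (h \<circ>\<circ> (\<psi> \<circ>\<circ> r)) = u1 ((c \<circ>\<circ> h) \<circ>\<circ> \<psi>)" if "\<psi> \<in> rhom R1 S" for \<psi>
          using adj[OF hom_comp[OF R1 I0 that h]] by (simp add: comp_fam_assoc)
        note ch = hom_comp[OF S I1 h c(1)]
        have l: "functional_on (scale_fam s) (rhom R1 S) (\<lambda>\<psi>. u1 ((c \<circ>\<circ> h) \<circ>\<circ> \<psi>))"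
          by (rule functional_comp_right[OF u1 R1 S I1 ch])
        show "functional_on (scale_fam s) (rhom R1 S) (\<lambda>\<psi>. u0 (h \<circ>\<circ> (\<psi> \<circ>\<circ> r)))"
          using l subspace_addD[OF vs_fam rhom_subspace[OF R1 S]] subspace_scaleD[OF vs_fam rhom_subspace[OF R1 S]]
          by (simp add: linear_on_def eq)
        assume "\<forall>\<psi>\<in>rhom R1 S. u0 (h \<circ>\<circ> (\<psi> \<circ>\<circ> r)) = 0"
        then have "c \<circ>\<circ> h = 0" using eq by (intro nakayamaD(5)[OF n1 S ch]) simp
        then obtain g where "g \<in> rhom S M" "h = j \<circ>\<circ> g" using lift[OF S h] by blast
        then show "u0 (h \<circ>\<circ> (\<iota> \<circ>\<circ> \<phi>)) = 0" using kill by blast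
      qed
      then obtain \<psi> where \<psi>: "\<psi> \<in> rhom R1 S" "\<And>h. h \<in> rhom S I0 \<Longrightarrow> u0 (h \<circ>\<circ> (\<iota> \<circ>\<circ> \<phi>)) = u0 (h \<circ>\<circ> (\<psi> \<circ>\<circ> r))" by blast
      note \<psi>r = hom_comp[OF R0 S r \<psi>(1)]
      have "(\<iota> \<circ>\<circ> \<phi>) - (\<psi> \<circ>\<circ> r) = 0"
      proof (rule nakayamaD(4)[OF n0 S rhom_diff[OF R0 S \<iota>\<phi> \<psi>r]])
        fix h assume h: "h \<in> rhom S I0"
        show "u0 (h \<circ>\<circ> ((\<iota> \<circ>\<circ> \<phi>) - (\<psi> \<circ>\<circ> r))) = 0"
          using linear_on_diff[OF vs_fam rhom_subspace[OF R0 S] functional_comp_right[OF u0 R0 S I0 h] \<iota>\<phi> \<psi>r] \<psi>(2)[OF h] by simp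
      qed
      then have eq: "\<psi> \<circ>\<circ> r = \<iota> \<circ>\<circ> \<phi>" by simp
      then have eqx: "\<psi> v (r v x) = \<iota> v (\<phi> v x)" for v x by (metis comp_fam_apply)
      have im: "(\<psi> \<circ>\<circ> ?\<kappa>) v x \<in> \<iota> v ` space P v" if v: "v \<in> verts Q" "x \<in> space ?K v" for v x
      proof -
        obtain y where y: "y \<in> space R0 v" "x = r v y" using v(2) by auto
        have "(\<psi> \<circ>\<circ> ?\<kappa>) v x = \<iota> v (\<phi> v y)" using v eqx[of v y] y by (simp add: id_fam_apply)
        then show ?thesis using hom_in[OF f'(2) v(1) y(1)] by blast
      qed
      obtain \<phi>2 where \<phi>2: "\<phi>2 \<in> rhom ?K P" "\<iota> \<circ>\<circ> \<phi>2 = \<psi> \<circ>\<circ> ?\<kappa>"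
        by (rule factor_through_mono[OF P S K \<iota> hom_comp[OF K S \<kappa>(1) \<psi>(1)] im]) blast+
      have "\<phi>2 \<circ>\<circ> r = \<phi>"
      proof -
        note \<phi>2r = hom_comp[OF R0 P rK(1) \<phi>2(1)]
        have "\<iota> \<circ>\<circ> (\<phi>2 \<circ>\<circ> r) = \<iota> \<circ>\<circ> \<phi>"
          unfolding comp_fam_assoc[symmetric] \<phi>2(2) unfolding comp_fam_assoc rK(2) by (rule eq)
        then have "\<iota> \<circ>\<circ> ((\<phi>2 \<circ>\<circ> r) - \<phi>) = 0" unfolding comp_diff_right[OF R0 P \<iota>(1) \<phi>2r f'(2)] by simp
        then have "(\<phi>2 \<circ>\<circ> r) - \<phi> = 0" using mono_cancel[OF P \<iota> rhom_diff[OF R0 P \<phi>2r f'(2)]] by blast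
        then show ?thesis by simp
      qed
      then have "f = Comp H (\<phi>2, \<psi>) (r, r)" unfolding f'(1) f'(4) H_simps eq by simp
      moreover have "(\<phi>2, \<psi>) \<in> Hom H ?Y1 X" unfolding X' Hom_H using \<phi>2 \<psi>(1) by simp
      ultimately show ?thesis by blast
    qed
    show "g = 0" if g: "g \<in> Hom H ?Y1 X" "Comp H g (r, r) = 0" for g
    proof -
      obtain \<phi> \<psi> where g': "g = (\<phi>, \<psi>)" "\<phi> \<in> rhom ?K P" "\<psi> \<in> rhom R1 S" "\<psi> \<circ>\<circ> ?\<kappa> = \<iota> \<circ>\<circ> \<phi>"
        using g(1) unfolding X' by (cases g) (auto simp: Hom_H)
      have "\<phi> \<circ>\<circ> r = 0" using g(2) unfolding g'(1) H_simps zero_prod_def by simp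
      then have \<phi>0: "\<phi> = 0" using epi_cancel[OF rK(1) r_epi g'(2)] by blast
      then have "\<psi> \<circ>\<circ> ?\<kappa> = 0" using g'(4) comp_zero_right[OF \<iota>(1)] by simp
      then have "\<psi> = 0" using H_elim[OF Y1 H_ObjD(2)[OF XX] g'(3)] by blast
      then show ?thesis unfolding g'(1) \<phi>0 zero_prod_def by simp
    qed
  qed
  then show thesis by (rule that)
qed

end

end

theorem theorem5p6:
  fixes s :: "'k::field \<Rightarrow> 'u::ab_group_add \<Rightarrow> 'u"
    and Q :: "('v, 'a) pre_digraph"
    and M :: "('v, 'a, 'u) qrep"
  assumes "vector_space s" and "\<not> fin_dim s UNIV"
    and "dynkin_quiver Q"
    and "M \<in> fd_reps s Q"
  shows "(proj_dim (H_cat s Q) (scale_fam s) (hat s Q M) \<le> 1 \<and>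
          inj_dim (H_cat s Q) (scale_fam s) (hat s Q M) \<le> 1) \<and>
         Ext1 (H_cat s Q) (scale_fam s) (hat s Q M) (hat s Q M)
           = {Ext1_zero (H_cat s Q) (scale_fam s) (hat s Q M) (hat s Q M)}"
proof -
  have "wf_digraph Q" using assms(3) unfolding dynkin_quiver_def by blast
  then have "quiver_reps s Q"
    using assms(1,2) dynkin_quiver_finite[OF assms(3)] by (intro quiver_reps.intro)
  then interpret tree_reps s Q
    using dynkin_quiver_finite_arcs[OF assms(3)] dynkin_quiver_unique_walk[OF assms(3)]
    by (intro tree_reps.intro tree_reps_axioms.intro)
  interpret C: fd_category "H_cat s Q" fam_scale by (rule H_fd_category)
  note F = hat_mod_op[OF assms(4)]
  obtain Y0 Y1 m z where p: "C.presents (hat s Q M) Y0 Y1 m z"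
    and onto: "fmap (hat s Q M) Y1 Y0 m ` fobj (hat s Q M) Y0 = fobj (hat s Q M) Y1"
    by (rule hat_presentation[OF assms(4)]) blast
  obtain Z0 Z1 m' z' where c: "C.copresents (hat s Q M) Z0 Z1 m' z'"
    by (rule hat_copresentation[OF assms(4)]) blast
  show ?thesis using C.proj_dim_le_1[OF F p] C.inj_dim_le_1[OF F c] C.Ext1_presented[OF F F p onto] by blast
qed

end
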